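(* The set $S_{15}$ of $15\times 15$ integer circulant determinants is exactly the set of integers of one of the following forms, where $m$ denotes an arbitrary integer with $\gcd(m,15)=1$ and $p$ denotes a prime: (a) an element of $15^2\mathbb Z$; (b) $m$; (c) $3^t m$ or $5^t m$ with $t\ge 3$; (d) $3^2k$ or $5^2k$, where (i) $k=mp$ with $p\equiv 7,11$ or $13 \pmod{15}$, or with $p\equiv 1\pmod{15}$ a good prime; or (ii) $k=mp^2$ with $p\equiv 4\pmod{15}$; or (iii) $k=mp^4$ with $p\equiv 2$ or $8\pmod{15}$.
   Context: $S_{15}=\{\det(a_{(j-i)\bmod 15})_{0\le i,j\le 14} : (a_0,\dots,a_{14})\in\mathbb Z^{15}\}$; equivalently $S_{15}=\{M_{15}(F):F\in\mathbb Z[x]\}$ with $M_{15}(F)=\prod_{j=1}^{15}F(\omega_{15}^j)$, $\omega_{n}=e^{2\pi i/n}$. For $F\in\mathbb Z[x]$ let $N_{15}(F)=\prod_{1\le j\le 15,\ \gcd(j,15)=1}F(\omega_{15}^j)$, and let $\Phi_d$ denote the $d$-th cyclotomic polynomial. A prime $p\equiv 1\pmod{15}$ is called good if there exist an integer $0\le j<15$, a sign $\pm$ and $g\in\mathbb Z[x]$ with $p=N_{15}\big((x^5-1)\pm x^j\Phi_3(x)+(x-1)\Phi_3(x)\Phi_5(x)g(x)\big)$ (otherwise $p$ is called bad; then it has such a representation with $\Phi_3(x)$ replaced by $\Phi_3(x)(x-1)$). *)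

theory Defs
  imports
    Complex_Main
    "HOL-Computational_Algebra.Polynomial"
    "HOL-Computational_Algebra.Primes"
    "HOL-Number_Theory.Cong"
    "Jordan_Normal_Form.Determinant"
begin

text \<open>For \<open>i, j < n\<close> the natural number \<open>j + n - i\<close> is congruent to \<open>j - i\<close> modulo \<open>n\<close>
  and involves no truncated subtraction.\<close>

definition circulant :: "nat \<Rightarrow> (nat \<Rightarrow> int) \<Rightarrow> int mat" where
  "circulant n a = mat n n (\<lambda>(i, j). a ((j + n - i) mod n))"

definition S15 :: "int set" where
  "S15 = {Determinant.det (circulant 15 a) | a. True}"

definition root_unity :: "nat \<Rightarrow> complex" where
  "root_unity n = exp (2 * of_real pi * \<i> / of_nat n)"

definition N15 :: "int poly \<Rightarrow> complex" where
  "N15 F = (\<Prod>j | 1 \<le> j \<and> j \<le> 15 \<and> gcd j 15 = 1. poly (map_poly of_int F) (root_unity 15 ^ j))"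

definition is_cyclotomic :: "nat \<Rightarrow> int poly \<Rightarrow> bool" where
  "is_cyclotomic d P \<longleftrightarrow>
     map_poly of_int P = (\<Prod>k | 1 \<le> k \<and> k \<le> d \<and> gcd k d = 1. [:- (root_unity d ^ k), 1:])"

definition cyclotomic :: "nat \<Rightarrow> int poly" where
  "cyclotomic d = (THE P. is_cyclotomic d P)"

definition good_prime :: "nat \<Rightarrow> bool" where
  "good_prime p \<longleftrightarrow> prime p \<and> [p = 1] (mod 15) \<and>
     (\<exists>j<15. \<exists>s\<in>{1, -1}. \<exists>g :: int poly.
        of_nat p = N15 ((monom 1 5 - 1) + smult s (monom 1 j * cyclotomic 3)
                        + (monom 1 1 - 1) * cyclotomic 3 * cyclotomic 5 * g))"

lemma is_cyclotomic_unique: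
  assumes "is_cyclotomic d P" "is_cyclotomic d Q"
  shows "P = Q"
proof -
  have "map_poly of_int P = (map_poly of_int Q :: complex poly)"
    using assms by (simp add: is_cyclotomic_def)
  then have "coeff P n = coeff Q n" for n
    by (auto simp: poly_eq_iff coeff_map_poly)
  then show ?thesis by (simp add: poly_eq_iff)
qed

lemma cyclotomic_eqI: "is_cyclotomic d P \<Longrightarrow> cyclotomic d = P"
  unfolding cyclotomic_def using is_cyclotomic_unique by blast

lemma root_unity_cis: "root_unity n = cis (2 * pi / n)"
  by (simp add: root_unity_def cis_conv_exp field_simps)

lemma root_unity_power: "0 < n \<Longrightarrow> root_unity n ^ n = 1"
  by (simp add: root_unity_cis DeMoivre)

lemma root_unity_neq_1:
  assumes "1 < n"
  shows "root_unity n \<noteq> 1"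
proof
  assume "root_unity n = 1"
  then have "cos (2 * pi / n) = cos 0"
    by (simp add: root_unity_cis complex_eq_iff)
  moreover have "2 * pi / n \<le> pi" using assms by (simp add: field_simps)
  moreover have "0 < 2 * pi / n" using assms by simp
  ultimately show False using cos_inj_pi[of "2 * pi / n" 0] by simp
qed

lemma root_unity_sum:
  assumes "1 < n"
  shows "(\<Sum>k<n. root_unity n ^ k) = 0"
  using assms root_unity_neq_1[of n] root_unity_power[of n]
  by (simp add: geometric_sum)

lemma cyclotomic_3: "cyclotomic 3 = [:1, 1, 1:]"
proof (rule cyclotomic_eqI)
  define w where "w = root_unity 3"
  have w3: "w ^ 3 = 1" and s: "1 + w + w ^ 2 = 0"
    using root_unity_power[of 3] root_unity_sum[of 3]
    by (simp_all add: w_def eval_nat_numeral algebra_simps)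
  have set: "{k. 1 \<le> k \<and> k \<le> 3 \<and> gcd k 3 = 1} = {1, 2 :: nat}"
  proof (rule Set.set_eqI)
    fix k :: nat
    have g: "gcd 2 3 = (1::nat)"
      by (simp_all add: gcd_non_0_nat)
    consider "k = 0 \<or> k > 3" | "k = 1 \<or> k = 2 \<or> k = 3" by linarith
    then show "k \<in> {k. 1 \<le> k \<and> k \<le> 3 \<and> gcd k 3 = 1} \<longleftrightarrow> k \<in> {1, 2}"
    proof cases
      case 1
      then show ?thesis by (elim disjE) simp_all
    next
      case 2
      then show ?thesis using g by (elim disjE) simp_all
    qed
  qed
  have "w * w ^ 2 = 1" using w3 by (simp add: eval_nat_numeral)
  moreover have "- w - w ^ 2 = 1"
  proof -
    have "- w - w ^ 2 = 1 - (1 + w + w ^ 2)" by simp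
    then show ?thesis by (simp add: s)
  qed
  moreover have "[:- w, 1:] * [:- (w ^ 2), 1:] = [:w * w ^ 2, - w - w ^ 2, 1:]"
    by simp
  ultimately have "map_poly of_int [:1, 1, 1:] = [:- w, 1:] * [:- (w ^ 2), 1:]"
    by (simp only:) (simp add: map_poly_pCons)
  then show "is_cyclotomic 3 [:1, 1, 1:]"
    unfolding is_cyclotomic_def set
    by (simp add: w_def[symmetric] del: mult_pCons_left mult_pCons_right)
qed

lemma cyclotomic_5: "cyclotomic 5 = [:1, 1, 1, 1, 1:]"
proof (rule cyclotomic_eqI)
  define w where "w = root_unity 5"
  have w5: "w ^ 5 = 1" and s: "1 + w + w ^ 2 + w ^ 3 + w ^ 4 = 0"
    using root_unity_power[of 5] root_unity_sum[of 5]
    by (simp_all add: w_def eval_nat_numeral algebra_simps)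
  have set: "{k. 1 \<le> k \<and> k \<le> 5 \<and> gcd k 5 = 1} = {1, 2, 3, 4 :: nat}"
  proof (rule Set.set_eqI)
    fix k :: nat
    have g: "gcd 2 5 = (1::nat)" "gcd 3 5 = (1::nat)" "gcd 4 5 = (1::nat)"
      by (simp_all add: gcd_non_0_nat)
    consider "k = 0 \<or> k > 5" | "k = 1 \<or> k = 2 \<or> k = 3 \<or> k = 4 \<or> k = 5" by linarith
    then show "k \<in> {k. 1 \<le> k \<and> k \<le> 5 \<and> gcd k 5 = 1} \<longleftrightarrow> k \<in> {1, 2, 3, 4}"
    proof cases
      case 1
      then show ?thesis by (elim disjE) simp_all
    next
      case 2
      then show ?thesis using g by (elim disjE) simp_all
    qed
  qed
  have p1: "[:- w, 1:] * [:- (w ^ 4), 1:] = [:1, - w - w ^ 4, 1:]"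
    using w5 by (simp add: power_Suc[symmetric] eval_nat_numeral mult.assoc)
  have p2: "[:- (w ^ 2), 1:] * [:- (w ^ 3), 1:] = [:1, - (w ^ 2) - w ^ 3, 1:]"
    using w5 by (simp add: eval_nat_numeral mult.assoc)
  have c1: "(- w - w ^ 4) + (- (w ^ 2) - w ^ 3) = 1"
  proof -
    have "(- w - w ^ 4) + (- (w ^ 2) - w ^ 3) = 1 - (1 + w + w ^ 2 + w ^ 3 + w ^ 4)"
      by simp
    then show ?thesis by (simp add: s)
  qed
  have c2: "(- w - w ^ 4) * (- (w ^ 2) - w ^ 3) = - 1"
  proof -
    have "(- w - w ^ 4) * (- (w ^ 2) - w ^ 3) = w ^ 3 + w ^ 4 + w ^ 5 * (w + w ^ 2)"
      by (simp add: eval_nat_numeral algebra_simps)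
    also have "\<dots> = (1 + w + w ^ 2 + w ^ 3 + w ^ 4) - 1" by (simp add: w5)
    finally show ?thesis by (simp add: s)
  qed
  have "[:1, a, 1:] * [:1, b, 1:] = [:1, a + b, 2 + a * b, a + b, 1:]" for a b :: complex
    by (simp add: algebra_simps)
  then have "map_poly of_int [:1, 1, 1, 1, 1:]
      = ([:- w, 1:] * [:- (w ^ 4), 1:]) * ([:- (w ^ 2), 1:] * [:- (w ^ 3), 1:])"
    unfolding p1 p2 by (simp only: c1 c2) (simp add: map_poly_pCons)
  then show "is_cyclotomic 5 [:1, 1, 1, 1, 1:]"
    unfolding is_cyclotomic_def set
    by (simp add: w_def[symmetric] mult_ac del: mult_pCons_left mult_pCons_right)
qed

end

theory Submission
  imports Defs "HOL-Number_Theory.Quadratic_Reciprocity" "HOL-Number_Theory.Residue_Primitive_Roots"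
    "HOL-Computational_Algebra.Nth_Powers"
begin

text \<open>
  The determinant is \<open>F(1) N\<^sub>3(F) N\<^sub>5(F) N\<^sub>1\<^sub>5(F)\<close>, where \<open>N\<^sub>d\<close> is the product of the values of the
  integer polynomial \<open>F\<close> at the primitive \<open>d\<close>-th roots of unity, and the values at the four kinds of
  roots can be prescribed up to congruences modulo the primes above 3 and 5.  The only obstruction
  appears for determinants exactly divisible by \<open>3\<^sup>2\<close> or \<open>5\<^sup>2\<close>.  There the product of the quadratic
  characters of \<open>F(\<omega>\<^sub>1\<^sub>5)\<close> modulo the primes above 3 and 5 is \<open>-1\<close>, unless a prime as in (d) divides
  \<open>N\<^sub>3(F)\<close> or \<open>N\<^sub>5(F)\<close>.  This character is trivial on units and on the primes above \<open>p \<equiv> 14\<close>: it can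
  be read off from the trace of the norm of \<open>F(\<omega>\<^sub>1\<^sub>5)\<close> to \<open>\<rat>(\<surd>-15)\<close>.  It is \<open>-1\<close> on the primes above
  \<open>p \<equiv> 2, 4, 8\<close>, and the good primes \<open>p \<equiv> 1\<close> are those on which it is \<open>-1\<close>.  As \<open>\<int>[\<omega>\<^sub>d]\<close> is norm-Euclidean
  for \<open>d = 3, 5, 15\<close>, every norm splits into norms of prime elements.
\<close>

hide_const (open) up_ring.monom up_ring.coeff

text \<open>The sign -1 has its origin in 3 being a nonsquare modulo 5 and 5 a nonsquare modulo 3.
  The residue fields above 3 and 5 have 81 and 25 elements, so the quadratic characters are y^40 and
  y^12, that is, the norm to F_3 and the square of the norm to F_5. They can be read off from
  \<open>nm5 F\<close> modulo 3 and from \<open>(nm3 F)\<^sup>2\<close> modulo 5. If 3 divides F(1),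
  a factor x - 1 of norm 3 splits off at the cube roots of unity, and 3^2 = -1 modulo 5; if 5
  divides F(1), a factor of norm 5 splits off at the fifth roots, and 5 = -1 modulo 3. In the other
  direction everything rests on units filling the norm 1 groups of the residue fields: the six units
  \<open>\<plusminus>\<omega>^j\<close> modulo 5 and the powers of 1 + x^2 modulo 3. An element can
  therefore be moved to any other one with the same norm residue. No ideal theory enters. An
  algebraic integer is a polynomial modulo a cyclotomic polynomial, and a gcd with a rational prime
  p, whose norm is a power of p, stands in for a prime element. The exponent is pinned down by the
  fact that norms prime to the order of the roots of unity are 1 modulo that order.\<close>

definition ev :: "int poly \<Rightarrow> complex \<Rightarrow> complex" where
  "ev F z = poly (map_poly of_int F) z"

lemma ev_0 [simp]: "ev 0 z = 0"
  by (simp add: ev_def)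

lemma ev_pCons [simp]: "ev (pCons a F) z = of_int a + z * ev F z"
  by (cases "F = 0 \<and> a = 0") (auto simp: ev_def map_poly_pCons)

lemma ev_1 [simp]: "ev 1 z = 1"
  by (simp add: one_pCons)

lemma ev_add [simp]: "ev (F + G) z = ev F z + ev G z"
proof (induction F arbitrary: G)
  case (pCons a F)
  then show ?case by (cases G) (simp add: algebra_simps)
qed simp

lemma ev_minus [simp]: "ev (- F) z = - ev F z"
  by (induction F) simp_all

lemma ev_diff [simp]: "ev (F - G) z = ev F z - ev G z"
  using ev_add[of F "- G" z] by simp

lemma ev_smult [simp]: "ev (smult c F) z = of_int c * ev F z"
  by (induction F) (simp_all add: algebra_simps)

lemma ev_mult [simp]: "ev (F * G) z = ev F z * ev G z"
  by (induction F) (simp_all add: algebra_simps)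

lemma ev_power [simp]: "ev (F ^ n) z = ev F z ^ n"
  by (induction n) simp_all

lemma ev_prod [simp]: "ev (prod f A) z = (\<Prod>a\<in>A. ev (f a) z)"
  by (induction A rule: infinite_finite_induct) simp_all

lemma ev_sum [simp]: "ev (sum f A) z = (\<Sum>a\<in>A. ev (f a) z)"
  by (induction A rule: infinite_finite_induct) simp_all

lemma ev_monom [simp]: "ev (monom a n) z = of_int a * z ^ n"
  by (induction n) (simp_all add: monom_0 monom_Suc)

lemma ev_pcompose [simp]: "ev (pcompose F G) z = ev F (ev G z)"
  by (induction F) (simp_all add: pcompose_pCons)

lemma ev_cnj: "ev F (cnj z) = cnj (ev F z)"
  by (induction F) simp_all

lemma ev_dvd: "P dvd F \<Longrightarrow> ev P z = 0 \<Longrightarrow> ev F z = 0"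
  by (auto elim!: dvdE)

lemma monic_division:
  fixes P F :: "int poly"
  assumes "lead_coeff P = 1" "0 < degree P"
  shows "\<exists>Q R. F = P * Q + R \<and> degree R < degree P"
proof -
  obtain Q R where qr: "pseudo_divmod F P = (Q, R)" by force
  have "P \<noteq> 0" using assms by auto
  from pseudo_divmod[OF this qr] assms show ?thesis
    by (intro exI[of _ Q] exI[of _ R]) auto
qed

section \<open>Norms as products over a set of conjugate roots\<close>

text \<open>The assumption \<open>bij\<close> stands in for the Galois group: from any root, the
  exponents in \<open>hs\<close> reach all roots. Conjugation of a value becomes the substitution of
  x^h in the polynomial.\<close>

locale cyc =
  fixes Phi :: "int poly" and Z :: "complex set" and hs :: "nat set"
  assumes monic: "lead_coeff Phi = 1"
    and degree_Phi: "degree Phi = card Z"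
    and finite_Z: "finite Z" and Z_nonempty: "Z \<noteq> {}"
    and root: "z \<in> Z \<Longrightarrow> ev Phi z = 0"
    and hs1: "1 \<in> hs" and finite_hs: "finite hs"
    and bij: "z \<in> Z \<Longrightarrow> bij_betw (\<lambda>h. z ^ h) hs Z"
    and cnj_Z: "z \<in> Z \<Longrightarrow> cnj z \<in> Z"
    and Im_Z: "z \<in> Z \<Longrightarrow> Im z \<noteq> 0"
begin

lemma card_pos: "0 < card Z"
  using finite_Z Z_nonempty by (simp add: card_gt_0_iff)

lemma some_Z: obtains z where "z \<in> Z"
  using Z_nonempty by blast

lemma low_degree_eq_0:
  assumes "degree (R :: complex poly) < card Z" "\<And>z. z \<in> Z \<Longrightarrow> poly R z = 0"
  shows "R = 0"
proof (rule ccontr)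
  assume "R \<noteq> 0"
  then have "finite {z. poly R z = 0}" "card {z. poly R z = 0} \<le> degree R"
    by (simp_all add: poly_roots_finite card_poly_roots_bound)
  moreover have "card Z \<le> card {z. poly R z = 0}"
    using assms(2) calculation(1) by (intro card_mono) auto
  ultimately show False using assms(1) by simp
qed

lemma low_degree_int_eq_0:
  assumes "degree (R :: int poly) < card Z" "\<And>z. z \<in> Z \<Longrightarrow> ev R z = 0"
  shows "R = 0"
proof -
  have "map_poly of_int R = (0 :: complex poly)"
    using assms by (intro low_degree_eq_0) (auto simp: ev_def degree_map_poly)
  then have "coeff R n = 0" for n
    by (metis coeff_0 coeff_map_poly of_int_0 of_int_eq_iff)
  then show ?thesis by (simp add: poly_eq_iff)
qed

lemma division: "\<exists>Q R. F = Phi * Q + R \<and> degree R < card Z"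
  using monic_division[OF monic] degree_Phi card_pos by simp

lemma Phi_dvd_iff: "Phi dvd F \<longleftrightarrow> (\<forall>z\<in>Z. ev F z = 0)"
proof
  assume "Phi dvd F" then show "\<forall>z\<in>Z. ev F z = 0" using root ev_dvd by blast
next
  assume *: "\<forall>z\<in>Z. ev F z = 0"
  obtain Q R where QR: "F = Phi * Q + R" "degree R < card Z" using division by blast
  have "R = 0" using * QR root by (intro low_degree_int_eq_0) auto
  then show "Phi dvd F" using QR by simp
qed

text \<open>The remainder of \<open>F\<close> modulo \<open>Phi\<close>, minus the constant, has
  degree below \<open>card Z\<close> and vanishes on all of \<open>Z\<close>, so it is zero. This is
  the device by which complex products turn out to be integers.\<close>

lemma constant_value:
  assumes "\<And>z. z \<in> Z \<Longrightarrow> ev F z = c"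
  shows "\<exists>n. c = of_int n \<and> Phi dvd F - [:n:]"
proof -
  obtain Q R where QR: "F = Phi * Q + R" "degree R < card Z" using division by blast
  define R' where "R' = map_poly of_int R - [:c:]"
  have "degree R' < card Z" unfolding R'_def
    using QR(2) card_pos by (intro degree_diff_less) (auto simp: degree_map_poly)
  then have "R' = 0"
    using assms root QR by (intro low_degree_eq_0) (auto simp: R'_def ev_def[symmetric])
  then have "map_poly of_int R = [:c:]" by (simp add: R'_def)
  then have "coeff (map_poly of_int R) 0 = c" by simp
  then have "c = of_int (coeff R 0)" by (simp add: coeff_map_poly)
  moreover from this assms have "Phi dvd F - [:coeff R 0:]"
    by (auto simp: Phi_dvd_iff)
  ultimately show ?thesis by blast
qed

text \<open>A single integer polynomial whose value at every root is the whole product of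
  conjugates, so that \<open>constant_value\<close> applies to the norm.\<close>

definition conjprod :: "int poly \<Rightarrow> int poly" where
  "conjprod F = (\<Prod>h\<in>hs. pcompose F (monom 1 h))"

lemma ev_conjprod: "z \<in> Z \<Longrightarrow> ev (conjprod F) z = (\<Prod>z\<in>Z. ev F z)"
  unfolding conjprod_def using prod.reindex_bij_betw[OF bij, of z "ev F"] by simp

definition N :: "int poly \<Rightarrow> int" where
  "N F = (THE n. of_int n = (\<Prod>z\<in>Z. ev F z))"

lemma N_eq: "of_int (N F) = (\<Prod>z\<in>Z. ev F z)"
proof -
  obtain n where n: "(\<Prod>z\<in>Z. ev F z) = of_int n"
    using constant_value[of "conjprod F" "\<Prod>z\<in>Z. ev F z"] by (auto simp: ev_conjprod)
  show ?thesis unfolding N_def n of_int_eq_iff by simp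
qed

lemma N_unique: "of_int n = (\<Prod>z\<in>Z. ev F z) \<Longrightarrow> N F = n"
  using N_eq[of F] by (metis of_int_eq_iff)

lemma N_eq_hs: "z \<in> Z \<Longrightarrow> of_int (N F) = (\<Prod>h\<in>hs. ev F (z ^ h))"
  using prod.reindex_bij_betw[OF bij, of z "ev F"] N_eq by simp

lemma Phi_dvd_conjprod: "Phi dvd conjprod F - [:N F:]"
  by (auto simp: Phi_dvd_iff ev_conjprod N_eq)

lemma N_mult [simp]: "N (F * G) = N F * N G"
  by (rule N_unique) (simp add: N_eq prod.distrib)

lemma N_1 [simp]: "N 1 = 1"
  by (rule N_unique) simp

lemma N_power [simp]: "N (F ^ k) = N F ^ k"
  by (induction k) simp_all

lemma N_const: "N [:c:] = c ^ card Z"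
  by (rule N_unique) simp

lemma N_smult: "N (smult c F) = c ^ card Z * N F"
  by (rule N_unique) (simp add: N_eq prod.distrib)

lemma N_cong: "Phi dvd F - G \<Longrightarrow> N F = N G"
  by (rule N_unique) (auto simp: N_eq Phi_dvd_iff intro!: prod.cong)

lemma N_eq_0_iff: "N F = 0 \<longleftrightarrow> (\<exists>z\<in>Z. ev F z = 0)"
  using N_eq[of F] finite_Z by (metis of_int_0_eq_iff prod_zero_iff)

text \<open>No root is real, so the roots pair off under complex conjugation and the norm is a
  product of squared absolute values.\<close>

lemma N_nonneg: "0 \<le> N F"
proof -
  define Zp where "Zp = {z\<in>Z. 0 < Im z}"
  have fin: "finite Zp" using finite_Z by (simp add: Zp_def)
  have Z: "Z = Zp \<union> cnj ` Zp"
  proof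
    show "Z \<subseteq> Zp \<union> cnj ` Zp"
    proof
      fix z assume z: "z \<in> Z"
      show "z \<in> Zp \<union> cnj ` Zp"
      proof (cases "0 < Im z")
        case False
        then have "cnj z \<in> Zp" using z cnj_Z Im_Z[OF z] by (auto simp: Zp_def)
        then show ?thesis by (metis UnI2 complex_cnj_cnj image_eqI)
      qed (use z in \<open>auto simp: Zp_def\<close>)
    qed
  qed (auto simp: Zp_def cnj_Z)
  have "of_int (N F) = (\<Prod>z\<in>Zp. ev F z) * (\<Prod>z\<in>cnj ` Zp. ev F z)"
    unfolding N_eq using fin by (subst Z) (rule prod.union_disjoint, auto simp: Zp_def)
  also have "(\<Prod>z\<in>cnj ` Zp. ev F z) = (\<Prod>z\<in>Zp. cnj (ev F z))"
    by (subst prod.reindex) (auto simp: inj_on_def ev_cnj)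
  also have "(\<Prod>z\<in>Zp. ev F z) * \<dots> = of_real ((\<Prod>z\<in>Zp. cmod (ev F z))\<^sup>2)"
    by (simp add: prod.distrib[symmetric] complex_norm_square prod_power_distrib del: of_real_power)
  finally have "complex_of_real (of_int (N F)) = of_real ((\<Prod>z\<in>Zp. cmod (ev F z))\<^sup>2)"
    by simp
  then have "real_of_int (N F) = (\<Prod>z\<in>Zp. cmod (ev F z))\<^sup>2" using of_real_eq_iff by blast
  then have "0 \<le> real_of_int (N F)" by simp
  then show ?thesis by simp
qed

text \<open>Nonnegative integers with product 1 are both 1, so an explicit inverse modulo
  \<open>Phi\<close> certifies a unit.\<close>

lemma N_unit: "Phi dvd F * G - 1 \<Longrightarrow> N F = 1"
  using N_cong[of "F * G" 1] N_nonneg[of F] by (auto simp: zmult_eq_1_iff)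

text \<open>The two conjugate products differ by \<open>smult m S\<close>, and \<open>S\<close>
  takes the same value at all roots; by \<open>constant_value\<close> that value is an
  integer.\<close>

lemma N_mod: "[N (F + smult m G) = N F] (mod m)"
proof -
  have "\<exists>S. conjprod (F + smult m G) = conjprod F + smult m S"
  proof -
    have "\<exists>S. (\<Prod>h\<in>A. pcompose (F + smult m G) (monom 1 h))
            = (\<Prod>h\<in>A. pcompose F (monom 1 h)) + smult m S" if "finite A" for A :: "nat set"
      using that
    proof (induction A)
      case (insert h A)
      then obtain S where S: "(\<Prod>h\<in>A. pcompose (F + smult m G) (monom 1 h))
            = (\<Prod>h\<in>A. pcompose F (monom 1 h)) + smult m S" by blast
      show ?case
        unfolding prod.insert[OF insert(1,2)] S
        by (intro exI[of _ "pcompose F (monom 1 h) * S + pcompose G (monom 1 h) *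
            ((\<Prod>h\<in>A. pcompose F (monom 1 h)) + smult m S)"])
           (simp add: pcompose_add pcompose_smult algebra_simps smult_add_right)
    qed (auto intro: exI[of _ 0])
    then show ?thesis unfolding conjprod_def using finite_hs by blast
  qed
  then obtain S where S: "conjprod (F + smult m G) = conjprod F + smult m S" by blast
  show ?thesis
  proof (cases "m = 0")
    case False
    have "ev S z = (of_int (N (F + smult m G)) - of_int (N F)) / of_int m" if "z \<in> Z" for z
      using arg_cong[OF S, of "\<lambda>p. ev p z"] ev_conjprod[OF that] N_eq False by (simp add: field_simps)
    then obtain n where "(of_int (N (F + smult m G)) - of_int (N F)) / of_int m = (of_int n :: complex)"
      using constant_value[of S] by blast
    then have "of_int (N (F + smult m G) - N F) = (of_int (m * n) :: complex)"
      using False by (simp add: field_simps)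
    then have "N (F + smult m G) - N F = m * n" by (simp only: of_int_eq_iff)
    then show ?thesis by (simp add: cong_iff_dvd_diff)
  qed simp
qed

text \<open>Dividing by \<open>q\<close> keeps the norm zero, so \<open>H\<close> is divisible by
  every power of \<open>q\<close> modulo \<open>Phi\<close>. The coefficients of the reduced
  remainder inherit this and must vanish.\<close>

lemma N_zero_imp_dvd_by_descent:
  assumes q: "1 < (q :: int)" and step: "\<And>H. N H = 0 \<Longrightarrow> \<exists>H'. Phi dvd H - smult q H'"
    and H: "N H = 0"
  shows "Phi dvd H"
proof -
  have pow: "\<exists>H'. Phi dvd H - smult (q ^ k) H'" for k
  proof (induction k)
    case (Suc k)
    then obtain H' where H': "Phi dvd H - smult (q ^ k) H'" by blast
    have "N H' = 0" using N_cong[OF H'] H q by (simp add: N_smult)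
    then obtain H'' where "Phi dvd H' - smult q H''" using step by blast
    then have "Phi dvd H - smult (q ^ Suc k) H''" using H' by (auto simp: Phi_dvd_iff)
    then show ?case by blast
  qed (auto intro: exI[of _ H])
  obtain Q R where R: "H = Phi * Q + R" "degree R < card Z" using division by blast
  have "coeff R i = 0" for i
  proof -
    have "q ^ k dvd coeff R i" for k
    proof -
      obtain H' where H': "Phi dvd H - smult (q ^ k) H'" using pow by blast
      obtain Q' R' where R': "H' = Phi * Q' + R'" "degree R' < card Z" using division by blast
      have "ev (R - smult (q ^ k) R') z = 0" if "z \<in> Z" for z
        using H' that R(1) R'(1) root by (auto simp: Phi_dvd_iff)
      moreover have "degree (R - smult (q ^ k) R') < card Z"
        using R R' by (intro degree_diff_less) (auto intro: le_less_trans[OF degree_smult_le])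
      ultimately have "R - smult (q ^ k) R' = 0" using low_degree_int_eq_0 by blast
      then have "R = smult (q ^ k) R'" by simp
      then show ?thesis by simp
    qed
    moreover have "\<bar>coeff R i\<bar> < q ^ nat (\<bar>coeff R i\<bar>)"
    proof -
      have "int (nat \<bar>coeff R i\<bar>) < 2 ^ nat \<bar>coeff R i\<bar>"
        using of_nat_less_two_power by blast
      also have "\<dots> \<le> q ^ nat \<bar>coeff R i\<bar>" using q by (intro power_mono) auto
      finally show ?thesis by simp
    qed
    ultimately show ?thesis
      using dvd_imp_le_int[of "coeff R i" "q ^ nat \<bar>coeff R i\<bar>"] q
      by (metis abs_ge_self leD order_trans)
  qed
  then have "R = 0" by (simp add: poly_eq_iff)
  then show ?thesis using R by simp
qed

end

section \<open>Division with remainder, gcds and divisors above a rational prime\<close>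

text \<open>\<open>rounding\<close> bounds a sum of squares instead of a norm: this is a covering
  property of a lattice that can be checked coordinate by coordinate. In \<open>N_cong_1\<close> the
  modulus will be the order 3, 5 or 15 of the roots.\<close>

locale euclid = cyc +
  fixes q :: int
  assumes rounding: "\<exists>Q :: int poly.
      (\<Sum>z\<in>Z. (cmod (poly (map_poly of_real X) z - ev Q z))\<^sup>2) < real (card Z)"
    and N_zero_imp_dvd: "N F = 0 \<Longrightarrow> Phi dvd F"
    and N_cong_1: "coprime (N F) q \<Longrightarrow> [N F = 1] (mod q)"
begin

lemma euclidean_step:
  assumes "N B \<noteq> 0"
  shows "\<exists>Q. N (A - Q * B) < N B"
proof -
  \<comment> \<open>The product of the other conjugates of \<open>B\<close>; \<open>B'\<close>
    divided by \<open>N B\<close> is the inverse of \<open>B\<close> at every root, and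
    \<open>X\<close> is the exact quotient of \<open>A\<close> by \<open>B\<close>.\<close>
  define B' where "B' = (\<Prod>h\<in>hs - {1}. pcompose B (monom 1 h))"
  have BB': "ev B z * ev B' z = of_int (N B)" if "z \<in> Z" for z
    using N_eq_hs[OF that, of B] prod.remove[OF finite_hs hs1, of "\<lambda>h. ev B (z ^ h)"]
    by (simp add: B'_def)
  define X :: "real poly" where "X = smult (1 / of_int (N B)) (map_poly of_int (A * B'))"
  have real_ev: "poly (map_poly complex_of_real (map_poly real_of_int F)) z = ev F z" for F z
    by (induction F) (simp_all add: map_poly_pCons)
  have X: "poly (map_poly of_real X) z * ev B z = ev A z" if "z \<in> Z" for z
  proof -
    have "map_poly complex_of_real (smult c p) = smult (of_real c) (map_poly of_real p)" for c p
      by (rule poly_eqI) (simp add: coeff_map_poly)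
    then have "poly (map_poly of_real X) z = ev A z * ev B' z / of_int (N B)"
      unfolding X_def by (simp only: poly_smult real_ev ev_mult) simp
    then have "poly (map_poly of_real X) z * ev B z = ev A z * (ev B z * ev B' z) / of_int (N B)"
      by simp
    then show ?thesis using assms unfolding BB'[OF that] by simp
  qed
  obtain Q where Q: "(\<Sum>z\<in>Z. (cmod (poly (map_poly of_real X) z - ev Q z))\<^sup>2) < real (card Z)"
    using rounding by blast
  define t where "t z = cmod (poly (map_poly of_real X) z - ev Q z)" for z
  \<comment> \<open>The inequality of arithmetic and geometric means, obtained by multiplying
    \<open>(t z)\<^sup>2 \<le> exp ((t z)\<^sup>2 - 1)\<close> over the roots.\<close>
  have "(\<Prod>z\<in>Z. (t z)\<^sup>2) \<le> (\<Prod>z\<in>Z. exp ((t z)\<^sup>2 - 1))"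
  proof (intro prod_mono conjI)
    fix z show "(t z)\<^sup>2 \<le> exp ((t z)\<^sup>2 - 1)" using exp_ge_add_one_self[of "(t z)\<^sup>2 - 1"] by simp
  qed simp
  also have "\<dots> = exp ((\<Sum>z\<in>Z. (t z)\<^sup>2) - real (card Z))"
    using finite_Z by (simp add: exp_sum[symmetric] sum_subtractf)
  also have "\<dots> < 1" using Q by (simp add: t_def)
  finally have "(\<Prod>z\<in>Z. t z)\<^sup>2 < 1" by (simp add: prod_power_distrib)
  then have small: "(\<Prod>z\<in>Z. t z) < 1"
    unfolding abs_square_less_1 by simp
  have "real_of_int (N (A - Q * B)) = (\<Prod>z\<in>Z. t z) * real_of_int (N B)"
  proof -
    have abs: "real_of_int (N F) = (\<Prod>z\<in>Z. cmod (ev F z))" for F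
      using arg_cong[OF N_eq[of F], of cmod] N_nonneg[of F] by (simp add: prod_norm)
    have "cmod (ev (A - Q * B) z) = t z * cmod (ev B z)" if "z \<in> Z" for z
      unfolding t_def norm_mult[symmetric] using X[OF that] by (simp add: algebra_simps)
    then show ?thesis by (simp add: abs prod.distrib)
  qed
  also have "\<dots> < 1 * real_of_int (N B)"
    using small N_nonneg[of B] assms by (intro mult_strict_right_mono) auto
  finally show ?thesis by auto
qed

text \<open>\<open>G\<close> is a combination of \<open>A\<close> and \<open>B\<close> of least
  positive norm. Any remainder on division by \<open>G\<close> has norm 0 and so is 0 modulo
  \<open>Phi\<close>.\<close>

lemma gcd_exists:
  assumes "N A \<noteq> 0"
  shows "\<exists>G U V A' B'. Phi dvd G - (U * A + V * B) \<and> Phi dvd A - G * A' \<and> Phi dvd B - G * B'"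
proof -
  define S where "S = {n. \<exists>U V. n = nat (N (U * A + V * B)) \<and> 0 < n}"
  have "nat (N A) \<in> S"
    unfolding S_def mem_Collect_eq
    using assms N_nonneg[of A] by (intro exI[of _ 1] exI[of _ 0]) simp
  then have "(LEAST n. n \<in> S) \<in> S" by (rule LeastI)
  then obtain U V where UV: "(LEAST n. n \<in> S) = nat (N (U * A + V * B))" "0 < N (U * A + V * B)"
    by (auto simp: S_def)
  define G where "G = U * A + V * B"
  have G: "\<exists>Q. Phi dvd (U' * A + V' * B) - G * Q" for U' V'
  proof -
    obtain Q where Q: "N ((U' * A + V' * B) - Q * G) < N G"
      using euclidean_step[of G] UV by (auto simp: G_def)
    have eq: "(U' * A + V' * B) - Q * G = (U' - Q * U) * A + (V' - Q * V) * B"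
      by (simp add: G_def algebra_simps)
    have "N ((U' * A + V' * B) - Q * G) = 0"
    proof (rule ccontr)
      assume "N ((U' * A + V' * B) - Q * G) \<noteq> 0"
      then have "0 < N ((U' * A + V' * B) - Q * G)"
        using N_nonneg[of "(U' * A + V' * B) - Q * G"] by linarith
      then have "nat (N ((U' * A + V' * B) - Q * G)) \<in> S"
        unfolding eq S_def mem_Collect_eq by (intro exI conjI[OF refl]) simp
      then have "(LEAST n. n \<in> S) \<le> nat (N ((U' * A + V' * B) - Q * G))" by (rule Least_le)
      then show False using UV Q by (simp add: G_def)
    qed
    from N_zero_imp_dvd[OF this] show ?thesis by (auto simp: mult.commute)
  qed
  obtain A' B' where "Phi dvd A - G * A'" "Phi dvd B - G * B'"
    using G[of 1 0] G[of 0 1] by auto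
  moreover have "Phi dvd G - (U * A + V * B)" by (simp add: G_def)
  ultimately show ?thesis by blast
qed

text \<open>\<open>G\<close> is a gcd of \<open>p\<close> and \<open>F\<close>. Its norm divides a
  power of \<open>p\<close>, and it is divisible by \<open>p\<close> because it agrees with
  \<open>N (V * F)\<close> modulo \<open>p\<close>.\<close>

lemma prime_divisor:
  assumes p: "prime (p :: nat)" and "int p dvd N F"
  shows "\<exists>G F' p' j. Phi dvd F - G * F' \<and> Phi dvd [:int p:] - G * p' \<and> N G = int p ^ j \<and> 1 \<le> j"
proof -
  have "N [:int p:] \<noteq> 0" using prime_gt_0_nat[OF p] by (simp add: N_const)
  then obtain G U V p' F' where *: "Phi dvd G - (U * [:int p:] + V * F)"
      "Phi dvd [:int p:] - G * p'" "Phi dvd F - G * F'"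
    using gcd_exists[of "[:int p:]" F] by blast
  have "N G dvd int p ^ card Z" using N_cong[OF *(2)] by (simp add: N_const)
  then obtain j where j: "N G = int p ^ j"
    using divides_primepow[of "int p" "N G" "card Z"] p N_nonneg[of G] by auto
  have "[N G = 0] (mod int p)"
  proof -
    have "N G = N (V * F + smult (int p) U)" using N_cong[OF *(1)] by (simp add: add.commute)
    also have "[\<dots> = N (V * F)] (mod int p)" by (rule N_mod)
    also have "[N (V * F) = 0] (mod int p)" using assms(2) by (simp add: cong_0_iff)
    finally show ?thesis .
  qed
  then have "int p dvd N G" by (simp add: cong_0_iff)
  then have "1 \<le> j" using j p prime_gt_1_nat[OF p] by (cases j) auto
  then show ?thesis using * j by blast
qed

end

section \<open>Roots of unity of order 3, 5 and 15\<close>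

context cyc begin

text \<open>Modulo \<open>poly Phi r\<close> the integer \<open>r\<close> behaves like a root of
  \<open>Phi\<close>, so the identity behind \<open>conjprod\<close> can be evaluated at
  \<open>r\<close>.\<close>

lemma N_cong_at: "[N F = (\<Prod>h\<in>hs. poly F (r ^ h))] (mod poly Phi r)"
proof -
  obtain Q where "conjprod F - [:N F:] = Phi * Q" using Phi_dvd_conjprod by (auto elim: dvdE)
  from arg_cong[OF this, of "\<lambda>p. poly p r"]
  have "(\<Prod>h\<in>hs. poly F (r ^ h)) - N F = poly Phi r * poly Q r"
    by (simp add: conjprod_def poly_prod poly_pcompose poly_monom)
  then have "poly Phi r dvd (\<Prod>h\<in>hs. poly F (r ^ h)) - N F" by simp
  then show ?thesis by (simp add: cong_iff_dvd_diff dvd_diff_commute)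
qed

lemma int_dvd_of_values:
  assumes "\<And>z. z \<in> Z \<Longrightarrow> of_int n = of_int m * ev S z"
  shows "m dvd n"
proof (cases "m = 0")
  case True
  then show ?thesis using assms some_Z by fastforce
next
  case False
  have "ev S z = of_int n / of_int m" if "z \<in> Z" for z
    using assms[OF that] False by simp
  then obtain k where "of_int n / of_int m = (of_int k :: complex)"
    using constant_value[of S "of_int n / of_int m"] by auto
  then have "of_int n = (of_int (m * k) :: complex)" using False by (simp add: field_simps)
  then have "n = m * k" by (simp only: of_int_eq_iff)
  then show ?thesis by simp
qed

text \<open>If \<open>q\<close> is totally ramified above \<open>E\<close>, an element of norm 0 is divisible by every power of \<open>q\<close>.
  This replaces the irreducibility of \<open>Phi\<close>.\<close>

lemma N_zero_imp_dvd_by_ramified: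
  assumes q: "1 < (q :: int)" and E: "N E \<noteq> 0" and W: "Phi dvd E ^ k - smult q W"
    and step: "\<And>H. N H = 0 \<Longrightarrow> \<exists>H'. Phi dvd H - E * H'"
    and H: "N H = 0"
  shows "Phi dvd H"
proof (rule N_zero_imp_dvd_by_descent[OF q _ H])
  fix H assume H: "N H = 0"
  have "\<exists>H'. Phi dvd H - E ^ i * H' \<and> N H' = 0" for i
  proof (induction i)
    case (Suc i)
    then obtain H' where H': "Phi dvd H - E ^ i * H'" "N H' = 0" by blast
    then obtain H'' where H'': "Phi dvd H' - E * H''" using step by blast
    then have "N H'' = 0" using N_cong[OF H''] H' E by simp
    moreover have "Phi dvd H - E ^ Suc i * H''" using H' H'' by (auto simp: Phi_dvd_iff)
    ultimately show ?case by blast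
  qed (use H in \<open>auto intro: exI[of _ H]\<close>)
  then obtain H' where "Phi dvd H - E ^ k * H'" by blast
  then have "Phi dvd H - smult q (W * H')" using W by (auto simp: Phi_dvd_iff)
  then show "\<exists>H'. Phi dvd H - smult q H'" by blast
qed

end

section \<open>The cyclotomic polynomials of order 3, 5 and 15 and their roots\<close>

definition Phi3 :: "int poly" where "Phi3 = [:1, 1, 1:]"
definition Phi5 :: "int poly" where "Phi5 = [:1, 1, 1, 1, 1:]"
definition Phi15 :: "int poly" where "Phi15 = [:1, -1, 0, 1, -1, 1, 0, -1, 1:]"

definition Z3 :: "complex set" where "Z3 = {z. ev Phi3 z = 0}"
definition Z5 :: "complex set" where "Z5 = {z. ev Phi5 z = 0}"
definition Z15 :: "complex set" where "Z15 = {z. ev Phi15 z = 0}"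

lemma Z3_iff: "z \<in> Z3 \<longleftrightarrow> z ^ 3 = 1 \<and> z \<noteq> 1"
proof -
  have "z ^ 3 - 1 = (z - 1) * ev Phi3 z"
    by (simp add: Phi3_def algebra_simps power3_eq_cube)
  then show ?thesis by (auto simp: Z3_def Phi3_def)
qed

lemma Z5_iff: "z \<in> Z5 \<longleftrightarrow> z ^ 5 = 1 \<and> z \<noteq> 1"
proof -
  have "z ^ 5 - 1 = (z - 1) * ev Phi5 z"
    by (simp add: Phi5_def algebra_simps eval_nat_numeral)
  then show ?thesis by (auto simp: Z5_def Phi5_def)
qed

lemma Z15_iff: "z \<in> Z15 \<longleftrightarrow> z ^ 15 = 1 \<and> z ^ 3 \<noteq> 1 \<and> z ^ 5 \<noteq> 1"
proof -
  have f: "z ^ 15 - 1 = (z ^ 5 - 1) * ev Phi3 z * ev Phi15 z"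
    by (simp add: Phi3_def Phi15_def algebra_simps eval_nat_numeral)
  have f3: "z ^ 3 - 1 = (z - 1) * ev Phi3 z"
    by (simp add: Phi3_def algebra_simps eval_nat_numeral)
  have "z ^ 15 = 1" if "ev Phi15 z = 0" using f that by simp
  moreover have "z ^ 3 \<noteq> 1" if "ev Phi15 z = 0"
  proof
    assume "z ^ 3 = 1"
    then have "z = 1 \<or> ev Phi3 z = 0" using f3 by simp
    \<comment> \<open>At a root of \<open>Phi3\<close> this equals \<open>- 5 * z\<close>, and at 1
      it equals 1, so it does not vanish.\<close>
    moreover have "ev Phi15 z = z ^ 2 - 3 * z + 2 + z ^ 2"
    proof -
      have "z ^ 8 = z ^ 2 * (z ^ 3) ^ 2" "z ^ 7 = z * (z ^ 3) ^ 2" "z ^ 5 = z ^ 2 * z ^ 3" "z ^ 4 = z * z ^ 3"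
        by (simp_all add: eval_nat_numeral)
      then have "z ^ 8 = z ^ 2" "z ^ 7 = z" "z ^ 5 = z ^ 2" "z ^ 4 = z" using \<open>z ^ 3 = 1\<close> by simp_all
      moreover have "ev Phi15 z = z ^ 8 - z ^ 7 + z ^ 5 - z ^ 4 + z ^ 3 - z + 1"
        by (simp add: Phi15_def algebra_simps eval_nat_numeral)
      ultimately show ?thesis using \<open>z ^ 3 = 1\<close> by simp
    qed
    moreover have "z ^ 2 = ev Phi3 z - 1 - z" by (simp add: Phi3_def algebra_simps power2_eq_square)
    ultimately show False using that by auto
  qed
  moreover have "z ^ 5 \<noteq> 1" if "ev Phi15 z = 0"
  proof
    assume z5: "z ^ 5 = 1"
    have "z ^ 8 = z ^ 3 * z ^ 5" "z ^ 7 = z ^ 2 * z ^ 5"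
      by (simp_all add: eval_nat_numeral)
    then have "z ^ 8 = z ^ 3" "z ^ 7 = z ^ 2" using z5 by simp_all
    moreover have "ev Phi15 z = z ^ 8 - z ^ 7 + z ^ 5 - z ^ 4 + z ^ 3 - z + 1"
      by (simp add: Phi15_def algebra_simps eval_nat_numeral)
    ultimately have e: "ev Phi15 z = 2 * z ^ 3 - z ^ 2 - z ^ 4 - z + 2" using z5 by simp
    show False
    proof (cases "z = 1")
      case True
      then show ?thesis using e that by simp
    next
      case False
      then have "ev Phi5 z = 0" using z5 Z5_iff[of z] by (simp add: Z5_def)
      then have "ev Phi15 z + ev Phi5 z = 0" using that by simp
      moreover have "ev Phi15 z + ev Phi5 z = 3 * (z ^ 3 + 1)"
        unfolding e by (simp add: Phi5_def algebra_simps eval_nat_numeral)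
      ultimately have "z ^ 3 + 1 = 0" by (metis mult_eq_0_iff zero_neq_numeral)
      then have "z ^ 3 = - 1" by (simp add: eq_neg_iff_add_eq_0)
      then have "z ^ 15 = - 1" using power_mult[of z 3 5] by simp
      moreover have "z ^ 15 = 1" using power_mult[of z 5 3] z5 by simp
      ultimately show False by simp
    qed
  qed
  moreover have "ev Phi15 z = 0" if "z ^ 15 = 1" "z ^ 3 \<noteq> 1" "z ^ 5 \<noteq> 1"
    using f f3 that by auto
  ultimately show ?thesis by (auto simp: Z15_def)
qed

lemma power_gcd_eq_1:
  fixes z :: complex
  assumes "z ^ k = 1" "z ^ n = 1" "k \<noteq> 0"
  shows "z ^ gcd k n = 1"
proof -
  obtain x y where "k * x = n * y + gcd k n" using bezout_nat[OF \<open>k \<noteq> 0\<close>] by blast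
  then have "(z ^ k) ^ x = (z ^ n) ^ y * z ^ gcd k n"
    by (simp add: power_mult[symmetric] power_add[symmetric])
  then show ?thesis using assms by simp
qed

lemma not_real_root_of_unity:
  assumes "z ^ n = 1" "odd n" "z \<noteq> (1 :: complex)"
  shows "Im z \<noteq> 0"
proof
  assume "Im z = 0"
  then obtain x where x: "z = of_real x" by (metis complex_is_Real_iff Reals_cases)
  then have "x ^ n = 1" using assms(1) by (metis of_real_1 of_real_eq_iff of_real_power)
  moreover from this have "\<bar>x\<bar> = 1" using power_eq_1_iff[of x n] assms(2) by auto
  ultimately have "x = 1" using assms(2) by (auto simp: abs_if split: if_splits)
  then show False using x assms(3) by simp
qed

lemma root_unity_3_5: "root_unity 15 ^ 3 = root_unity 5" "root_unity 15 ^ 5 = root_unity 3"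
  by (simp_all add: root_unity_cis DeMoivre)

lemma root_unity_mem: "root_unity 3 \<in> Z3" "root_unity 5 \<in> Z5" "root_unity 15 \<in> Z15"
  using root_unity_power[of 3] root_unity_power[of 5] root_unity_power[of 15]
    root_unity_neq_1[of 3] root_unity_neq_1[of 5]
  by (simp_all add: Z3_iff Z5_iff Z15_iff root_unity_3_5)

text \<open>The powers of one root are \<open>card hs\<close> different roots, and the degree allows
  no more, so they are all of them.\<close>

lemma cycI:
  assumes "lead_coeff P = 1" "degree P = card hs" "1 \<in> hs" "finite hs" "z0 \<in> Z"
    and Z: "Z = {z. ev P z = 0}"
    and pow: "\<And>z h. z \<in> Z \<Longrightarrow> h \<in> hs \<Longrightarrow> z ^ h \<in> Z"
    and inj: "\<And>z. z \<in> Z \<Longrightarrow> inj_on (\<lambda>h. z ^ h) hs"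
    and Im: "\<And>z. z \<in> Z \<Longrightarrow> Im z \<noteq> 0"
  shows "cyc P Z hs"
proof -
  define P' :: "complex poly" where "P' = map_poly of_int P"
  have "P \<noteq> 0" using assms(1) by auto
  then have "P' \<noteq> 0" unfolding P'_def
    by (metis assms(1) coeff_map_poly coeff_0 of_int_0 of_int_1 zero_neq_one)
  have degP: "degree P' = degree P" by (simp add: P'_def degree_map_poly)
  have Z': "Z = {z. poly P' z = 0}" by (simp add: Z P'_def ev_def)
  have fin: "finite Z" and le: "card Z \<le> card hs"
    using poly_roots_finite[OF \<open>P' \<noteq> 0\<close>] card_poly_roots_bound[OF \<open>P' \<noteq> 0\<close>] assms(2) degP
    by (simp_all add: Z')
  have im: "(\<lambda>h. z ^ h) ` hs = Z" and card: "card Z = card hs" if "z \<in> Z" for z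
  proof -
    have sub: "(\<lambda>h. z ^ h) ` hs \<subseteq> Z" using pow that by auto
    have c: "card ((\<lambda>h. z ^ h) ` hs) = card hs" using card_image[OF inj[OF that]] .
    show "(\<lambda>h. z ^ h) ` hs = Z" using card_seteq[OF fin sub] c le by simp
    then show "card Z = card hs" using c by simp
  qed
  show ?thesis
  proof
    show "degree P = card Z" using card[OF assms(5)] assms(2) by simp
    show "bij_betw (\<lambda>h. z ^ h) hs Z" if "z \<in> Z" for z
      using inj[OF that] im[OF that] by (simp add: bij_betw_def)
    show "ev P z = 0" if "z \<in> Z" for z using that Z by simp
    show "cnj z \<in> Z" if "z \<in> Z" for z using that by (simp add: Z ev_cnj)
  qed (use assms fin in auto)
qed

lemma inj_on_powers:
  assumes "\<And>k. 0 < k \<Longrightarrow> k < n \<Longrightarrow> z ^ k \<noteq> 1" "(z :: complex) \<noteq> 0" "hs \<subseteq> {..<n}"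
  shows "inj_on (\<lambda>h. z ^ h) hs"
proof -
  have "z ^ b \<noteq> z ^ a" if "a < b" "b < n" for a b
  proof
    assume "z ^ b = z ^ a"
    moreover have "z ^ b = z ^ a * z ^ (b - a)" using that by (simp add: power_add[symmetric])
    ultimately have "z ^ (b - a) = 1" using assms(2) by simp
    then show False using assms(1)[of "b - a"] that by simp
  qed
  then show ?thesis unfolding inj_on_def by (metis assms(3) lessThan_iff nat_neq_iff subset_iff)
qed

lemma divisors_15: "d dvd (15::nat) \<Longrightarrow> d = 1 \<or> d = 3 \<or> d = 5 \<or> d = 15"
proof -
  assume d: "d dvd 15"
  then have "d \<le> 15" by (auto dest: dvd_imp_le)
  then have "d = 0 \<or> d = 1 \<or> d = 2 \<or> d = 3 \<or> d = 4 \<or> d = 5 \<or> d = 6 \<or> d = 7 \<or> d = 8 \<or> d = 9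
     \<or> d = 10 \<or> d = 11 \<or> d = 12 \<or> d = 13 \<or> d = 14 \<or> d = 15" by presburger
  then show ?thesis using d by (elim disjE) simp_all
qed

lemma Z15_power_neq_1:
  assumes "z \<in> Z15" "0 < k" "k < 15"
  shows "z ^ k \<noteq> 1"
proof
  assume "z ^ k = 1"
  then have g: "z ^ gcd k 15 = 1" using assms power_gcd_eq_1[of z k 15] by (auto simp: Z15_iff)
  have "gcd k 15 \<le> k" using assms gcd_le1_nat[of k 15] by simp
  then have "gcd k 15 = 1 \<or> gcd k 15 = 3 \<or> gcd k 15 = 5"
    using divisors_15[OF gcd_dvd2[of k 15]] assms by linarith
  then show False using g assms by (auto simp: Z15_iff)
qed

lemma prime_power_neq_1:
  assumes "z ^ n = 1" "z \<noteq> (1 :: complex)" "prime n" "0 < k" "k < n"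
  shows "z ^ k \<noteq> 1"
proof
  assume "z ^ k = 1"
  moreover have "coprime k n"
    using assms prime_imp_coprime_nat[of n k] by (metis coprime_commute dvd_imp_le not_less)
  ultimately show False using power_gcd_eq_1[of z k n] assms by (simp add: coprime_imp_gcd_eq_1)
qed

abbreviation hs15 :: "nat set" where "hs15 \<equiv> {1, 2, 4, 7, 8, 11, 13, 14}"

lemma power_power_1: "z ^ n = (1 :: complex) \<Longrightarrow> (z ^ k) ^ n = 1"
  by (metis power_commutes power_mult mult.commute power_one)

interpretation n3: cyc Phi3 Z3 "{1, 2}"
proof (rule cycI[of _ _ "root_unity 3"])
  show "z ^ h \<in> Z3" if "z \<in> Z3" "h \<in> {1, 2}" for z h
    using that prime_power_neq_1[of z 3 h] by (auto simp: Z3_iff power_power_1)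
  show "inj_on (\<lambda>h. z ^ h) {1, 2}" if "z \<in> Z3" for z
  proof (rule inj_on_powers[of 3])
    show "z ^ k \<noteq> 1" if "0 < k" "k < 3" for k
      using prime_power_neq_1[of z 3 k] \<open>z \<in> Z3\<close> that by (simp add: Z3_iff)
    show "z \<noteq> 0" using \<open>z \<in> Z3\<close> by (auto simp: Z3_iff)
  qed auto
  show "Im z \<noteq> 0" if "z \<in> Z3" for z
    using that not_real_root_of_unity[of z 3] by (auto simp: Z3_iff)
qed (use root_unity_mem in \<open>auto simp: Z3_def Phi3_def\<close>)

interpretation n5: cyc Phi5 Z5 "{1, 2, 3, 4}"
proof (rule cycI[of _ _ "root_unity 5"])
  show "z ^ h \<in> Z5" if "z \<in> Z5" "h \<in> {1, 2, 3, 4}" for z h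
    using that prime_power_neq_1[of z 5 h] by (auto simp: Z5_iff power_power_1)
  show "inj_on (\<lambda>h. z ^ h) {1, 2, 3, 4}" if "z \<in> Z5" for z
  proof (rule inj_on_powers[of 5])
    show "z ^ k \<noteq> 1" if "0 < k" "k < 5" for k
      using prime_power_neq_1[of z 5 k] \<open>z \<in> Z5\<close> that by (simp add: Z5_iff)
    show "z \<noteq> 0" using \<open>z \<in> Z5\<close> by (auto simp: Z5_iff)
  qed auto
  show "Im z \<noteq> 0" if "z \<in> Z5" for z
    using that not_real_root_of_unity[of z 5] by (auto simp: Z5_iff)
qed (use root_unity_mem in \<open>auto simp: Z5_def Phi5_def\<close>)

interpretation n15: cyc Phi15 Z15 hs15
proof (rule cycI[of _ _ "root_unity 15"])
  show "z ^ h \<in> Z15" if z: "z \<in> Z15" and h: "h \<in> hs15" for z h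
  proof -
    have "z ^ (h * 3) \<noteq> 1 \<and> z ^ (h * 5) \<noteq> 1"
    proof -
      have "z ^ gcd (h * 3) 15 \<noteq> 1" "z ^ gcd (h * 5) 15 \<noteq> 1"
        using h Z15_power_neq_1[OF z, of 3] Z15_power_neq_1[OF z, of 5]
        by (elim insertE emptyE; simp add: gcd_non_0_nat)+
      then show ?thesis using power_gcd_eq_1[of z _ 15] z h by (auto simp: Z15_iff)
    qed
    then show ?thesis using z by (auto simp: Z15_iff power_power_1 power_mult)
  qed
  show "inj_on (\<lambda>h. z ^ h) hs15" if "z \<in> Z15" for z
  proof (rule inj_on_powers[of 15])
    show "z ^ k \<noteq> 1" if "0 < k" "k < 15" for k using Z15_power_neq_1[OF \<open>z \<in> Z15\<close> that] .
    show "z \<noteq> 0" using \<open>z \<in> Z15\<close> by (auto simp: Z15_iff)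
  qed auto
  show "Im z \<noteq> 0" if "z \<in> Z15" for z
  proof -
    have "z \<noteq> 1" using that Z15_power_neq_1[of z 1] by auto
    then show ?thesis using that not_real_root_of_unity[of z 15] by (simp add: Z15_iff)
  qed
qed (use root_unity_mem in \<open>auto simp: Z15_def Phi15_def\<close>)

abbreviation nm3 :: "int poly \<Rightarrow> int" where "nm3 \<equiv> n3.N"
abbreviation nm5 :: "int poly \<Rightarrow> int" where "nm5 \<equiv> n5.N"
abbreviation nm15 :: "int poly \<Rightarrow> int" where "nm15 \<equiv> n15.N"

lemma card_Z [simp]: "card Z3 = 2" "card Z5 = 4" "card Z15 = 8"
  using n3.degree_Phi n5.degree_Phi n15.degree_Phi by (simp_all add: Phi3_def Phi5_def Phi15_def)

section \<open>Approximation of real points by lattice points\<close>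

text \<open>Orthogonality of the characters of the cyclic group of order 5; the complex conjugate of
  \<open>y ^ i\<close> is written as its fourth power.\<close>

lemma parseval5:
  assumes y: "y \<in> Z5"
  shows "(\<Sum>i<5. (cmod (\<Sum>j<5. b j * (y ^ i) ^ j))\<^sup>2) = 5 * (\<Sum>j<5. (cmod (b j))\<^sup>2)"
proof -
  have y5: "y ^ 5 = 1" and y1: "y \<noteq> 1" using y by (auto simp: Z5_iff)
  have c: "cnj (y ^ i) = (y ^ i) ^ 4" for i
  proof -
    have "norm (y ^ i) = 1"
      using power_eq_1_iff[of "y ^ i" 5] power_power_1[OF y5, of i] by simp
    then have "y ^ i * cnj (y ^ i) = 1" by (metis complex_norm_square of_real_1 power_one)
    moreover have "y ^ i * (y ^ i) ^ 4 = 1"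
      using power_power_1[OF y5, of i] by (simp add: power_Suc[symmetric] del: power_Suc)
    moreover have "y ^ i \<noteq> 0" using y5 by auto
    ultimately show ?thesis by (metis mult_cancel_left)
  qed
  have orth: "(\<Sum>i<5. (y ^ i) ^ j * (y ^ i) ^ (4 * k)) = (if j = k then 5 else 0)"
    if "j < 5" "k < 5" for j k
  proof -
    have "(\<Sum>i<5. (y ^ i) ^ j * (y ^ i) ^ (4 * k)) = (\<Sum>i<5. (y ^ (j + 4 * k)) ^ i)"
      by (intro sum.cong refl) (simp add: power_mult[symmetric] power_add[symmetric] algebra_simps)
    also have "\<dots> = (if j = k then 5 else 0)"
    proof (cases "j = k")
      case True
      then have "y ^ (j + 4 * k) = (y ^ 5) ^ k" by (simp add: power_mult[symmetric])
      then show ?thesis using True y5 by simp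
    next
      case False
      have nd: "(j + 4 * k) mod 5 \<noteq> 0"
      proof
        assume "(j + 4 * k) mod 5 = 0"
        then obtain q where "j + 4 * k = 5 * q" by auto
        then show False using False that by (cases q k rule: linorder_cases) linarith+
      qed
      have "y ^ (j + 4 * k) = (y ^ 5) ^ ((j + 4 * k) div 5) * y ^ ((j + 4 * k) mod 5)"
        by (simp only: power_mult[symmetric] power_add[symmetric]) simp
      also have "\<dots> = y ^ ((j + 4 * k) mod 5)" using y5 by simp
      finally have "y ^ (j + 4 * k) \<noteq> 1" using prime_power_neq_1[of y 5] y5 y1 nd by simp
      moreover have "(y ^ (j + 4 * k)) ^ 5 = 1" using power_power_1[OF y5] .
      ultimately show ?thesis using False geometric_sum[of "y ^ (j + 4 * k)" 5] by simp
    qed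
    finally show ?thesis .
  qed
  have "of_real (\<Sum>i<5. (cmod (\<Sum>j<5. b j * (y ^ i) ^ j))\<^sup>2)
      = (\<Sum>i<5. (\<Sum>j<5. b j * (y ^ i) ^ j) * (\<Sum>k<5. cnj (b k) * (y ^ i) ^ (4 * k)))"
    by (simp only: of_real_sum complex_norm_square cnj_sum complex_cnj_mult complex_cnj_power[of "y ^ _"] c
        power_mult)
  also have "\<dots> = (\<Sum>i<5. \<Sum>j<5. \<Sum>k<5. b j * cnj (b k) * ((y ^ i) ^ j * (y ^ i) ^ (4 * k)))"
    by (simp only: sum_product) (simp add: algebra_simps)
  also have "\<dots> = (\<Sum>j<5. \<Sum>k<5. \<Sum>i<5. b j * cnj (b k) * ((y ^ i) ^ j * (y ^ i) ^ (4 * k)))"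
    by (rule trans[OF sum.swap]) (intro sum.cong refl sum.swap)
  also have "\<dots> = (\<Sum>j<5. \<Sum>k<5. if j = k then 5 * (b j * cnj (b k)) else 0)"
    by (intro sum.cong refl) (simp add: sum_distrib_left[symmetric] orth)
  also have "\<dots> = (\<Sum>j<5. 5 * (b j * cnj (b j)))"
    by simp
  also have "\<dots> = of_real (5 * (\<Sum>j<5. (cmod (b j))\<^sup>2))"
    by (simp only: of_real_mult of_real_sum complex_norm_square sum_distrib_left[symmetric]) simp
  finally show ?thesis by (simp only: of_real_eq_iff)
qed

lemma parseval_Z5_le: "(\<Sum>y\<in>Z5. (cmod (\<Sum>j<5. b j * y ^ j))\<^sup>2) \<le> 5 * (\<Sum>j<5. (cmod (b j))\<^sup>2)"
proof -
  obtain y where y: "y \<in> Z5" using n5.some_Z by blast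
  have "(\<Sum>y\<in>Z5. (cmod (\<Sum>j<5. b j * y ^ j))\<^sup>2)
      = (\<Sum>i\<in>{1, 2, 3, 4}. (cmod (\<Sum>j<5. b j * (y ^ i) ^ j))\<^sup>2)"
    using sum.reindex_bij_betw[OF n5.bij[OF y], of "\<lambda>y. (cmod (\<Sum>j<5. b j * y ^ j))\<^sup>2"] by simp
  also have "\<dots> \<le> (\<Sum>i<5. (cmod (\<Sum>j<5. b j * (y ^ i) ^ j))\<^sup>2)"
    \<comment> \<open>The term for \<open>i = 0\<close>, the value at 1, is added here.\<close>
    by (intro sum_mono2) auto
  also have "\<dots> = 5 * (\<Sum>j<5. (cmod (b j))\<^sup>2)" by (rule parseval5[OF y])
  finally show ?thesis .
qed

lemma sum_lessThan_5: "(\<Sum>j<5. f j) = f 0 + f 1 + f 2 + f 3 + f (4::nat)"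
  by (simp add: eval_nat_numeral)

lemma map_poly_of_real_pCons:
  "poly (map_poly complex_of_real (pCons a X)) z = of_real a + z * poly (map_poly of_real X) z"
  by (cases "X = 0 \<and> a = 0") (auto simp: map_poly_pCons)

lemma Z3_square: "z \<in> Z3 \<Longrightarrow> z * z = - 1 - z"
  by (auto simp: Z3_def Phi3_def algebra_simps eq_neg_iff_add_eq_0)

lemma real_poly_at_Z3:
  "\<exists>u v. \<forall>z\<in>Z3. poly (map_poly of_real X) z = of_real u + of_real v * z"
proof (induction X)
  case 0
  then show ?case by (intro exI[of _ 0]) simp
next
  case (pCons a X)
  then obtain u v where uv: "\<And>z. z \<in> Z3 \<Longrightarrow> poly (map_poly of_real X) z = of_real u + of_real v * z"
    by blast
  have "poly (map_poly of_real (pCons a X)) z = of_real (a - v) + of_real (u - v) * z" if "z \<in> Z3" for z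
  proof -
    have "poly (map_poly of_real (pCons a X)) z = of_real a + of_real u * z + of_real v * (z * z)"
      by (simp add: map_poly_of_real_pCons uv[OF that] algebra_simps)
    then show ?thesis unfolding Z3_square[OF that] by (simp add: algebra_simps)
  qed
  then show ?case by blast
qed

text \<open>Five coordinates are kept in degree 4 on purpose. Since the five powers of
  \<open>z\<close> sum to 0, a common shift of all coordinates leaves the value unchanged, and the
  rounding exploits this freedom.\<close>

lemma real_poly_at_Z5:
  "\<exists>b :: nat \<Rightarrow> real. \<forall>z\<in>Z5. poly (map_poly of_real X) z = (\<Sum>j<5. of_real (b j) * z ^ j)"
proof (induction X)
  case 0
  then show ?case by (intro exI[of _ "\<lambda>_. 0"]) simp
next
  case (pCons a X)
  then obtain b where b: "\<And>z. z \<in> Z5 \<Longrightarrow> poly (map_poly of_real X) z = (\<Sum>j<5. of_real (b j) * z ^ j)"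
    by blast
  define b' where "b' j = (if j = 0 then a + b 4 else b (j - 1))" for j
  have "poly (map_poly of_real (pCons a X)) z = (\<Sum>j<5. of_real (b' j) * z ^ j)" if "z \<in> Z5" for z
  proof -
    have "poly (map_poly of_real (pCons a X)) z = of_real a + of_real (b 0) * z + of_real (b 1) * z ^ 2
        + of_real (b 2) * z ^ 3 + of_real (b 3) * z ^ 4 + of_real (b 4) * z ^ 5"
      by (simp add: map_poly_of_real_pCons b[OF that] sum_lessThan_5 algebra_simps eval_nat_numeral)
    also have "z ^ 5 = 1" using that by (simp add: Z5_iff)
    finally show ?thesis by (simp add: sum_lessThan_5 b'_def algebra_simps)
  qed
  then show ?case by blast
qed

lemma Z15_powers: "z \<in> Z15 \<Longrightarrow> z ^ 10 \<in> Z3" "z \<in> Z15 \<Longrightarrow> z ^ 6 \<in> Z5" "z \<in> Z15 \<Longrightarrow> z = z ^ 10 * z ^ 6"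
proof -
  assume z: "z \<in> Z15"
  then have z15: "z ^ 15 = 1" by (simp add: Z15_iff)
  show "z ^ 10 \<in> Z3" using Z15_power_neq_1[OF z, of 10] power_power_1[OF z15, of 2]
    by (simp add: Z3_iff power_mult[symmetric])
  show "z ^ 6 \<in> Z5" using Z15_power_neq_1[OF z, of 6] power_power_1[OF z15, of 2]
    by (simp add: Z5_iff power_mult[symmetric])
  have "z ^ 10 * z ^ 6 = z ^ 15 * z" by (simp add: power_add[symmetric] power_Suc2[symmetric] del: power_Suc power_Suc2)
  then show "z = z ^ 10 * z ^ 6" using z15 by simp
qed

text \<open>\<open>z\<close> is the product of the cube root of unity \<open>z ^ 10\<close> and the
  fifth root of unity \<open>z ^ 6\<close>. A value gets five coordinates as in order 5, each now a
  point \<open>u + v * z ^ 10\<close> of the hexagonal plane.\<close>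

lemma real_poly_at_Z15:
  "\<exists>u v :: nat \<Rightarrow> real. \<forall>z\<in>Z15. poly (map_poly of_real X) z
      = (\<Sum>j<5. (of_real (u j) + of_real (v j) * z ^ 10) * (z ^ 6) ^ j)"
proof (induction X)
  case 0
  then show ?case by (intro exI[of _ "\<lambda>_. 0"]) simp
next
  case (pCons a X)
  then obtain u v where uv: "\<And>z. z \<in> Z15 \<Longrightarrow> poly (map_poly of_real X) z
      = (\<Sum>j<5. (of_real (u j) + of_real (v j) * z ^ 10) * (z ^ 6) ^ j)"
    by blast
  define u' where "u' j = (if j = 0 then a - v 4 else - v (j - 1))" for j
  define v' where "v' j = (if j = 0 then u 4 - v 4 else u (j - 1) - v (j - 1))" for j
  have "poly (map_poly of_real (pCons a X)) z
      = (\<Sum>j<5. (of_real (u' j) + of_real (v' j) * z ^ 10) * (z ^ 6) ^ j)" if z: "z \<in> Z15" for z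
  proof -
    define c y where "c = z ^ 10" and "y = z ^ 6"
    have c: "c * c = - 1 - c" and y: "y ^ 5 = 1" and zcy: "z = c * y"
      using Z15_powers[OF z] Z3_square[OF Z15_powers(1)[OF z]] by (simp_all add: c_def y_def Z5_iff)
    have shift: "c * (of_real s + of_real t * c) = of_real (- t) + of_real (s - t) * c" for s t
    proof -
      have "c * (of_real s + of_real t * c) = of_real s * c + of_real t * (c * c)"
        by (simp add: algebra_simps)
      then show ?thesis unfolding c by (simp add: algebra_simps)
    qed
    have "poly (map_poly of_real (pCons a X)) z
        = of_real a + c * y * (\<Sum>j<5. (of_real (u j) + of_real (v j) * c) * y ^ j)"
      using uv[OF z] by (simp add: map_poly_of_real_pCons c_def[symmetric] y_def[symmetric] zcy[symmetric])
    also have "\<dots> = of_real a + c * (of_real (u 0) + of_real (v 0) * c) * y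
       + c * (of_real (u 1) + of_real (v 1) * c) * y ^ 2 + c * (of_real (u 2) + of_real (v 2) * c) * y ^ 3
       + c * (of_real (u 3) + of_real (v 3) * c) * y ^ 4 + c * (of_real (u 4) + of_real (v 4) * c) * y ^ 5"
      by (simp add: sum_lessThan_5 distrib_left distrib_right eval_nat_numeral mult_ac)
    also have "\<dots> = (\<Sum>j<5. (of_real (u' j) + of_real (v' j) * c) * y ^ j)"
      unfolding shift y by (simp add: sum_lessThan_5 u'_def v'_def)
    finally show ?thesis by (simp add: c_def y_def)
  qed
  then show ?case by blast
qed

text \<open>With \<open>s\<close> in [0, 1/2] the distance of one of the points t, t - 1/2 from an
  integer, the other lies at distance 1/2 - s, and s^2 + (1/2 - s)^2 is at most 1/4.\<close>

lemma half_shift: "\<exists>m n :: int. (t - of_int m)\<^sup>2 + (t - 1 / 2 - of_int n)\<^sup>2 \<le> (1 / 4 :: real)"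
proof -
  define s where "s = t - of_int (floor (2 * t)) / 2"
  have s: "0 \<le> s" "s \<le> 1 / 2" by (simp_all add: s_def field_simps) linarith+
  have sq: "s\<^sup>2 + (s - 1 / 2)\<^sup>2 \<le> 1 / 4"
  proof -
    have "s * (1 / 2 - s) \<ge> 0" using s by simp
    then show ?thesis by (simp add: power2_eq_square algebra_simps)
  qed
  show ?thesis
  proof (cases "even (floor (2 * t))")
    case True
    then obtain k where "floor (2 * t) = 2 * k" by (auto elim: evenE)
    then have "t = of_int k + s" by (simp add: s_def)
    then show ?thesis using sq by (intro exI[of _ k]) simp
  next
    case False
    then obtain k where "floor (2 * t) = 2 * k + 1" by (auto elim: oddE)
    then have t: "t = of_int k + 1 / 2 + s" by (simp add: s_def field_simps)
    show ?thesis using sq by (intro exI[of _ "k + 1"] exI[of _ k]) (simp add: t algebra_simps)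
  qed
qed

lemma cmod_Z3:
  assumes "z \<in> Z3"
  shows "(cmod (of_real p + of_real q * z))\<^sup>2 = p\<^sup>2 - p * q + q\<^sup>2"
proof -
  have z3: "z ^ 3 = 1" using assms by (simp add: Z3_iff)
  then have "cmod z = 1" using power_eq_1_iff[of z 3] by simp
  then have n: "z * cnj z = 1" by (metis complex_norm_square of_real_1 power_one)
  moreover have "z * (z * z) = 1" using z3 by (simp add: power3_eq_cube mult.assoc)
  moreover have "z \<noteq> 0" using z3 by auto
  ultimately have c: "cnj z = - 1 - z" using Z3_square[OF assms] by (metis mult_cancel_left)
  have "of_real ((cmod (of_real p + of_real q * z))\<^sup>2) = (of_real p + of_real q * z) * (of_real p + of_real q * cnj z)"
    by (simp only: complex_norm_square) simp
  also have "\<dots> = of_real p * of_real p + of_real p * of_real q * (z + cnj z) + of_real q * of_real q * (z * cnj z)"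
    by (simp add: algebra_simps)
  also have "\<dots> = of_real (p\<^sup>2 - p * q + q\<^sup>2)"
    unfolding n by (simp add: c power2_eq_square)
  finally show ?thesis by (simp only: of_real_eq_iff)
qed

lemma hexagonal_norm_le:
  assumes "\<bar>e :: real\<bar> \<le> 1 / 2" "\<bar>f\<bar> \<le> 1 / 2"
  shows "e\<^sup>2 - e * f + f\<^sup>2 \<le> 3 / 4"
proof -
  have "\<bar>e\<bar> * \<bar>f\<bar> \<le> (1 / 2) * (1 / 2)" using assms by (intro mult_mono) auto
  moreover have "e\<^sup>2 \<le> (1 / 2)\<^sup>2" "f\<^sup>2 \<le> (1 / 2)\<^sup>2"
    using assms abs_le_square_iff[of e "1 / 2"] abs_le_square_iff[of f "1 / 2"] by simp_all
  moreover have "- (e * f) \<le> \<bar>e\<bar> * \<bar>f\<bar>" by (metis abs_ge_minus_self abs_mult)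
  ultimately show ?thesis by (simp add: power2_eq_square)
qed

lemma rounding3: "\<exists>Q. (\<Sum>z\<in>Z3. (cmod (poly (map_poly of_real X) z - ev Q z))\<^sup>2) < real (card Z3)"
proof -
  obtain u v where uv: "\<And>z. z \<in> Z3 \<Longrightarrow> poly (map_poly of_real X) z = of_real u + of_real v * z"
    using real_poly_at_Z3 by blast
  define e f where "e = u - of_int (round u)" and "f = v - of_int (round v)"
  have "\<bar>e\<bar> \<le> 1 / 2" "\<bar>f\<bar> \<le> 1 / 2"
    using of_int_round_abs_le[of u] of_int_round_abs_le[of v] by (simp_all add: e_def f_def abs_minus_commute)
  then have "e\<^sup>2 - e * f + f\<^sup>2 \<le> 3 / 4" by (rule hexagonal_norm_le)
  moreover have "(cmod (poly (map_poly of_real X) z - ev [:round u, round v:] z))\<^sup>2 = e\<^sup>2 - e * f + f\<^sup>2"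
    if "z \<in> Z3" for z
  proof -
    have "poly (map_poly of_real X) z - ev [:round u, round v:] z = of_real e + of_real f * z"
      by (simp add: uv[OF that] e_def f_def algebra_simps)
    then show ?thesis using cmod_Z3[OF that] by simp
  qed
  ultimately show ?thesis by (intro exI[of _ "[:round u, round v:]"]) simp
qed

lemma rounding5: "\<exists>Q. (\<Sum>z\<in>Z5. (cmod (poly (map_poly of_real X) z - ev Q z))\<^sup>2) < real (card Z5)"
proof -
  obtain b :: "nat \<Rightarrow> real" where b: "\<And>z. z \<in> Z5 \<Longrightarrow> poly (map_poly of_real X) z = (\<Sum>j<5. of_real (b j) * z ^ j)"
    using real_poly_at_Z5[of X] by blast
  obtain m n where mn: "(b j - of_int (m j))\<^sup>2 + (b j - 1 / 2 - of_int (n j))\<^sup>2 \<le> 1 / 4" for j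
    using half_shift[of "b _"] by metis
  \<comment> \<open>The shifts 0 and 1/2 together cost at most 5/4, so one of them costs at most
    5/8. Parseval multiplies this by 5, and 25/8 is below the degree 4.\<close>
  have "(\<Sum>j<5. (b j - of_int (m j))\<^sup>2) + (\<Sum>j<5. (b j - 1 / 2 - of_int (n j))\<^sup>2) \<le> (\<Sum>j<(5::nat). 1 / 4)"
    unfolding sum.distrib[symmetric] using mn by (rule sum_mono)
  then have "(\<Sum>j<5. (b j - of_int (m j))\<^sup>2) \<le> 5 / 8 \<or> (\<Sum>j<5. (b j - 1 / 2 - of_int (n j))\<^sup>2) \<le> 5 / 8"
    by (simp; linarith)
  then obtain c k where ck: "(\<Sum>j<5. (b j - c - of_int (k j))\<^sup>2) \<le> 5 / 8"
    by (metis (no_types, lifting) diff_zero sum.cong)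
  define Q :: "int poly" where "Q = (\<Sum>j<5. monom (k j) j)"
  have "poly (map_poly of_real X) z - ev Q z = (\<Sum>j<5. of_real (b j - c - of_int (k j)) * z ^ j)"
    if "z \<in> Z5" for z
  proof -
    have "(\<Sum>j<5. z ^ j) = 0" using that geometric_sum[of z 5] by (simp add: Z5_iff)
    then have "(\<Sum>j<5. of_real c * z ^ j) = 0" by (simp add: sum_distrib_left[symmetric])
    then show ?thesis
      by (simp add: b[OF that] Q_def left_diff_distrib sum_subtractf)
  qed
  then have "(\<Sum>z\<in>Z5. (cmod (poly (map_poly of_real X) z - ev Q z))\<^sup>2)
      = (\<Sum>z\<in>Z5. (cmod (\<Sum>j<5. of_real (b j - c - of_int (k j)) * z ^ j))\<^sup>2)"
    by simp
  also have "\<dots> \<le> 5 * (\<Sum>j<5. (cmod (of_real (b j - c - of_int (k j))))\<^sup>2)" by (rule parseval_Z5_le)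
  also have "\<dots> \<le> 5 * (5 / 8)" using ck by (simp only: norm_of_real power2_abs)
  finally show ?thesis by (intro exI[of _ Q]) simp
qed

text \<open>Each class of \<open>\<int>[\<omega>]\<close> modulo 7 has a representative in the Voronoi cell of \<open>7\<int>[\<omega>]\<close>;
  only six of the points of the square \<open>[-3, 3]\<^sup>2\<close> have to be moved.\<close>

definition hex_rep :: "int \<Rightarrow> int \<Rightarrow> int \<times> int" where
  "hex_rep i j =
     (if (i, j) = (3, -3) then (3, 4) else if (i, j) = (-3, 3) then (-3, -4)
      else if (i, j) = (3, -2) then (-4, -2) else if (i, j) = (-3, 2) then (4, 2)
      else if (i, j) = (2, -3) then (2, 4) else if (i, j) = (-2, 3) then (-2, -4) else (i, j))"

definition centred_mod7 :: "int \<Rightarrow> int" where "centred_mod7 x = (x + 3) mod 7 - 3"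

definition hexnorm :: "real \<Rightarrow> real \<Rightarrow> real" where "hexnorm e f = e\<^sup>2 - e * f + f\<^sup>2"

lemma interval7: "{-3..3::int} = {-3, -2, -1, 0, 1, 2, 3}"
  by auto

text \<open>The 49 representatives are symmetric about 0, which cancels the terms linear in
  \<open>e\<close> and \<open>f\<close>; 336 is the sum of their norms.\<close>

lemma hex_rep_sum:
  "(\<Sum>i\<in>{-3..3}. \<Sum>j\<in>{-3..3}. hexnorm (of_int (fst (hex_rep i j)) + e) (of_int (snd (hex_rep i j)) + f))
    = 336 + 49 * hexnorm e f"
  unfolding interval7 hexnorm_def hex_rep_def by (simp add: power2_eq_square algebra_simps)

lemma bij_centred_mod7: "bij_betw (\<lambda>c. centred_mod7 (M - c)) {-3..3} {-3..3}"
proof (rule bij_betw_byWitness[where f' = "\<lambda>c. centred_mod7 (M - c)"])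
  show "\<forall>a\<in>{-3..3}. centred_mod7 (M - centred_mod7 (M - a)) = a"
  proof
    fix a :: int assume "a \<in> {-3..3}"
    then have "(M + 6 - (M - a + 3)) mod 7 = a + 3" by simp
    then have "(M + 6 - (M - a + 3) mod 7) mod 7 = a + 3" by (simp only: mod_diff_right_eq)
    then show "centred_mod7 (M - centred_mod7 (M - a)) = a"
      by (simp add: centred_mod7_def algebra_simps)
  qed
  then show "\<forall>a\<in>{-3..3}. centred_mod7 (M - centred_mod7 (M - a)) = a" .
  show "(\<lambda>c. centred_mod7 (M - c)) ` {-3..3} \<subseteq> {-3..3}"
    by (auto simp: centred_mod7_def)
  then show "(\<lambda>c. centred_mod7 (M - c)) ` {-3..3} \<subseteq> {-3..3}" .
qed

text \<open>After scaling by 7 and rounding, the shifted points are lattice points displaced by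
  \<open>(e, f)\<close>. As the shift varies, every class modulo 7 is met once, so the total is the
  one of \<open>hex_rep_sum\<close> divided by 49.\<close>

lemma hexagonal_shifts:
  fixes u v :: real
  shows "\<exists>m n :: int \<Rightarrow> int \<Rightarrow> int. (\<Sum>c\<in>{-3..3}. \<Sum>d\<in>{-3..3}.
      hexnorm (u - of_int c / 7 - of_int (m c d)) (v - of_int d / 7 - of_int (n c d))) \<le> 336 / 49 + 3 / 4"
proof -
  define M K where "M = round (7 * u)" and "K = round (7 * v)"
  define e f where "e = 7 * u - of_int M" and "f = 7 * v - of_int K"
  have ef: "hexnorm e f \<le> 3 / 4"
    using of_int_round_abs_le[of "7 * u"] of_int_round_abs_le[of "7 * v"]
    unfolding hexnorm_def by (intro hexagonal_norm_le) (simp_all add: e_def f_def M_def K_def abs_minus_commute)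
  define R where "R c d = hex_rep (centred_mod7 (M - c)) (centred_mod7 (K - d))" for c d
  define m where "m c d = (M - c - fst (R c d)) div 7" for c d
  define n where "n c d = (K - d - snd (R c d)) div 7" for c d
  have cm: "7 dvd x - centred_mod7 x" for x unfolding centred_mod7_def by presburger
  have hr: "7 dvd i - fst (hex_rep i j)" "7 dvd j - snd (hex_rep i j)" for i j
    by (auto simp: hex_rep_def)
  have "7 dvd M - c - fst (R c d)" for c d
    using dvd_add[OF cm[of "M - c"] hr(1)[of "centred_mod7 (M - c)" "centred_mod7 (K - d)"]]
    by (simp add: R_def algebra_simps)
  then have m: "M - c = fst (R c d) + 7 * m c d" for c d by (simp add: m_def algebra_simps)
  have "7 dvd K - d - snd (R c d)" for c d
    using dvd_add[OF cm[of "K - d"] hr(2)[of "centred_mod7 (K - d)" "centred_mod7 (M - c)"]]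
    by (simp add: R_def algebra_simps)
  then have n: "K - d = snd (R c d) + 7 * n c d" for c d by (simp add: n_def algebra_simps)
  have u: "u - of_int c / 7 - of_int (m c d) = (of_int (fst (R c d)) + e) / 7" for c d
    using arg_cong[OF m[of c d], of real_of_int] by (simp add: e_def field_simps)
  have v: "v - of_int d / 7 - of_int (n c d) = (of_int (snd (R c d)) + f) / 7" for c d
    using arg_cong[OF n[of d c], of real_of_int] by (simp add: f_def field_simps)
  have scale: "hexnorm (x / 7) (y / 7) = hexnorm x y / 49" for x y
    by (simp add: hexnorm_def power2_eq_square field_simps)
  let ?g = "\<lambda>i j. hexnorm (of_int (fst (hex_rep i j)) + e) (of_int (snd (hex_rep i j)) + f)"
  have "(\<Sum>c\<in>{-3..3}. \<Sum>d\<in>{-3..3}.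
      hexnorm (u - of_int c / 7 - of_int (m c d)) (v - of_int d / 7 - of_int (n c d)))
    = (\<Sum>c\<in>{-3..3}. \<Sum>d\<in>{-3..3}. ?g (centred_mod7 (M - c)) (centred_mod7 (K - d))) / 49"
    unfolding u v scale by (simp add: sum_divide_distrib R_def)
  also have "(\<Sum>c\<in>{-3..3}. \<Sum>d\<in>{-3..3}. ?g (centred_mod7 (M - c)) (centred_mod7 (K - d)))
    = (\<Sum>c\<in>{-3..3}. \<Sum>j\<in>{-3..3}. ?g (centred_mod7 (M - c)) j)"
    by (intro sum.cong refl sum.reindex_bij_betw[OF bij_centred_mod7])
  also have "\<dots> = (\<Sum>i\<in>{-3..3}. \<Sum>j\<in>{-3..3}. ?g i j)"
    by (rule sum.reindex_bij_betw[OF bij_centred_mod7])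
  also have "\<dots> / 49 \<le> 336 / 49 + 3 / 4" unfolding hex_rep_sum using ef by simp
  finally show ?thesis by blast
qed

lemma Z15_reindex: "(\<Sum>z\<in>Z15. f (z ^ 10) (z ^ 6)) = (\<Sum>c\<in>Z3. \<Sum>y\<in>Z5. f c y)"
proof -
  have "bij_betw (\<lambda>z. (z ^ 10, z ^ 6)) Z15 (Z3 \<times> Z5)"
  proof -
    have inj: "inj_on (\<lambda>z. (z ^ 10, z ^ 6)) Z15"
    proof (rule inj_onI)
      fix x y assume "x \<in> Z15" "y \<in> Z15" "(x ^ 10, x ^ 6) = (y ^ 10, y ^ 6)"
      then show "x = y" using Z15_powers(3)[of x] Z15_powers(3)[of y] by simp
    qed
    have sub: "(\<lambda>z. (z ^ 10, z ^ 6)) ` Z15 \<subseteq> Z3 \<times> Z5" using Z15_powers by auto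
    have "(\<lambda>z. (z ^ 10, z ^ 6)) ` Z15 = Z3 \<times> Z5"
      using n3.finite_Z n5.finite_Z
      by (intro card_seteq[OF _ sub]) (simp_all add: card_image[OF inj] card_cartesian_product)
    then show ?thesis using inj by (simp add: bij_betw_def)
  qed
  from sum.reindex_bij_betw[OF this, of "\<lambda>(c, y). f c y"]
  show ?thesis by (simp add: sum.cartesian_product)
qed

text \<open>A common shift of the five coordinates over \<open>\<int>[\<omega>]\<close> does not change the value, and averaging over
  the shifts in \<open>\<int>[\<omega>]/7\<close> gives the bound.\<close>

lemma rounding15: "\<exists>Q. (\<Sum>z\<in>Z15. (cmod (poly (map_poly of_real X) z - ev Q z))\<^sup>2) < real (card Z15)"
proof -
  obtain u v :: "nat \<Rightarrow> real" where uv: "\<And>z. z \<in> Z15 \<Longrightarrow> poly (map_poly of_real X) z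
      = (\<Sum>j<5. (of_real (u j) + of_real (v j) * z ^ 10) * (z ^ 6) ^ j)"
    using real_poly_at_Z15[of X] by blast
  let ?I = "{-3..3::int}"
  have "\<forall>j. \<exists>mn :: (int \<Rightarrow> int \<Rightarrow> int) \<times> (int \<Rightarrow> int \<Rightarrow> int).
      (\<Sum>c\<in>?I. \<Sum>d\<in>?I. hexnorm (u j - of_int c / 7 - of_int (fst mn c d))
        (v j - of_int d / 7 - of_int (snd mn c d))) \<le> 336 / 49 + 3 / 4"
    using hexagonal_shifts by (simp only: split_paired_Ex fst_conv snd_conv) blast
  from choice[OF this] obtain mn where "\<forall>j. (\<Sum>c\<in>?I. \<Sum>d\<in>?I. hexnorm (u j - of_int c / 7 - of_int (fst (mn j) c d))
        (v j - of_int d / 7 - of_int (snd (mn j) c d))) \<le> 336 / 49 + 3 / 4" ..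
  moreover define m n where "m j = fst (mn j)" and "n j = snd (mn j)" for j
  ultimately have mn: "(\<Sum>c\<in>?I. \<Sum>d\<in>?I. hexnorm (u j - of_int c / 7 - of_int (m j c d))
      (v j - of_int d / 7 - of_int (n j c d))) \<le> 336 / 49 + 3 / 4" for j
    by simp
  define h where "h c d j = hexnorm (u j - of_int c / 7 - of_int (m j c d)) (v j - of_int d / 7 - of_int (n j c d))"
    for c d j
  \<comment> \<open>The mean over the 49 shifts is 5 (336/49 + 3/4) / 49, just below 4/5. The bound
    4/5 is dictated by the degree: Parseval contributes a factor 5 and the two cube roots a factor
    2, giving 8.\<close>
  have "\<exists>c\<in>?I. \<exists>d\<in>?I. (\<Sum>j<5. h c d j) < 4 / 5"
  proof (rule ccontr)
    assume "\<not> ?thesis"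
    then have "(\<Sum>c\<in>?I. \<Sum>d\<in>?I. 4 / 5) \<le> (\<Sum>c\<in>?I. \<Sum>d\<in>?I. \<Sum>j<5. h c d j)"
      by (intro sum_mono) (auto simp: not_less)
    also have "\<dots> = (\<Sum>j<5. \<Sum>c\<in>?I. \<Sum>d\<in>?I. h c d j)"
      by (simp only: sum.swap[of _ "{..<5}"])
    also have "\<dots> \<le> (\<Sum>j<(5::nat). 336 / 49 + 3 / 4)"
      using mn unfolding h_def by (rule sum_mono)
    finally show False by simp
  qed
  then obtain c d where cd: "(\<Sum>j<5. h c d j) < 4 / 5" by blast
  define e f where "e j = u j - of_int c / 7 - of_int (m j c d)" and "f j = v j - of_int d / 7 - of_int (n j c d)" for j
  define Q :: "int poly" where "Q = (\<Sum>j<5. (monom (m j c d) 0 + monom (n j c d) 10) * monom 1 (6 * j))"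
  have Q: "poly (map_poly of_real X) z - ev Q z = (\<Sum>j<5. (of_real (e j) + of_real (f j) * z ^ 10) * (z ^ 6) ^ j)"
    if z: "z \<in> Z15" for z
  proof -
    have "(\<Sum>j<5. (z ^ 6) ^ j) = 0"
      using Z15_powers(2)[OF z] geometric_sum[of "z ^ 6" 5] by (simp add: Z5_iff)
    then have "(\<Sum>j<5. (of_real (of_int c / 7) + of_real (of_int d / 7) * z ^ 10) * (z ^ 6) ^ j) = 0"
      by (simp only: sum_distrib_left[symmetric]) simp
    moreover have "(\<Sum>j<5. (of_real (e j) + of_real (f j) * z ^ 10) * (z ^ 6) ^ j)
      = (\<Sum>j<5. (of_real (u j) + of_real (v j) * z ^ 10) * (z ^ 6) ^ j)
       - (\<Sum>j<5. (of_real (of_int c / 7) + of_real (of_int d / 7) * z ^ 10) * (z ^ 6) ^ j)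
       - (\<Sum>j<5. (of_int (m j c d) + of_int (n j c d) * z ^ 10) * (z ^ 6) ^ j)"
      unfolding sum_subtractf[symmetric] by (intro sum.cong refl) (simp add: e_def f_def algebra_simps)
    ultimately show ?thesis
      by (simp add: uv[OF z] Q_def power_mult)
  qed
  have "(\<Sum>z\<in>Z15. (cmod (poly (map_poly of_real X) z - ev Q z))\<^sup>2)
     = (\<Sum>z\<in>Z15. (cmod (\<Sum>j<5. (of_real (e j) + of_real (f j) * z ^ 10) * (z ^ 6) ^ j))\<^sup>2)"
    using Q by simp
  also have "\<dots> = (\<Sum>w\<in>Z3. \<Sum>y\<in>Z5. (cmod (\<Sum>j<5. (of_real (e j) + of_real (f j) * w) * y ^ j))\<^sup>2)"
    by (rule Z15_reindex)
  also have "\<dots> \<le> (\<Sum>w\<in>Z3. 5 * (\<Sum>j<5. (cmod (of_real (e j) + of_real (f j) * w))\<^sup>2))"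
    by (intro sum_mono parseval_Z5_le)
  also have "\<dots> = (\<Sum>w\<in>Z3. 5 * (\<Sum>j<5. h c d j))"
  proof -
    have "h c d j = hexnorm (e j) (f j)" for j by (simp only: h_def e_def f_def)
    then show ?thesis by (intro sum.cong refl) (simp add: cmod_Z3 hexnorm_def)
  qed
  also have "\<dots> < 8" using cd by simp
  finally show ?thesis by (intro exI[of _ Q]) simp
qed

section \<open>Explicit norm forms and the norm to \<open>\<rat>(\<surd>-15)\<close>\<close>

definition icong :: "int \<Rightarrow> int poly \<Rightarrow> int poly \<Rightarrow> int poly \<Rightarrow> bool" where
  "icong m P A B \<longleftrightarrow> (\<exists>U V. A - B = smult m U + P * V)"

lemma icongI: "A - B = smult m U + P * V \<Longrightarrow> icong m P A B"
  by (auto simp: icong_def)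

lemma icong_refl [simp]: "icong m P A A"
  by (rule icongI[of _ _ _ 0 _ 0]) simp

lemma icong_sym: "icong m P A B \<Longrightarrow> icong m P B A"
proof -
  assume "icong m P A B"
  then obtain U V where "A - B = smult m U + P * V" by (auto simp: icong_def)
  then have "B - A = - (smult m U + P * V)" by (metis minus_diff_eq)
  then show ?thesis by (intro icongI[of _ _ _ "- U" _ "- V"]) simp
qed

lemma icong_trans: "icong m P A B \<Longrightarrow> icong m P B C \<Longrightarrow> icong m P A C"
proof -
  assume "icong m P A B" "icong m P B C"
  then obtain U V U' V' where *: "A - B = smult m U + P * V" "B - C = smult m U' + P * V'"
    by (auto simp: icong_def)
  have "A - C = (A - B) + (B - C)" by simp
  then show ?thesis unfolding *
    by (intro icongI[of _ _ _ "U + U'" _ "V + V'"]) (simp add: smult_add_right algebra_simps)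
qed

lemma icong_mult: "icong m P A B \<Longrightarrow> icong m P C D \<Longrightarrow> icong m P (A * C) (B * D)"
proof -
  assume "icong m P A B" "icong m P C D"
  then obtain U V U' V' where *: "A - B = smult m U + P * V" "C - D = smult m U' + P * V'"
    by (auto simp: icong_def)
  have "A * C - B * D = (A - B) * C + B * (C - D)" by (simp add: algebra_simps)
  then show ?thesis unfolding *
    by (intro icongI[of _ _ _ "U * C + B * U'" _ "V * C + B * V'"]) (simp add: smult_add_right algebra_simps)
qed

lemma icong_power: "icong m P A B \<Longrightarrow> icong m P (A ^ k) (B ^ k)"
  by (induction k) (auto intro: icong_mult)

lemma icong_dvd: "P dvd A - B \<Longrightarrow> icong m P A B"
  by (metis add_0 dvdE icongI smult_0_right)

lemma ev_eq_mod: "A = B + P * Q \<Longrightarrow> ev P z = 0 \<Longrightarrow> ev A z = ev B z"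
  by simp

lemma power_mod_of_1: "x ^ n = (1 :: complex) \<Longrightarrow> x ^ k = x ^ (k mod n)"
proof -
  assume "x ^ n = 1"
  moreover have "x ^ k = (x ^ n) ^ (k div n) * x ^ (k mod n)"
    by (simp only: power_mult[symmetric] power_add[symmetric]) simp
  ultimately show ?thesis by simp
qed

lemma (in cyc) N_icong: "icong m Phi A B \<Longrightarrow> [N A = N B] (mod m)"
proof -
  assume "icong m Phi A B"
  then obtain U V where *: "A - B = smult m U + Phi * V" by (auto simp: icong_def)
  have "Phi dvd A - (B + smult m U)" using * by (simp add: algebra_simps)
  then have "N A = N (B + smult m U)" by (rule N_cong)
  then show ?thesis using N_mod by simp
qed

lemma nm3_formula: "nm3 [:a, b:] = a\<^sup>2 - a * b + b\<^sup>2"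
proof (rule n3.N_unique)
  obtain z where z: "z \<in> Z3" using n3.some_Z by blast
  have "(\<Prod>z\<in>Z3. ev [:a, b:] z) = (of_int a + of_int b * z) * (of_int a + of_int b * z ^ 2)"
    using n3.N_eq_hs[OF z, of "[:a, b:]"] n3.N_eq[of "[:a, b:]"] by (simp add: mult.commute)
  also have "z ^ 2 = - 1 - z" using Z3_square[OF z] by (simp add: power2_eq_square)
  also have "(of_int a + of_int b * z) * (of_int a + of_int b * (- 1 - z))
      = of_int a ^ 2 - of_int a * of_int b - of_int b ^ 2 * z - of_int b ^ 2 * (z * z)"
    by (simp add: algebra_simps power2_eq_square)
  also have "\<dots> = of_int (a\<^sup>2 - a * b + b\<^sup>2)"
    unfolding Z3_square[OF z] by (simp add: algebra_simps)
  finally show "of_int (a\<^sup>2 - a * b + b\<^sup>2) = (\<Prod>z\<in>Z3. ev [:a, b:] z)" by simp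
qed

definition nf5 :: "int \<Rightarrow> int \<Rightarrow> int \<Rightarrow> int \<Rightarrow> int" where
  "nf5 a b c d =
    (let s = a * a + b * b + c * c + d * d; t = a * b + b * c + c * d; u = a * c + b * d + a * d
     in s * s - s * t - s * u - t * t - u * u + 3 * (t * u))"

lemma nm5_formula: "nm5 [:a, b, c, d:] = nf5 a b c d"
proof (rule n5.N_unique)
  obtain y where y: "y \<in> Z5" using n5.some_Z by blast
  then have y5: "y ^ 5 = 1" and y0: "1 + y + y ^ 2 + y ^ 3 + y ^ 4 = 0"
    by (simp add: Z5_iff, simp add: Z5_def Phi5_def algebra_simps eval_nat_numeral)
  define s t u where "s = a * a + b * b + c * c + d * d" and "t = a * b + b * c + c * d"
    and "u = a * c + b * d + a * d"
  define f where "f x = of_int a + of_int b * x + of_int c * x ^ 2 + of_int d * x ^ 3" for x :: complex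
  have ev: "ev [:a, b, c, d:] x = f x" for x
    by (simp add: f_def algebra_simps eval_nat_numeral)
  \<comment> \<open>This is the norm to the real quadratic subfield; \<open>s\<close>,
    \<open>t\<close>, \<open>u\<close> are the cyclic autocorrelations of the coefficients.
    Replacing x by x^2 gives the conjugate factor.\<close>
  have 1: "f x * f (x ^ 4) = of_int s + of_int t * (x + x ^ 4) + of_int u * (x ^ 2 + x ^ 3)"
    if "x ^ 5 = 1" for x
  proof -
    have "x ^ 6 = x" "x ^ 7 = x ^ 2" "x ^ 8 = x ^ 3" "x ^ 9 = x ^ 4" "x ^ 10 = 1" "x ^ 11 = x" "x ^ 12 = x ^ 2"
      "x ^ 13 = x ^ 3" "x ^ 14 = x ^ 4" "x ^ 15 = 1"
      using power_mod_of_1[OF that, of 6] power_mod_of_1[OF that, of 7] power_mod_of_1[OF that, of 8]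
        power_mod_of_1[OF that, of 9] power_mod_of_1[OF that, of 10] power_mod_of_1[OF that, of 11]
        power_mod_of_1[OF that, of 12] power_mod_of_1[OF that, of 13] power_mod_of_1[OF that, of 14]
        power_mod_of_1[OF that, of 15] by simp_all
    moreover have "f x * f (x ^ 4) = of_int s * 1 + of_int (a * a - a * a) + of_int (b * b) * (x ^ 5 - 1)
        + of_int (c * c) * (x ^ 10 - 1) + of_int (d * d) * (x ^ 15 - 1)
        + of_int (a * b) * (x + x ^ 4) + of_int (a * c) * (x ^ 2 + x ^ 8) + of_int (a * d) * (x ^ 3 + x ^ 12)
        + of_int (b * c) * (x ^ 6 + x ^ 9) + of_int (b * d) * (x ^ 7 + x ^ 13) + of_int (c * d) * (x ^ 11 + x ^ 14)"
      by (simp add: f_def s_def algebra_simps power_mult[symmetric] power_add[symmetric])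
         (simp add: eval_nat_numeral mult_ac)
    ultimately show ?thesis using that by (simp add: t_def u_def algebra_simps)
  qed
  have y25: "(y ^ 2) ^ 5 = 1" using power_power_1[OF y5] .
  have p: "y ^ 8 = y ^ 3" "y ^ 6 = y"
    using power_mod_of_1[OF y5, of 8] power_mod_of_1[OF y5, of 6] by simp_all
  have f2: "f (y ^ 2) * f (y ^ 3) = of_int s + of_int t * (y ^ 2 + y ^ 3) + of_int u * (y ^ 4 + y)"
    using 1[OF y25] by (simp add: power_mult[symmetric] p)
  define T where "T = y + y ^ 4"
  have T1: "y ^ 2 + y ^ 3 = - 1 - T" using y0 unfolding T_def by (simp add: algebra_simps eq_neg_iff_add_eq_0)
  have T2: "T * T = 1 - T"
  proof -
    have "T * T = y ^ 2 + 2 * y ^ 5 + y ^ 8" by (simp add: T_def algebra_simps eval_nat_numeral)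
    also have "\<dots> = (y ^ 2 + y ^ 3) + 2" using y5 p by simp
    finally show ?thesis unfolding T1 by simp
  qed
  have "(\<Prod>z\<in>Z5. ev [:a, b, c, d:] z) = (f y * f (y ^ 4)) * (f (y ^ 2) * f (y ^ 3))"
    using n5.N_eq_hs[OF y, of "[:a, b, c, d:]"] n5.N_eq[of "[:a, b, c, d:]"]
    unfolding ev by (simp add: mult_ac)
  also have "\<dots> = (of_int s + of_int t * T + of_int u * (- 1 - T)) * (of_int s + of_int t * (- 1 - T) + of_int u * T)"
    unfolding 1[OF y5] f2 T1 T_def[symmetric] by (simp add: T_def add.commute)
  also have "\<dots> = of_int (s * s - s * t - s * u + t * u) + of_int (2 * t * u - t * t - u * u) * (T + T * T)"
    by (simp add: algebra_simps)
  also have "\<dots> = of_int (nf5 a b c d)"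
    unfolding T2 by (simp add: nf5_def Let_def s_def[symmetric] t_def[symmetric] u_def[symmetric])
  finally show "of_int (nf5 a b c d) = (\<Prod>z\<in>Z5. ev [:a, b, c, d:] z)" by simp
qed

lemma poly_degree_lt_2: "degree (R :: int poly) < 2 \<Longrightarrow> \<exists>a b. R = [:a, b:]"
  by (intro exI[of _ "coeff R 0"] exI[of _ "coeff R 1"])
     (auto simp: poly_eq_iff coeff_pCons coeff_eq_0 split: nat.split)

lemma poly_degree_lt_4: "degree (R :: int poly) < 4 \<Longrightarrow> \<exists>a b c d. R = [:a, b, c, d:]"
  by (intro exI[of _ "coeff R 0"] exI[of _ "coeff R 1"] exI[of _ "coeff R 2"] exI[of _ "coeff R 3"])
     (auto simp: poly_eq_iff coeff_pCons coeff_eq_0 numeral_2_eq_2 numeral_3_eq_3 split: nat.split)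

lemma poly_degree_lt_8:
  assumes "degree (R :: int poly) < 8"
  shows "R = [:coeff R 0, coeff R 1, coeff R 2, coeff R 3, coeff R 4, coeff R 5, coeff R 6, coeff R 7:]"
proof (rule poly_eqI)
  fix n
  show "coeff R n = coeff [:coeff R 0, coeff R 1, coeff R 2, coeff R 3, coeff R 4, coeff R 5, coeff R 6, coeff R 7:] n"
  proof (cases "n < 8")
    case True
    then have "n = 0 \<or> n = 1 \<or> n = 2 \<or> n = 3 \<or> n = 4 \<or> n = 5 \<or> n = 6 \<or> n = 7" by presburger
    then show ?thesis by (elim disjE) (simp_all add: coeff_pCons numeral_eq_Suc)
  next
    case False
    then have "coeff R n = 0" using assms by (intro coeff_eq_0) simp
    moreover have "degree [:coeff R 0, coeff R 1, coeff R 2, coeff R 3, coeff R 4, coeff R 5, coeff R 6, coeff R 7:] < n"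
    proof -
      have "degree [:coeff R 0, coeff R 1, coeff R 2, coeff R 3, coeff R 4, coeff R 5, coeff R 6, coeff R 7:] \<le> 7"
        by (simp add: degree_pCons_le)
      then show ?thesis using False by simp
    qed
    ultimately show ?thesis by (simp add: coeff_eq_0)
  qed
qed

lemma reduce3: "\<exists>a b. Phi3 dvd F - [:a, b:]"
  using n3.division[of F] poly_degree_lt_2 by (metis add_diff_cancel_right' card_Z(1) dvd_triv_left)

lemma reduce5: "\<exists>a b c d. Phi5 dvd F - [:a, b, c, d:]"
  using n5.division[of F] poly_degree_lt_4 by (metis add_diff_cancel_right' card_Z(2) dvd_triv_left)

text \<open>As 1 + x^3 is a unit modulo \<open>Phi5\<close>, the pair \<open>Phi15\<close>,
  \<open>Phi5\<close> generates the same ideal as 3, \<open>Phi5\<close>: values at roots of order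
  15 and 5 are tied exactly modulo 3. The next identity ties orders 15 and 3 modulo 5.\<close>

lemma Phi15_mod_Phi5: "Phi15 = smult 3 [:1, 0, 0, 1:] + Phi5 * [:-2, 1, 1, -2, 1:]"
  by (simp add: Phi15_def Phi5_def)

lemma Phi15_mod_Phi3: "Phi15 = smult 5 [:0, -1:] + Phi3 * [:1, 3, -4, 2, 1, -2, 1:]"
  by (simp add: Phi15_def Phi3_def)

text \<open>The value of \<open>theta\<close> at a primitive 15th root of unity is \<open>(1 \<plusminus> \<surd>-15) / 2\<close>.\<close>

definition theta :: "int poly" where "theta = [:0, 1, 1, 0, 1, 0, 0, 0, 1:]"

lemma ev_theta: "ev theta z = z + z ^ 2 + z ^ 4 + z ^ 8"
  by (simp add: theta_def algebra_simps eval_nat_numeral)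

lemma Z15_power_mod: "z \<in> Z15 \<Longrightarrow> z ^ k = z ^ (k mod 15)"
  by (rule power_mod_of_1) (simp add: Z15_iff)

text \<open>\<open>theta\<close> is the Gauss period of the subgroup {1, 2, 4, 8} of the units
  modulo 15, and 7 represents the other coset. The two periods have sum 1 and product 4.\<close>

lemma theta_conj:
  assumes z: "z \<in> Z15"
  shows "ev theta (z ^ 7) = 1 - ev theta z" "ev theta z * ev theta z = ev theta z - 4"
proof -
  have r: "ev Phi15 z = 0" using z by (simp add: Z15_def)
  have "theta + [:0,0,0,0,0,0,0,1,0,0,0,1,0,1,1:] = 1 + Phi15 * [:-1, 0, 1, 2, 2, 2, 1:]"
    by (simp add: theta_def Phi15_def one_pCons)
  from ev_eq_mod[OF this r]
  have "ev theta z + ev [:0,0,0,0,0,0,0,1,0,0,0,1,0,1,1:] z = 1" by (simp only: ev_add ev_1)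
  moreover have "ev [:0,0,0,0,0,0,0,1,0,0,0,1,0,1,1:] z = z ^ 7 + z ^ 11 + z ^ 13 + z ^ 14"
    by (simp add: algebra_simps eval_nat_numeral)
  moreover have "ev theta (z ^ 7) = z ^ 7 + z ^ 14 + z ^ 13 + z ^ 11"
    using Z15_power_mod[OF z, of 28] Z15_power_mod[OF z, of 56]
    by (simp add: ev_theta power_mult[symmetric])
  ultimately show "ev theta (z ^ 7) = 1 - ev theta z" by (simp add: algebra_simps)
  have "theta * theta = theta - 4 + Phi15 * [:4, 3, 3, 1, 2, 0, 1, 1, 1:]"
    by (simp add: theta_def Phi15_def numeral_poly)
  from ev_eq_mod[OF this r]
  show "ev theta z * ev theta z = ev theta z - 4" by (simp only: ev_mult ev_diff) (simp add: numeral_poly)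
qed

text \<open>The product over the subgroup {1, 2, 4, 8} is invariant under x to x^2, hence of the
  form a + b theta. At fifth roots the four exponents become 1, 2, 4, 3, at cube roots 1, 2, 1, 2;
  there \<open>theta\<close> is -1 and -2, and the product is \<open>nm5 F\<close> and
  \<open>(nm3 F)\<^sup>2\<close>.\<close>

lemma quadratic_norm:
  "\<exists>a b. (\<forall>z\<in>Z15. ev F z * ev F (z ^ 2) * ev F (z ^ 4) * ev F (z ^ 8) = of_int a + of_int b * ev theta z)
     \<and> nm15 F = a\<^sup>2 + a * b + 4 * b\<^sup>2 \<and> [nm5 F = a - b] (mod 3) \<and> [(nm3 F)\<^sup>2 = a - 2 * b] (mod 5)"
proof -
  define P where "P = F * pcompose F (monom 1 2) * pcompose F (monom 1 4) * pcompose F (monom 1 8)"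
  have evP: "ev P z = ev F z * ev F (z ^ 2) * ev F (z ^ 4) * ev F (z ^ 8)" for z
    by (simp add: P_def)
  obtain Q R where QR: "P = Phi15 * Q + R" "degree R < card Z15" using n15.division by blast
  define r where "r = coeff R"
  have R: "R = [:r 0, r 1, r 2, r 3, r 4, r 5, r 6, r 7:]"
    using poly_degree_lt_8[of R] QR(2) by (simp add: r_def)
  have evR: "ev R z = ev P z" if "z \<in> Z15" for z using that n15.root by (simp add: QR(1))
  \<comment> \<open>The remainder of R(x^2) - R(x) modulo \<open>Phi15\<close>; its coefficients are
    the linear conditions for invariance.\<close>
  define S :: "int poly" where "S = [:r 7 - r 4 - r 5, r 4 - r 1, r 1 - r 6 - r 7 - r 2, r 7 - r 4 - r 3,
     r 2 - r 7, - r 4 - 2 * r 5, r 3 + r 7 - r 6, r 4 - r 6 - 2 * r 7:]"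
  have "S = 0"
  proof (rule n15.low_degree_int_eq_0)
    show "degree S < card Z15" by (simp add: S_def)
    fix z assume z: "z \<in> Z15"
    have z2: "z ^ 2 \<in> Z15" using n15.bij[OF z] by (auto simp: bij_betw_def)
    have "ev P (z ^ 2) = ev P z"
      using Z15_power_mod[OF z, of 16] by (simp add: evP power_mult[symmetric] mult_ac)
    then have e: "ev R (z ^ 2) - ev R z = 0" using evR z z2 by simp
    have r0: "ev Phi15 z = 0" using z by (simp add: Z15_def)
    have "pcompose R (monom 1 2) - R = S + Phi15 * (smult (r 4) 1 + smult (r 5) [:1, 1, 1:]
       + smult (r 6) [:0, 0, 1, 1, 1:] + smult (r 7) [:-1, -1, 0, 0, 1, 1, 1:])"
      by (simp add: R S_def Phi15_def pcompose_pCons monom_altdef eval_nat_numeral one_pCons algebra_simps)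
    from ev_eq_mod[OF this r0]
    show "ev S z = 0" using e by (simp only: ev_diff ev_pcompose ev_monom) simp
  qed
  then have eqs: "r 4 = r 1" "r 2 = r 7" "r 4 = - 2 * r 5" "r 7 = r 4 + r 5" "r 7 = r 4 + r 3" "r 6 = r 3 + r 7"
    by (simp_all add: S_def)
  define a b where "a = r 0 + r 7" and "b = r 7"
  have Rab: "R = [:a:] + smult b theta - smult b Phi15"
    using eqs by (simp add: R a_def b_def theta_def Phi15_def)
  have Z15ab: "ev P z = of_int a + of_int b * ev theta z" if "z \<in> Z15" for z
    using evR[OF that] that by (simp add: Rab Z15_def)
  have P: "P = [:a:] + smult b theta + Phi15 * (Q - [:b:])"
    by (simp add: QR(1) Rab algebra_simps)
  have "nm15 F = a\<^sup>2 + a * b + 4 * b\<^sup>2"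
  proof (rule n15.N_unique)
    obtain z where z: "z \<in> Z15" using n15.some_Z by blast
    have z7: "z ^ 7 \<in> Z15" using n15.bij[OF z] by (auto simp: bij_betw_def)
    define t where "t = ev theta z"
    have "of_int (nm15 F) = ev P z * ev P (z ^ 7)"
      using n15.N_eq_hs[OF z, of F] Z15_power_mod[OF z, of 28] Z15_power_mod[OF z, of 56]
      by (simp add: evP power_mult[symmetric] mult_ac)
    also have "\<dots> = (of_int a + of_int b * t) * (of_int a + of_int b * (1 - t))"
      using Z15ab z z7 theta_conj(1)[OF z] by (simp add: t_def)
    also have "\<dots> = of_int (a\<^sup>2 + a * b) + of_int (b\<^sup>2) * (t - t * t)"
      by (simp add: algebra_simps power2_eq_square)
    also have "t * t = t - 4" using theta_conj(2)[OF z] by (simp add: t_def)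
    finally show "of_int (a\<^sup>2 + a * b + 4 * b\<^sup>2) = (\<Prod>z\<in>Z15. ev F z)"
      by (simp add: n15.N_eq algebra_simps)
  qed
  moreover have "[nm5 F = a - b] (mod 3)"
  proof -
    have "3 dvd nm5 F - (a - b)"
    proof (rule n5.int_dvd_of_values)
      fix y assume y: "y \<in> Z5"
      then have y5: "y ^ 5 = 1" and y0: "ev Phi5 y = 0" by (simp add: Z5_iff, simp add: Z5_def)
      have y8: "y ^ 8 = y ^ 3" using power_mod_of_1[OF y5, of 8] by simp
      have "of_int (nm5 F) = ev P y"
        using n5.N_eq_hs[OF y, of F] by (simp add: evP y8 mult_ac)
      moreover have "ev theta y = - 1"
        using y0 by (simp add: ev_theta y8) (simp add: Phi5_def algebra_simps eval_nat_numeral eq_neg_iff_add_eq_0)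
      moreover have "ev Phi15 y = 3 * ev [:1, 0, 0, 1:] y"
        using ev_eq_mod[OF Phi15_mod_Phi5 y0] by (simp only: ev_smult) simp
      ultimately show "of_int (nm5 F - (a - b)) = of_int 3 * ev ([:1, 0, 0, 1:] * (Q - [:b:])) y"
        unfolding P ev_add ev_mult ev_smult by (simp add: algebra_simps)
    qed
    then show ?thesis by (simp add: cong_iff_dvd_diff)
  qed
  moreover have "[(nm3 F)\<^sup>2 = a - 2 * b] (mod 5)"
  proof -
    have "5 dvd (nm3 F)\<^sup>2 - (a - 2 * b)"
    proof (rule n3.int_dvd_of_values)
      fix y assume y: "y \<in> Z3"
      then have y3: "y ^ 3 = 1" and y0: "ev Phi3 y = 0" by (simp add: Z3_iff, simp add: Z3_def)
      have p: "y ^ 4 = y" "y ^ 8 = y ^ 2"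
        using power_mod_of_1[OF y3, of 4] power_mod_of_1[OF y3, of 8] by simp_all
      have "of_int ((nm3 F)\<^sup>2) = ev P y"
        using n3.N_eq_hs[OF y, of F] by (simp add: evP p power2_eq_square mult_ac)
      moreover have "ev theta y = - 2"
      proof -
        have "ev theta y = 2 * (ev Phi3 y - 1)"
          by (simp add: ev_theta p) (simp add: Phi3_def power2_eq_square algebra_simps)
        then show ?thesis using y0 by simp
      qed
      moreover have "ev Phi15 y = 5 * ev [:0, -1:] y"
        using ev_eq_mod[OF Phi15_mod_Phi3 y0] by (simp only: ev_smult) simp
      ultimately show "of_int ((nm3 F)\<^sup>2 - (a - 2 * b)) = of_int 5 * ev ([:0, -1:] * (Q - [:b:])) y"
        unfolding P ev_add ev_mult ev_smult by (simp add: algebra_simps)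
    qed
    then show ?thesis by (simp add: cong_iff_dvd_diff)
  qed
  ultimately show ?thesis using Z15ab evP by (intro exI[of _ a] exI[of _ b]) simp
qed

section \<open>Residue fields and the Euclidean property\<close>

text \<open>The prime 5 is inert in the ring generated by a cube root of unity, so the norm form of
  the field with 25 elements has no nontrivial zero.\<close>

lemma hexagonal_form_mod5:
  "\<forall>a\<in>set [0, 1, 2, 3, 4 :: int]. \<forall>b\<in>set [0, 1, 2, 3, 4 :: int].
     (a * a - a * b + b * b) mod 5 = 0 \<longrightarrow> a = 0 \<and> b = 0"
  by code_simp

text \<open>In the field with 25 elements the group of norm 1 has order 6 and consists of the units
  \<open>\<plusminus>\<omega>^j\<close>. The three alternatives are multiplication by these units
  for j = 0, 1, 2.\<close>

lemma hexagonal_form_mod5_orbit: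
  "\<forall>a\<in>set [0, 1, 2, 3, 4 :: int]. \<forall>b\<in>set [0, 1, 2, 3, 4 :: int].
   \<forall>c\<in>set [0, 1, 2, 3, 4 :: int]. \<forall>d\<in>set [0, 1, 2, 3, 4 :: int].
     (a * a - a * b + b * b) mod 5 = (c * c - c * d + d * d) mod 5 \<longrightarrow> (a * a - a * b + b * b) mod 5 \<noteq> 0 \<longrightarrow>
     (\<exists>s\<in>set [1, -1]. (c - s * a) mod 5 = 0 \<and> (d - s * b) mod 5 = 0
        \<or> (c + s * b) mod 5 = 0 \<and> (d - s * (a - b)) mod 5 = 0
        \<or> (c - s * (b - a)) mod 5 = 0 \<and> (d + s * a) mod 5 = 0)"
  by code_simp

text \<open>The prime 3 is inert in the field of fifth roots of unity; the residue field has 81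
  elements.\<close>

lemma nf5_mod3:
  "\<forall>a\<in>set [0, 1, 2 :: int]. \<forall>b\<in>set [0, 1, 2 :: int]. \<forall>c\<in>set [0, 1, 2 :: int]. \<forall>d\<in>set [0, 1, 2 :: int].
     nf5 a b c d mod 3 = 0 \<longrightarrow> a = 0 \<and> b = 0 \<and> c = 0 \<and> d = 0"
  by code_simp

text \<open>Multiplication by \<open>1 + x\<^sup>2\<close> modulo 3 and \<open>Phi5\<close>; this unit generates the norm 1 subgroup, of order 40.\<close>

definition step4 :: "int \<times> int \<times> int \<times> int \<Rightarrow> int \<times> int \<times> int \<times> int" where
  "step4 = (\<lambda>(a, b, c, d). ((a - c + d) mod 3, (b - c) mod 3, a, (b + d - c) mod 3))"

primrec orbit4 :: "nat \<Rightarrow> int \<times> int \<times> int \<times> int \<Rightarrow> (int \<times> int \<times> int \<times> int) list" where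
  "orbit4 0 t = []"
| "orbit4 (Suc n) t = t # orbit4 n (step4 t)"

lemma nf5_mod3_orbit:
  "let L = orbit4 40 (1, 0, 0, 0) in
   \<forall>a\<in>set [0, 1, 2 :: int]. \<forall>b\<in>set [0, 1, 2 :: int]. \<forall>c\<in>set [0, 1, 2 :: int]. \<forall>d\<in>set [0, 1, 2 :: int].
     nf5 a b c d mod 3 = 1 \<longrightarrow> (a, b, c, d) \<in> set L"
  by code_simp

lemma mod_5_cases: "(a::int) mod 5 \<in> set [0, 1, 2, 3, 4]"
  by (simp; presburger)

lemma mod_3_cases: "(a::int) mod 3 \<in> set [0, 1, 2]"
  by (simp; presburger)

lemma hexagonal_form_mod: "(a mod m * (a mod m) - a mod m * (b mod m) + b mod m * (b mod m)) mod m
    = (a * a - a * b + b * b) mod (m::int)"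
  unfolding cong_def[symmetric]
  by (intro cong_add cong_diff cong_mult) (simp_all add: cong_def)

lemma nf5_mod: "nf5 (a mod 3) (b mod 3) (c mod 3) (d mod 3) mod 3 = nf5 a b c d mod 3"
  unfolding cong_def[symmetric] nf5_def Let_def
  by (intro cong_add cong_diff cong_mult) (simp_all add: cong_def)

lemma icong_coeffs2: "m dvd a - c \<Longrightarrow> m dvd b - d \<Longrightarrow> icong m P [:a, b:] [:c, d:]"
proof -
  assume "m dvd a - c" "m dvd b - d"
  then obtain k l where "a - c = m * k" "b - d = m * l" by (auto elim!: dvdE)
  then show ?thesis by (intro icongI[of _ _ _ "[:k, l:]" _ 0]) simp
qed

lemma icong_coeffs4:
  "m dvd a - a' \<Longrightarrow> m dvd b - b' \<Longrightarrow> m dvd c - c' \<Longrightarrow> m dvd d - d' \<Longrightarrow>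
    icong m P [:a, b, c, d:] [:a', b', c', d':]"
proof -
  assume "m dvd a - a'" "m dvd b - b'" "m dvd c - c'" "m dvd d - d'"
  then obtain i j k l where "a - a' = m * i" "b - b' = m * j" "c - c' = m * k" "d - d' = m * l"
    by (auto elim!: dvdE)
  then show ?thesis by (intro icongI[of _ _ _ "[:i, j, k, l:]" _ 0]) simp
qed

lemma nm3_dvd5: "5 dvd nm3 F \<Longrightarrow> icong 5 Phi3 F 0"
proof -
  assume F: "5 dvd nm3 F"
  obtain a b where ab: "Phi3 dvd F - [:a, b:]" using reduce3 by blast
  have "(a * a - a * b + b * b) mod 5 = 0"
    using F n3.N_cong[OF ab] nm3_formula[of a b] by (simp add: power2_eq_square mod_eq_0_iff_dvd)
  then have "a mod 5 = 0 \<and> b mod 5 = 0"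
    using hexagonal_form_mod5[rule_format, OF mod_5_cases[of a] mod_5_cases[of b]]
    by (simp only: hexagonal_form_mod)
  then have "icong 5 Phi3 [:a, b:] [:0, 0:]" by (intro icong_coeffs2) auto
  then show ?thesis using icong_trans[OF icong_dvd[OF ab]] by simp
qed

lemma nm5_dvd3: "3 dvd nm5 F \<Longrightarrow> icong 3 Phi5 F 0"
proof -
  assume F: "3 dvd nm5 F"
  obtain a b c d where ab: "Phi5 dvd F - [:a, b, c, d:]" using reduce5 by blast
  have "nf5 a b c d mod 3 = 0"
    using F n5.N_cong[OF ab] nm5_formula[of a b c d] by (simp add: mod_eq_0_iff_dvd)
  then have "a mod 3 = 0 \<and> b mod 3 = 0 \<and> c mod 3 = 0 \<and> d mod 3 = 0"
    using nf5_mod3[rule_format, OF mod_3_cases[of a] mod_3_cases[of b] mod_3_cases[of c] mod_3_cases[of d]]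
    by (simp only: nf5_mod)
  then have "icong 3 Phi5 [:a, b, c, d:] [:0, 0, 0, 0:]" by (intro icong_coeffs4) auto
  then show ?thesis using icong_trans[OF icong_dvd[OF ab]] by simp
qed

lemma nm3_orbit:
  assumes "[nm3 B = nm3 A] (mod 5)" "\<not> 5 dvd nm3 A"
  shows "\<exists>s\<in>{1, -1}. \<exists>j<3. icong 5 Phi3 B (smult s (monom 1 j * A))"
proof -
  obtain a b where ab: "Phi3 dvd A - [:a, b:]" using reduce3 by blast
  obtain c d where cd: "Phi3 dvd B - [:c, d:]" using reduce3 by blast
  have n: "nm3 A = a * a - a * b + b * b" "nm3 B = c * c - c * d + d * d"
    using n3.N_cong[OF ab] nm3_formula[of a b] n3.N_cong[OF cd] nm3_formula[of c d]
    by (simp_all add: power2_eq_square)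
  have "\<exists>s\<in>set [1, -1]. (c mod 5 - s * (a mod 5)) mod 5 = 0 \<and> (d mod 5 - s * (b mod 5)) mod 5 = 0
        \<or> (c mod 5 + s * (b mod 5)) mod 5 = 0 \<and> (d mod 5 - s * (a mod 5 - b mod 5)) mod 5 = 0
        \<or> (c mod 5 - s * (b mod 5 - a mod 5)) mod 5 = 0 \<and> (d mod 5 + s * (a mod 5)) mod 5 = 0"
    by (rule hexagonal_form_mod5_orbit[rule_format, OF mod_5_cases[of a] mod_5_cases[of b] mod_5_cases[of c] mod_5_cases[of d]])
       (use assms in \<open>simp_all only: hexagonal_form_mod n cong_def dvd_eq_mod_eq_0 not_False_eq_True\<close>)
  moreover have "(x mod 5 - s * (y mod 5)) mod 5 = (x - s * y) mod 5"
      "(x mod 5 + s * (y mod 5)) mod 5 = (x + s * y) mod 5"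
      "(x mod 5 - s * (y mod 5 - w mod 5)) mod 5 = (x - s * (y - w)) mod 5" for x y w s :: int
    unfolding cong_def[symmetric] by (intro cong_add cong_diff cong_mult; simp add: cong_def)+
  ultimately have "\<exists>s\<in>{1, -1}. (c - s * a) mod 5 = 0 \<and> (d - s * b) mod 5 = 0
        \<or> (c + s * b) mod 5 = 0 \<and> (d - s * (a - b)) mod 5 = 0
        \<or> (c - s * (b - a)) mod 5 = 0 \<and> (d + s * a) mod 5 = 0"
    by (simp only: list.set)
  then obtain s where s: "s \<in> {1, -1}" and cases: "5 dvd c - s * a \<and> 5 dvd d - s * b
        \<or> 5 dvd c - s * (- b) \<and> 5 dvd d - s * (a - b) \<or> 5 dvd c - s * (b - a) \<and> 5 dvd d - s * (- a)"
    unfolding mod_eq_0_iff_dvd mult_minus_right diff_minus_eq_add by blast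
  have x0: "icong 5 Phi3 (smult s (monom 1 0 * A)) [:s * a, s * b:]"
    using icong_mult[OF icong_refl[of _ _ "[:s:]"] icong_dvd[OF ab]] by (simp add: one_pCons[symmetric] monom_0 mult.commute)
  have X: "icong 5 Phi3 ([:0, 1:] * [:e, f:]) [:- f, e - f:]" for e f
    by (rule icong_dvd, rule dvdI[of _ _ "[:f:]"]) (simp add: Phi3_def)
  have x1: "icong 5 Phi3 (smult s (monom 1 1 * A)) [:s * (- b), s * (a - b):]"
    using icong_trans[OF icong_mult[OF icong_refl[of _ _ "[:0, 1:]"] x0] X]
    by (simp add: monom_altdef algebra_simps)
  have x2: "icong 5 Phi3 (smult s (monom 1 2 * A)) [:s * (b - a), s * (- a):]"
    using icong_trans[OF icong_mult[OF icong_refl[of _ _ "[:0, 1:]"] x1] X]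
    by (simp add: monom_altdef power2_eq_square algebra_simps)
  have B: "icong 5 Phi3 B [:c, d:]" using icong_dvd[OF cd] .
  show ?thesis
    using cases
  proof (elim disjE conjE)
    assume "5 dvd c - s * a" "5 dvd d - s * b"
    then have "icong 5 Phi3 [:c, d:] [:s * a, s * b:]" by (rule icong_coeffs2)
    then show ?thesis using s B x0 by (intro bexI[of _ s] exI[of _ 0]) (auto intro: icong_trans icong_sym)
  next
    assume "5 dvd c - s * (- b)" "5 dvd d - s * (a - b)"
    then have "icong 5 Phi3 [:c, d:] [:s * (- b), s * (a - b):]" by (rule icong_coeffs2)
    then show ?thesis using s B x1 by (intro bexI[of _ s] exI[of _ 1]) (auto intro: icong_trans icong_sym)
  next
    assume "5 dvd c - s * (b - a)" "5 dvd d - s * (- a)"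
    then have "icong 5 Phi3 [:c, d:] [:s * (b - a), s * (- a):]" by (rule icong_coeffs2)
    then show ?thesis using s B x2 by (intro bexI[of _ s] exI[of _ 2]) (auto intro: icong_trans icong_sym)
  qed
qed

lemma orbit4_powers:
  assumes "(a, b, c, d) \<in> set (orbit4 n (a0, b0, c0, d0))" "icong 3 Phi5 [:a0, b0, c0, d0:] ([:1, 0, 1:] ^ j)"
  shows "\<exists>k. icong 3 Phi5 [:a, b, c, d:] ([:1, 0, 1:] ^ k)"
  using assms
proof (induction n arbitrary: a0 b0 c0 d0 j)
  case (Suc n)
  show ?case
  proof (cases "(a, b, c, d) = (a0, b0, c0, d0)")
    case True
    then show ?thesis using Suc.prems by blast
  next
    case False
    have i1: "icong 3 Phi5 [:a0 - c0 + d0, b0 - c0, a0, b0 + d0 - c0:] ([:1, 0, 1:] * [:a0, b0, c0, d0:])"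
      by (rule icong_sym, rule icong_dvd, rule dvdI[of _ _ "[:c0 - d0, d0:]"]) (simp add: Phi5_def)
    have i2: "icong 3 Phi5 [:(a0 - c0 + d0) mod 3, (b0 - c0) mod 3, a0, (b0 + d0 - c0) mod 3:]
        [:a0 - c0 + d0, b0 - c0, a0, b0 + d0 - c0:]"
      by (intro icong_coeffs4) (auto simp: mod_eq_dvd_iff[symmetric])
    have i3: "icong 3 Phi5 ([:1, 0, 1:] * [:a0, b0, c0, d0:]) ([:1, 0, 1:] * [:1, 0, 1:] ^ j)"
      using Suc.prems(2) by (intro icong_mult icong_refl)
    have "icong 3 Phi5 [:(a0 - c0 + d0) mod 3, (b0 - c0) mod 3, a0, (b0 + d0 - c0) mod 3:]
        ([:1, 0, 1:] ^ Suc j)"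
      unfolding power_Suc by (rule icong_trans[OF i2 icong_trans[OF i1 i3]])
    moreover have "(a, b, c, d) \<in> set (orbit4 n ((a0 - c0 + d0) mod 3, (b0 - c0) mod 3, a0, (b0 + d0 - c0) mod 3))"
      using Suc.prems(1) False by (auto simp: step4_def)
    ultimately show ?thesis using Suc.IH by blast
  qed
qed simp

lemma nm5_orbit:
  assumes "[nm5 F = 1] (mod 3)"
  shows "\<exists>k. icong 3 Phi5 F ([:1, 0, 1:] ^ k)"
proof -
  obtain a b c d where ab: "Phi5 dvd F - [:a, b, c, d:]" using reduce5 by blast
  have "nf5 a b c d mod 3 = 1"
    using assms n5.N_cong[OF ab] nm5_formula[of a b c d] by (simp add: cong_def)
  then have "(a mod 3, b mod 3, c mod 3, d mod 3) \<in> set (orbit4 40 (1, 0, 0, 0))"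
    using nf5_mod3_orbit[unfolded Let_def, rule_format, OF mod_3_cases[of a] mod_3_cases[of b] mod_3_cases[of c] mod_3_cases[of d]]
    by (simp only: nf5_mod)
  moreover have "icong 3 Phi5 [:1, 0, 0, 0:] ([:1, 0, 1:] ^ 0)" by (simp add: one_pCons)
  ultimately obtain k where k: "icong 3 Phi5 [:a mod 3, b mod 3, c mod 3, d mod 3:] ([:1, 0, 1:] ^ k)"
    using orbit4_powers by blast
  have "icong 3 Phi5 [:a, b, c, d:] [:a mod 3, b mod 3, c mod 3, d mod 3:]"
    by (intro icong_coeffs4) (auto simp: mod_eq_dvd_iff[symmetric])
  then show ?thesis using k icong_dvd[OF ab] icong_trans by blast
qed

lemma nm3_mod3: "[nm3 F = (poly F 1)\<^sup>2] (mod 3)"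
  using n3.N_cong_at[of F 1] by (simp add: Phi3_def power2_eq_square)

lemma nm5_mod5: "[nm5 F = (poly F 1) ^ 4] (mod 5)"
  using n5.N_cong_at[of F 1] by (simp add: Phi5_def eval_nat_numeral mult.assoc)

text \<open>Modulo \<open>P\<close> the integer \<open>q\<close> is a multiple of x - 1, so both
  parts of \<open>F = (F - F(1)) + F(1)\<close> are.\<close>

lemma divide_by_x_minus_1:
  assumes "q dvd poly F (1::int)" "P = [:q:] + [:-1, 1:] * V"
  shows "\<exists>F'. P dvd F - [:-1, 1:] * F'"
proof -
  have "[:-1, 1:] dvd F - [:poly F 1:]" by (simp add: poly_eq_0_iff_dvd[symmetric])
  then obtain F1 where F1: "F - [:poly F 1:] = [:-1, 1:] * F1" by (rule dvdE)
  obtain c where c: "poly F 1 = q * c" using assms(1) by (rule dvdE)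
  have ring: "A - X * F1 = Q * C \<Longrightarrow> P = Q + X * V \<Longrightarrow> A - X * (F1 - C * V) = P * C"
    for A X F1 Q C P V :: "int poly"
    by (simp add: algebra_simps)
  have "F - [:-1, 1:] * F1 = [:q:] * [:c:]" using F1 c by (simp add: algebra_simps)
  from ring[OF this assms(2)] show ?thesis by (metis dvd_triv_left)
qed

lemma Phi3_at_1: "Phi3 = [:3:] + [:-1, 1:] * [:2, 1:]"
  by (simp add: Phi3_def)

lemma Phi5_at_1: "Phi5 = [:5:] + [:-1, 1:] * [:4, 3, 2, 1:]"
  by (simp add: Phi5_def)

text \<open>The ramified element is x - 1, whose square is -3x modulo \<open>Phi3\<close>.\<close>

lemma nm3_zero: "nm3 F = 0 \<Longrightarrow> Phi3 dvd F"
proof (rule n3.N_zero_imp_dvd_by_ramified[of 3 "[:-1, 1:]" 2 "[:0, -1:]"])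
  show "nm3 [:-1, 1:] \<noteq> 0" by (simp add: nm3_formula)
  show "Phi3 dvd [:-1, 1:]\<^sup>2 - smult 3 [:0, -1:]" by (simp add: Phi3_def power2_eq_square)
  fix H assume "nm3 H = 0"
  then have "3 dvd (poly H 1)\<^sup>2" using nm3_mod3[of H] by (simp add: cong_iff_dvd_diff)
  then have "3 dvd poly H 1" using prime_dvd_power[of "3::int"] by simp
  then show "\<exists>H'. Phi3 dvd H - [:-1, 1:] * H'" using divide_by_x_minus_1 Phi3_at_1 by blast
qed simp_all

lemma nm5_x_minus_1: "nm5 [:-1, 1:] = 5"
  using nm5_formula[of "-1" 1 0 0] by (simp add: nf5_def)

lemma nm5_zero: "nm5 F = 0 \<Longrightarrow> Phi5 dvd F"
proof (rule n5.N_zero_imp_dvd_by_ramified[of 5 "[:-1, 1:]" 4 "[:0, -1, 1, -1:]"])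
  show "nm5 [:-1, 1:] \<noteq> 0" by (simp add: nm5_x_minus_1)
  show "Phi5 dvd [:-1, 1:] ^ 4 - smult 5 [:0, -1, 1, -1:]" by (simp add: Phi5_def eval_nat_numeral)
  fix H assume "nm5 H = 0"
  then have "5 dvd (poly H 1) ^ 4" using nm5_mod5[of H] by (simp add: cong_iff_dvd_diff)
  then have "5 dvd poly H 1" using prime_dvd_power[of "5::int"] by simp
  then show "\<exists>H'. Phi5 dvd H - [:-1, 1:] * H'" using divide_by_x_minus_1 Phi5_at_1 by blast
qed simp_all

lemma nm15_mod3: "[nm15 F = (nm5 F)\<^sup>2] (mod 3)"
proof -
  obtain a b where *: "nm15 F = a\<^sup>2 + a * b + 4 * b\<^sup>2" "[nm5 F = a - b] (mod 3)"
    using quadratic_norm by blast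
  have "[(nm5 F)\<^sup>2 = (a - b)\<^sup>2] (mod 3)" using *(2) by (rule cong_pow)
  also have "[(a - b)\<^sup>2 = nm15 F] (mod 3)"
    unfolding *(1) cong_iff_dvd_diff by (rule dvdI[of _ _ "- (a * b) - b\<^sup>2"]) (simp add: power2_eq_square algebra_simps)
  finally show ?thesis by (rule cong_sym)
qed

lemma nm15_mod5: "[nm15 F = (nm3 F) ^ 4] (mod 5)"
proof -
  obtain a b where *: "nm15 F = a\<^sup>2 + a * b + 4 * b\<^sup>2" "[(nm3 F)\<^sup>2 = a - 2 * b] (mod 5)"
    using quadratic_norm by blast
  have "[((nm3 F)\<^sup>2)\<^sup>2 = (a - 2 * b)\<^sup>2] (mod 5)" using *(2) by (rule cong_pow)
  also have "[(a - 2 * b)\<^sup>2 = nm15 F] (mod 5)"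
    unfolding *(1) cong_iff_dvd_diff by (rule dvdI[of _ _ "- (a * b)"]) (simp add: power2_eq_square algebra_simps)
  finally show ?thesis by (simp add: power_mult[symmetric] cong_sym_eq)
qed

lemma three_mod_Phi15: "Phi5 * [:2, -2, 0, 0, 0, 1, -1:] = [:3:] + Phi15 * [:-1, -1, -1:]"
  by (simp add: Phi5_def Phi15_def)

text \<open>At order 15 the element x - 1 is a unit, so \<open>Phi5\<close> takes over: modulo
  \<open>Phi15\<close> its square is divisible by 3 and it divides 3. Norm zero forces 3 to divide
  \<open>nm5 H\<close>, and as 3 is inert at order 5, \<open>H\<close> lies in the ideal of 3 and
  \<open>Phi5\<close>.\<close>

lemma nm15_zero: "nm15 F = 0 \<Longrightarrow> Phi15 dvd F"
proof (rule n15.N_zero_imp_dvd_by_ramified[of 3 Phi5 2 "[:0, 1, 1, 1, 2, 1, 1, 1:]"])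
  show "nm15 Phi5 \<noteq> 0"
  proof -
    have "ev Phi5 z \<noteq> 0" if "z \<in> Z15" for z
      using that Z5_iff[of z] by (auto simp: Z15_iff Z5_def)
    then show ?thesis by (auto simp: n15.N_eq_0_iff)
  qed
  show "Phi15 dvd Phi5\<^sup>2 - smult 3 [:0, 1, 1, 1, 2, 1, 1, 1:]"
    by (simp add: Phi5_def Phi15_def power2_eq_square)
  fix H assume "nm15 H = 0"
  then have "3 dvd (nm5 H)\<^sup>2" using nm15_mod3[of H] by (simp add: cong_iff_dvd_diff)
  then have "3 dvd nm5 H" using prime_dvd_power[of "3::int"] by simp
  then obtain U V where UV: "H = smult 3 U + Phi5 * V" using nm5_dvd3[of H] by (auto simp: icong_def)
  have ring: "A = T * U + P * V \<Longrightarrow> P * W = T + R * S \<Longrightarrow> A - P * (W * U + V) = R * (- S * U)"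
    for A T U P V W R S :: "int poly"
    by (simp add: distrib_left mult.assoc[symmetric]) (simp add: algebra_simps)
  have "H = [:3:] * U + Phi5 * V" using UV by simp
  from ring[OF this three_mod_Phi15] show "\<exists>H'. Phi15 dvd H - Phi5 * H'" by (metis dvd_triv_left)
qed simp_all

lemma not_dvd_3_square: "\<not> 3 dvd (x::int) \<Longrightarrow> [x\<^sup>2 = 1] (mod 3)"
proof -
  assume "\<not> 3 dvd x"
  then have "x mod 3 = 1 \<or> x mod 3 = 2" by presburger
  then show ?thesis unfolding cong_def power_mod[symmetric, of x] by auto
qed

lemma not_dvd_5_fourth: "\<not> 5 dvd (x::int) \<Longrightarrow> [x ^ 4 = 1] (mod 5)"
proof -
  assume "\<not> 5 dvd x"
  then have "x mod 5 = 1 \<or> x mod 5 = 2 \<or> x mod 5 = 3 \<or> x mod 5 = 4" by presburger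
  then show ?thesis unfolding cong_def power_mod[symmetric, of x] by auto
qed

lemma cong_3_5: "[a = b] (mod 3) \<Longrightarrow> [a = b] (mod 5) \<Longrightarrow> [a = b] (mod (15::int))"
  unfolding cong_iff_dvd_diff by presburger

lemma coprime_prime_iff: "prime p \<Longrightarrow> coprime x p \<longleftrightarrow> \<not> p dvd (x::int)"
  by (metis coprime_absorb_right coprime_commute not_prime_unit prime_imp_coprime)

lemma coprime_15_iff: "coprime x (15::int) \<longleftrightarrow> \<not> 3 dvd x \<and> \<not> 5 dvd x"
proof -
  have "coprime x (3 * 5) \<longleftrightarrow> coprime x 3 \<and> coprime x 5" by (rule coprime_mult_right_iff)
  then show ?thesis using coprime_prime_iff[of 3 x] coprime_prime_iff[of 5 x] by simp
qed

interpretation e3: euclid Phi3 Z3 "{1, 2}" 3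
proof
  show "[nm3 F = 1] (mod 3)" if "coprime (nm3 F) 3" for F
  proof -
    have "\<not> 3 dvd nm3 F" using that by (simp add: coprime_prime_iff)
    then have "\<not> 3 dvd poly F 1" using cong_dvd_iff[OF nm3_mod3[of F]] by (auto simp: power2_eq_square)
    then show ?thesis using nm3_mod3[of F] not_dvd_3_square cong_trans by blast
  qed
qed (rule rounding3, rule nm3_zero)

interpretation e5: euclid Phi5 Z5 "{1, 2, 3, 4}" 5
proof
  show "[nm5 F = 1] (mod 5)" if "coprime (nm5 F) 5" for F
  proof -
    have "\<not> 5 dvd nm5 F" using that by (simp add: coprime_prime_iff)
    then have "\<not> 5 dvd poly F 1" using cong_dvd_iff[OF nm5_mod5[of F]] by (auto simp: eval_nat_numeral)
    then show ?thesis using nm5_mod5[of F] not_dvd_5_fourth cong_trans by blast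
  qed
qed (rule rounding5, rule nm5_zero)

interpretation e15: euclid Phi15 Z15 hs15 15
proof
  show "[nm15 F = 1] (mod 15)" if "coprime (nm15 F) 15" for F
  proof (rule cong_3_5)
    have *: "\<not> 3 dvd nm15 F" "\<not> 5 dvd nm15 F" using that by (simp_all add: coprime_15_iff)
    then have "\<not> 3 dvd nm5 F" using cong_dvd_iff[OF nm15_mod3[of F]] by (auto simp: power2_eq_square)
    then show "[nm15 F = 1] (mod 3)" using nm15_mod3[of F] not_dvd_3_square cong_trans by blast
    have "\<not> 5 dvd nm3 F" using * cong_dvd_iff[OF nm15_mod5[of F]] by (auto simp: eval_nat_numeral)
    then show "[nm15 F = 1] (mod 5)" using nm15_mod5[of F] not_dvd_5_fourth cong_trans by blast
  qed
qed (rule rounding15, rule nm15_zero)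

section \<open>Circulant determinants and gluing\<close>

text \<open>The Fourier matrix \<open>V\<close> diagonalizes every circulant. The matrix
  \<open>V'\<close> of inverse powers, with exponent 14 for -1 modulo 15, serves to show that
  \<open>V\<close> is invertible.\<close>

lemma det_circulant:
  "of_int (Determinant.det (circulant 15 a)) = (\<Prod>k<15. \<Sum>m<15. of_int (a m) * (root_unity 15 ^ k) ^ m)"
proof -
  define w where "w = root_unity 15"
  have w15: "w ^ 15 = 1" by (simp add: w_def root_unity_power)
  have w0: "w \<noteq> 0" using w15 by auto
  have wmod: "w ^ k = w ^ (k mod 15)" for k using power_mod_of_1[OF w15] .
  have wneq: "w ^ k \<noteq> 1" if "k mod 15 \<noteq> 0" for k
    using Z15_power_neq_1[OF root_unity_mem(3), of "k mod 15"] that wmod[of k] by (simp add: w_def)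
  define lam where "lam k = (\<Sum>m<15. of_int (a m) * (w ^ k) ^ m)" for k
  define C :: "complex mat" where "C = map_mat of_int (circulant 15 a)"
  define V :: "complex mat" where "V = mat 15 15 (\<lambda>(i, j). w ^ (i * j))"
  define V' :: "complex mat" where "V' = mat 15 15 (\<lambda>(i, j). w ^ (14 * i * j))"
  define D :: "complex mat" where "D = mat 15 15 (\<lambda>(i, j). if i = j then lam i else 0)"
  define I :: "complex mat" where "I = mat 15 15 (\<lambda>(i, j). if i = j then 15 else 0)"
  have carr: "C \<in> carrier_mat 15 15" "V \<in> carrier_mat 15 15" "V' \<in> carrier_mat 15 15"
    "D \<in> carrier_mat 15 15" "I \<in> carrier_mat 15 15"
    by (simp_all add: C_def V_def V'_def D_def I_def circulant_def)
  have detdiag: "Determinant.det (mat 15 15 (\<lambda>(i, j). if i = j then f i else 0)) = (\<Prod>i<15. f i)"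
    for f :: "nat \<Rightarrow> complex"
  proof -
    have "Determinant.det (mat 15 15 (\<lambda>(i, j). if i = j then f i else 0))
        = prod_list (diag_mat (mat 15 15 (\<lambda>(i, j). if i = j then f i else 0)))"
      by (rule det_upper_triangular[of _ 15]) (auto simp: upper_triangular_def)
    also have "\<dots> = (\<Prod>i<15. f i)" by (simp add: prod_list_diag_prod lessThan_atLeast0)
    finally show ?thesis .
  qed
  have "V * V' = I"
  proof (rule eq_matI)
    fix i k assume "i < dim_row I" "k < dim_col I"
    then have ik: "i < 15" "k < 15" by (simp_all add: I_def)
    have "(V * V') $$ (i, k) = (\<Sum>j<15. (w ^ (i + 14 * k)) ^ j)"
      using ik by (simp add: V_def V'_def scalar_prod_def lessThan_atLeast0 power_mult[symmetric] power_add[symmetric] algebra_simps)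
    also have "\<dots> = (if i = k then 15 else 0)"
    proof (cases "i = k")
      case True
      then have "w ^ (i + 14 * k) = 1" using wmod[of "i + 14 * k"] by simp
      then show ?thesis using True by simp
    next
      case False
      have "(i + 14 * k) mod 15 \<noteq> 0"
      proof
        assume "(i + 14 * k) mod 15 = 0"
        then obtain q where "i + 14 * k = 15 * q" by auto
        then show False using False ik by (cases q k rule: linorder_cases) linarith+
      qed
      then have "w ^ (i + 14 * k) \<noteq> 1" by (rule wneq)
      moreover have "(w ^ (i + 14 * k)) ^ 15 = 1" using power_power_1[OF w15] .
      ultimately show ?thesis using False geometric_sum[of "w ^ (i + 14 * k)" 15] by simp
    qed
    finally show "(V * V') $$ (i, k) = I $$ (i, k)" using ik by (simp add: I_def)
  qed (simp_all add: V_def V'_def I_def)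
  then have "Determinant.det V * Determinant.det V' = 15 ^ 15"
    using det_mult[OF carr(2,3)] detdiag[of "\<lambda>_. 15"] by (simp add: I_def)
  then have detV: "Determinant.det V \<noteq> 0" by auto
  have "C * V = V * D"
  proof (rule eq_matI)
    fix i k assume "i < dim_row (V * D)" "k < dim_col (V * D)"
    then have ik: "i < 15" "k < 15" by (simp_all add: V_def D_def)
    have b: "bij_betw (\<lambda>j. (j + 15 - i) mod 15) {..<15} {..<15}"
    proof (rule bij_betw_byWitness[where f' = "\<lambda>m. (m + i) mod 15"])
      show "\<forall>j\<in>{..<15}. ((j + 15 - i) mod 15 + i) mod 15 = j"
      proof
        fix j :: nat assume "j \<in> {..<15}"
        then have "(j + 15 - i + i) mod 15 = j" using ik by simp
        then show "((j + 15 - i) mod 15 + i) mod 15 = j" by (simp only: mod_add_left_eq)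
      qed
      show "\<forall>m\<in>{..<15}. ((m + i) mod 15 + 15 - i) mod 15 = m"
      proof
        fix m :: nat assume m: "m \<in> {..<15}"
        show "((m + i) mod 15 + 15 - i) mod 15 = m"
        proof (cases "m + i < 15")
          case False
          then have "(m + i) mod 15 = m + i - 15" using m ik by (simp add: mod_if)
          then show ?thesis using False m ik by simp
        qed (use m ik in simp)
      qed
    qed auto
    have "(C * V) $$ (i, k) = (\<Sum>j<15. of_int (a ((j + 15 - i) mod 15)) * w ^ (j * k))"
      using ik by (simp add: C_def V_def circulant_def scalar_prod_def lessThan_atLeast0)
    also have "\<dots> = (\<Sum>j<15. w ^ (i * k) * (of_int (a ((j + 15 - i) mod 15)) * (w ^ k) ^ ((j + 15 - i) mod 15)))"
    proof (intro sum.cong refl)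
      fix j :: nat assume "j \<in> {..<15}"
      then have j: "(i + (j + 15 - i) mod 15) mod 15 = j"
        using ik by (simp add: mod_simps)
      have "w ^ (i * k) * (w ^ k) ^ ((j + 15 - i) mod 15) = (w ^ k) ^ (i + (j + 15 - i) mod 15)"
        by (simp add: power_add power_mult[symmetric] mult.commute)
      also have "\<dots> = (w ^ k) ^ j"
        using power_mod_of_1[OF power_power_1[OF w15, of k], of "i + (j + 15 - i) mod 15"] j by simp
      also have "\<dots> = w ^ (j * k)" by (simp add: power_mult[symmetric] mult.commute)
      finally show "of_int (a ((j + 15 - i) mod 15)) * w ^ (j * k) =
          w ^ (i * k) * (of_int (a ((j + 15 - i) mod 15)) * (w ^ k) ^ ((j + 15 - i) mod 15))"
        by (simp add: mult.left_commute)
    qed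
    also have "\<dots> = w ^ (i * k) * (\<Sum>j<15. of_int (a ((j + 15 - i) mod 15)) * (w ^ k) ^ ((j + 15 - i) mod 15))"
      by (simp add: sum_distrib_left)
    also have "(\<Sum>j<15. of_int (a ((j + 15 - i) mod 15)) * (w ^ k) ^ ((j + 15 - i) mod 15)) = lam k"
      unfolding lam_def by (rule sum.reindex_bij_betw[OF b])
    also have "w ^ (i * k) * lam k = (V * D) $$ (i, k)"
    proof -
      have "(V * D) $$ (i, k) = (\<Sum>j<15. w ^ (i * j) * (if j = k then lam j else 0))"
        using ik by (simp add: V_def D_def scalar_prod_def lessThan_atLeast0)
      also have "\<dots> = (\<Sum>j<15. if j = k then w ^ (i * k) * lam k else 0)"
        by (intro sum.cong) auto
      finally show ?thesis using ik by simp
    qed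
    finally show "(C * V) $$ (i, k) = (V * D) $$ (i, k)" .
  qed (simp_all add: C_def V_def D_def circulant_def)
  then have "Determinant.det C * Determinant.det V = Determinant.det V * Determinant.det D"
    by (simp only: det_mult[OF carr(1,2), symmetric] det_mult[OF carr(2,4), symmetric])
  then have "Determinant.det C = Determinant.det D" using detV by (metis mult.commute mult_cancel_left)
  also have "Determinant.det D = (\<Prod>k<15. lam k)" using detdiag by (simp add: D_def)
  finally show ?thesis by (simp add: C_def lam_def w_def)
qed

section \<open>Determinants as products of four norms\<close>

definition measure15 :: "int poly \<Rightarrow> int" where
  "measure15 F = poly F 1 * nm3 F * nm5 F * nm15 F"

lemma ev_at_1: "ev F 1 = of_int (poly F 1)"
  by (induction F) simp_all

lemma measure15_eq: "of_int (measure15 F) = (\<Prod>k<15. ev F (root_unity 15 ^ k))"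
proof -
  define w where "w = root_unity 15"
  have set: "{..<15} = insert 0 ({5, 10} \<union> ({3, 6, 9, 12} \<union> hs15))"
    by (rule Set.set_eqI) (simp; presburger)
  have "(\<Prod>k<15. ev F (w ^ k)) = ev F 1 * (ev F (w ^ 5) * ev F (w ^ 10))
      * (ev F (w ^ 3) * ev F (w ^ 6) * ev F (w ^ 9) * ev F (w ^ 12)) * (\<Prod>h\<in>hs15. ev F (w ^ h))"
    unfolding set by (simp add: mult_ac)
  also have "ev F (w ^ 5) * ev F (w ^ 10) = of_int (nm3 F)"
    using n3.N_eq_hs[OF root_unity_mem(1), of F]
    by (simp add: w_def root_unity_3_5[symmetric] power_mult[symmetric])
  also have "ev F (w ^ 3) * ev F (w ^ 6) * ev F (w ^ 9) * ev F (w ^ 12) = of_int (nm5 F)"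
    using n5.N_eq_hs[OF root_unity_mem(2), of F]
    by (simp add: w_def root_unity_3_5[symmetric] power_mult[symmetric] mult_ac)
  also have "(\<Prod>h\<in>hs15. ev F (w ^ h)) = of_int (nm15 F)"
    using n15.N_eq_hs[OF root_unity_mem(3), of F] by (simp add: w_def)
  finally show ?thesis by (simp add: measure15_def w_def ev_at_1)
qed

lemma S15_eq: "S15 = range measure15"
proof
  show "S15 \<subseteq> range measure15"
  proof
    fix x assume "x \<in> S15"
    then obtain a where x: "x = Determinant.det (circulant 15 a)" by (auto simp: S15_def)
    define F where "F = (\<Sum>m<15. monom (a m) m)"
    have "of_int x = (of_int (measure15 F) :: complex)"
      unfolding x det_circulant measure15_eq by (simp add: F_def)
    then show "x \<in> range measure15" by simp
  qed
  show "range measure15 \<subseteq> S15"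
  proof
    fix x assume "x \<in> range measure15"
    then obtain F where x: "x = measure15 F" by blast
    \<comment> \<open>Only values at 15th roots of unity count, so \<open>F\<close> may be reduced
      modulo x^15 - 1 to the 15 coefficients of a circulant.\<close>
    define P :: "int poly" where "P = monom 1 15 + [:-1:]"
    have deg: "degree P = 15" unfolding P_def
      by (subst degree_add_eq_left) (simp_all add: degree_monom_eq)
    have "lead_coeff P = 1" unfolding deg by (simp add: P_def coeff_pCons numeral_eq_Suc)
    then obtain Q R where QR: "F = P * Q + R" "degree R < 15"
      using monic_division[of P F] deg by auto
    have "(\<Sum>m<15. monom (coeff R m) m) = R"
      using poly_as_sum_of_monoms'[of R 14] QR(2) by (simp add: lessThan_Suc_atMost[symmetric])
    moreover have "ev F (root_unity 15 ^ k) = ev R (root_unity 15 ^ k)" for k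
      using power_power_1[OF root_unity_power[of 15], of k] by (simp add: QR(1) P_def)
    ultimately have "ev F (root_unity 15 ^ k) = (\<Sum>m<15. of_int (coeff R m) * (root_unity 15 ^ k) ^ m)" for k
      by (metis (no_types, lifting) ev_monom ev_sum sum.cong)
    then have "of_int x = (of_int (Determinant.det (circulant 15 (coeff R))) :: complex)"
      unfolding x det_circulant measure15_eq by simp
    then show "x \<in> S15" by (auto simp: S15_def)
  qed
qed

lemma N15_eq: "N15 F = of_int (nm15 F)"
proof -
  have set: "{j. 1 \<le> j \<and> j \<le> 15 \<and> gcd j 15 = 1} = hs15"
  proof (rule Set.set_eqI)
    fix j :: nat
    have g: "gcd 2 15 = (1::nat)" "gcd 3 15 = (3::nat)" "gcd 4 15 = (1::nat)" "gcd 5 15 = (5::nat)"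
      "gcd 6 15 = (3::nat)" "gcd 7 15 = (1::nat)" "gcd 8 15 = (1::nat)" "gcd 9 15 = (3::nat)"
      "gcd 10 15 = (5::nat)" "gcd 11 15 = (1::nat)" "gcd 12 15 = (3::nat)" "gcd 13 15 = (1::nat)"
      "gcd 14 15 = (1::nat)"
      by (simp_all add: gcd_non_0_nat)
    have "(j = 0 \<or> j > 15) \<or> (j = 1 \<or> j = 2 \<or> j = 3 \<or> j = 4 \<or> j = 5 \<or> j = 6 \<or> j = 7 \<or> j = 8 \<or> j = 9
      \<or> j = 10 \<or> j = 11 \<or> j = 12 \<or> j = 13 \<or> j = 14 \<or> j = 15)" by presburger
    then show "j \<in> {j. 1 \<le> j \<and> j \<le> 15 \<and> gcd j 15 = 1} \<longleftrightarrow> j \<in> hs15"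
      using g by (elim disjE) simp_all
  qed
  show ?thesis unfolding N15_def set ev_def[symmetric] using n15.N_eq_hs[OF root_unity_mem(3), of F] by simp
qed

lemma measure15_mult: "measure15 (F * G) = measure15 F * measure15 G"
  by (simp add: measure15_def)

lemma S15_mult: "x \<in> S15 \<Longrightarrow> y \<in> S15 \<Longrightarrow> x * y \<in> S15"
  unfolding S15_eq by (auto simp: measure15_mult[symmetric])

lemma S15_uminus: "x \<in> S15 \<Longrightarrow> - x \<in> S15"
proof -
  have "measure15 [:-1:] = - 1" by (simp add: measure15_def n3.N_const n5.N_const n15.N_const)
  then have "- 1 \<in> S15" unfolding S15_eq by (metis rangeI)
  then show "x \<in> S15 \<Longrightarrow> - x \<in> S15" using S15_mult[of "- 1" x] by simp
qed

section \<open>Prescribing the values at roots of different order\<close>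

text \<open>The Chinese remainder theorem for polynomials that need not be coprime: the difference
  only has to lie in the ideal of \<open>P\<close> and \<open>Q\<close>.\<close>

lemma glue_pair:
  assumes "A - B = P * U + Q * (V :: int poly)"
  shows "\<exists>F. P dvd F - A \<and> Q dvd F - B"
proof (intro exI conjI)
  show "P dvd (A - P * U) - A" by simp
  have "(A - P * U) - B = Q * V" using assms by (simp add: algebra_simps)
  then show "Q dvd (A - P * U) - B" by simp
qed

lemma icong_3_Phi5_of_Phi15: "Phi15 dvd A - B \<Longrightarrow> icong 3 Phi5 A B"
proof -
  assume "Phi15 dvd A - B"
  then obtain K where K: "A - B = Phi15 * K" by (rule dvdE)
  have ring: "(smult 3 X + P * Y) * K = smult 3 (X * K) + P * (Y * K)" for X P Y :: "int poly"
    by (simp add: distrib_right mult.assoc)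
  show ?thesis
    by (rule icongI) (unfold K Phi15_mod_Phi5, rule ring)
qed

text \<open>The ideals \<open>(Phi15, Phi3)\<close> and \<open>(5, Phi3)\<close> agree, and so do \<open>(Phi3 Phi15, x\<^sup>5 - 1)\<close> and \<open>(3, x\<^sup>5 - 1)\<close>.\<close>

lemma glue:
  assumes DB: "icong 5 Phi3 D B" and DC: "icong 3 Phi5 D C"
    and Ba: "[poly B 1 = a] (mod 3)" and Ca: "[poly C 1 = a] (mod 5)"
  shows "\<exists>F. Phi15 dvd F - D \<and> Phi3 dvd F - B \<and> Phi5 dvd F - C \<and> poly F 1 = a"
proof -
  obtain U V where UV: "D - B = smult 5 U + Phi3 * V" using DB by (auto simp: icong_def)
  define s t :: "int poly" where "s = [:0, 0, -1:]" and "t = [:5, -5, 1, 3, -4, 2, 1, -2, 1:]"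
  have st: "Phi15 * s + Phi3 * t = [:5:]" by (simp add: Phi15_def Phi3_def s_def t_def)
  have "D - B = [:5:] * U + Phi3 * V" using UV by simp
  also have "\<dots> = Phi15 * (s * U) + Phi3 * (V + t * U)" unfolding st[symmetric]
    by (simp add: distrib_left distrib_right mult.assoc)
  finally obtain F1 where F1: "Phi15 dvd F1 - D" "Phi3 dvd F1 - B" using glue_pair by blast
  obtain F2 where F2: "Phi5 dvd F2 - C" "[:-1, 1:] dvd F2 - [:a:]"
  proof -
    have "5 dvd poly (C - [:a:]) 1" using Ca by (simp add: cong_iff_dvd_diff)
    from divide_by_x_minus_1[OF this Phi5_at_1] obtain C' where "Phi5 dvd C - [:a:] - [:-1, 1:] * C'" by blast
    then obtain K where "C - [:a:] - [:-1, 1:] * C' = Phi5 * K" by (rule dvdE)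
    then have "C - [:a:] = Phi5 * K + [:-1, 1:] * C'" by (simp add: algebra_simps)
    then show ?thesis using glue_pair that by blast
  qed
  define E where "E = F1 - F2"
  have "icong 3 Phi5 F1 F2"
    using icong_3_Phi5_of_Phi15[OF F1(1)] DC icong_sym[OF icong_dvd[OF F2(1)]] icong_trans by blast
  then obtain X Y where XY: "E = smult 3 X + Phi5 * Y" by (auto simp: icong_def E_def)
  \<comment> \<open>The congruence modulo 3 and \<open>Phi5\<close> is to be strengthened to one
    modulo 3 and x^5 - 1. The missing factor x - 1 splits off \<open>Y\<close> modulo 3, because
    \<open>F1\<close> and \<open>F2\<close> agree modulo 3 at 1.\<close>
  have "3 dvd poly Y 1"
  proof -
    obtain K where "F1 - B = Phi3 * K" using F1(2) by (rule dvdE)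
    from arg_cong[OF this, of "\<lambda>p. poly p 1"] have "3 dvd poly F1 1 - poly B 1" by (simp add: Phi3_def)
    moreover have "3 dvd poly B 1 - a" using Ba by (simp add: cong_iff_dvd_diff)
    moreover have "poly F2 1 = a"
    proof -
      obtain K where "F2 - [:a:] = [:-1, 1:] * K" using F2(2) by (rule dvdE)
      from arg_cong[OF this, of "\<lambda>p. poly p 1"] show ?thesis by simp
    qed
    moreover have "poly F1 1 - poly F2 1 = 3 * poly X 1 + 5 * poly Y 1"
      using arg_cong[OF XY, of "\<lambda>p. poly p 1"] by (simp add: E_def Phi5_def)
    ultimately show ?thesis by presburger
  qed
  then obtain y where y: "poly Y 1 = 3 * y" by (rule dvdE)
  have "[:-1, 1:] dvd Y - [:poly Y 1:]" by (simp add: poly_eq_0_iff_dvd[symmetric])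
  then obtain Y1 where "Y - [:poly Y 1:] = [:-1, 1:] * Y1" by (rule dvdE)
  then have Y: "Y = [:-1, 1:] * Y1 + smult 3 [:y:]" using y by (simp add: algebra_simps)
  have x5: "Phi5 * [:-1, 1:] = [:-1, 0, 0, 0, 0, 1:]" by (simp add: Phi5_def)
  have three: "[:3:] = Phi3 * Phi15 + [:-1, 0, 0, 0, 0, 1:] * [:-2, 0, 0, 0, 0, -1:]"
    by (simp add: Phi3_def Phi15_def)
  have "F1 - F2 = [:3:] * (X + Phi5 * [:y:]) + (Phi5 * [:-1, 1:]) * Y1"
  proof -
    have "F1 - F2 = E" by (simp add: E_def)
    also have "E = smult 3 X + (Phi5 * [:-1, 1:]) * Y1 + Phi5 * smult 3 [:y:]"
      unfolding XY Y by (simp only: distrib_left mult.assoc add.assoc)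
    also have "\<dots> = [:3:] * (X + Phi5 * [:y:]) + (Phi5 * [:-1, 1:]) * Y1"
      by (simp add: smult_add_right)
    finally show ?thesis .
  qed
  also have "\<dots> = (Phi3 * Phi15) * (X + Phi5 * [:y:])
       + [:-1, 0, 0, 0, 0, 1:] * ([:-2, 0, 0, 0, 0, -1:] * (X + Phi5 * [:y:]) + Y1)"
    unfolding three x5 by (simp only: distrib_left distrib_right mult.assoc add.assoc)
  finally obtain F where F: "Phi3 * Phi15 dvd F - F1" "[:-1, 0, 0, 0, 0, 1:] dvd F - F2"
    using glue_pair by blast
  have "Phi15 dvd F - F1" "Phi3 dvd F - F1" using F(1) by (auto intro: dvd_mult_left dvd_mult_right)
  moreover have "Phi5 dvd F - F2" "[:-1, 1:] dvd F - F2"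
    using F(2) unfolding x5[symmetric] by (rule dvd_mult_left, rule dvd_mult_right)
  moreover have tr: "P dvd A - C" if "P dvd A - B" "P dvd B - C" for P A B C :: "int poly"
    using dvd_add[OF that] by simp
  ultimately have "Phi15 dvd F - D" "Phi3 dvd F - B" "Phi5 dvd F - C" "[:-1, 1:] dvd F - [:a:]"
    using F1 F2 tr by blast+
  moreover from this(4) have "poly F 1 = a"
    using poly_eq_0_iff_dvd[of "F - [:a:]" 1] by simp
  ultimately show ?thesis by blast
qed

text \<open>This reduces a construction to choosing the four values \<open>a\<close>,
  \<open>B\<close>, \<open>C\<close>, \<open>D\<close>, which are tied by congruences modulo 3 and 5
  alone.\<close>

lemma S15_glue:
  assumes "icong 5 Phi3 D B" "icong 3 Phi5 D C" "[poly B 1 = a] (mod 3)" "[poly C 1 = a] (mod 5)"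
  shows "a * nm3 B * nm5 C * nm15 D \<in> S15"
proof -
  obtain F where F: "Phi15 dvd F - D" "Phi3 dvd F - B" "Phi5 dvd F - C" "poly F 1 = a"
    using glue[OF assms] by blast
  have "measure15 F = a * nm3 B * nm5 C * nm15 D"
    using n15.N_cong[OF F(1)] n3.N_cong[OF F(2)] n5.N_cong[OF F(3)] F(4) by (simp add: measure15_def)
  then show ?thesis unfolding S15_eq by (metis rangeI)
qed

section \<open>Units and constructions\<close>

text \<open>Like its successors, a cyclotomic unit certified by an explicit inverse. What
  distinguishes these units is their value at 1 and their residue at the cube roots of
  unity.\<close>

lemma unit_1_plus_x: "nm3 [:1, 1:] = 1" "nm5 [:1, 1:] = 1" "nm15 [:1, 1:] = 1"
proof -
  show "nm3 [:1, 1:] = 1"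
    by (rule n3.N_unit[of _ "[:0, -1:]"], rule dvdI[of _ _ "[:-1:]"]) (simp add: Phi3_def one_pCons)
  show "nm5 [:1, 1:] = 1"
    by (rule n5.N_unit[of _ "[:0, -1, 0, -1:]"], rule dvdI[of _ _ "[:-1:]"]) (simp add: Phi5_def one_pCons)
  show "nm15 [:1, 1:] = 1"
    by (rule n15.N_unit[of _ "[:0, 1, -1, 0, 1, -2, 2, -1:]"], rule dvdI[of _ _ "[:-1:]"]) (simp add: Phi15_def one_pCons)
qed

lemma unit_1_plus_x2: "nm3 [:1, 0, 1:] = 1" "nm5 [:1, 0, 1:] = 1" "nm15 [:1, 0, 1:] = 1"
proof -
  show "nm3 [:1, 0, 1:] = 1"
    by (rule n3.N_unit[of _ "[:1, 1:]"], rule dvdI[of _ _ "[:0, 1:]"]) (simp add: Phi3_def one_pCons)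
  show "nm5 [:1, 0, 1:] = 1"
    by (rule n5.N_unit[of _ "[:0, -1, -1:]"], rule dvdI[of _ _ "[:-1:]"]) (simp add: Phi5_def one_pCons)
  show "nm15 [:1, 0, 1:] = 1"
    by (rule n15.N_unit[of _ "[:0, 1, 0, -2, 1, 1, -1:]"], rule dvdI[of _ _ "[:-1:]"]) (simp add: Phi15_def one_pCons)
qed

text \<open>At cube roots of unity the value is 2. Multiplication by this element changes the sign
  of \<open>nm3\<close> modulo 5 and leaves \<open>nm5\<close> and \<open>nm15\<close>
  alone.\<close>

lemma unit_1_plus_x3: "nm3 [:1, 0, 0, 1:] = 4" "nm5 [:1, 0, 0, 1:] = 1" "nm15 [:1, 0, 0, 1:] = 1"
proof -
  have "Phi3 dvd [:1, 0, 0, 1:] - [:2:]" by (rule dvdI[of _ _ "[:-1, 1:]"]) (simp add: Phi3_def)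
  then show "nm3 [:1, 0, 0, 1:] = 4" using n3.N_cong[of "[:1, 0, 0, 1:]" "[:2:]"] n3.N_const[of 2] by simp
  show "nm5 [:1, 0, 0, 1:] = 1"
    by (rule n5.N_unit[of _ "[:1, 1, 1:]"], rule dvdI[of _ _ "[:0, 1:]"]) (simp add: Phi5_def one_pCons)
  show "nm15 [:1, 0, 0, 1:] = 1"
    by (rule n15.N_unit[of _ "[:1, 0, -1, 0, 0, 0, 1, -1:]"], rule dvdI[of _ _ "[:0, 0, -1:]"]) (simp add: Phi15_def one_pCons)
qed

lemma unit_1_plus_x4: "nm3 [:1, 0, 0, 0, 1:] = 1" "nm5 [:1, 0, 0, 0, 1:] = 1" "nm15 [:1, 0, 0, 0, 1:] = 1"
proof -
  show "nm3 [:1, 0, 0, 0, 1:] = 1"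
    by (rule n3.N_unit[of _ "[:0, -1:]"], rule dvdI[of _ _ "[:-1, 0, 1, -1:]"]) (simp add: Phi3_def one_pCons)
  show "nm5 [:1, 0, 0, 0, 1:] = 1"
    by (rule n5.N_unit[of _ "[:1, 1, 0, 1:]"], rule dvdI[of _ _ "[:0, 1, -1, 1:]"]) (simp add: Phi5_def one_pCons)
  show "nm15 [:1, 0, 0, 0, 1:] = 1"
    by (rule n15.N_unit[of _ "[:-2, 1, 2, -1, 1, -2, -2, 2:]"], rule dvdI[of _ _ "[:-3, -2, 0, 2:]"]) (simp add: Phi15_def one_pCons)
qed

text \<open>As 15 is not a prime power, x - 1 is a unit at order 15, while its norms 3 and 5 at the
  prime orders make it flip both quadratic characters.\<close>

lemma norm_x_minus_1: "nm3 [:-1, 1:] = 3" "nm5 [:-1, 1:] = 5" "nm15 [:-1, 1:] = 1"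
proof -
  show "nm3 [:-1, 1:] = 3" by (simp add: nm3_formula)
  show "nm5 [:-1, 1:] = 5" by (rule nm5_x_minus_1)
  show "nm15 [:-1, 1:] = 1"
    by (rule n15.N_unit[of _ "[:0, -1, -1, 0, -1, 0, 0, -1:]"], rule dvdI[of _ _ "[:-1:]"]) (simp add: Phi15_def one_pCons)
qed

lemma unit_x: "nm3 [:0, 1:] = 1" "nm5 [:0, 1:] = 1" "nm15 [:0, 1:] = 1"
proof -
  show "nm3 [:0, 1:] = 1" by (simp add: nm3_formula)
  show "nm5 [:0, 1:] = 1"
    by (rule n5.N_unit[of _ "[:-1, -1, -1, -1:]"], rule dvdI[of _ _ "[:-1:]"]) (simp add: Phi5_def one_pCons)
  show "nm15 [:0, 1:] = 1"
    by (rule n15.N_unit[of _ "[:1, 0, -1, 1, -1, 0, 1, -1:]"], rule dvdI[of _ _ "[:-1:]"]) (simp add: Phi15_def one_pCons)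
qed

lemma unit_monom [simp]: "nm3 (monom 1 j) = 1" "nm5 (monom 1 j) = 1" "nm15 (monom 1 j) = 1"
  by (simp_all add: monom_altdef unit_x)

lemma norm_sign:
  assumes "s \<in> {1, -1}"
  shows "nm3 (smult s F) = nm3 F" "nm5 (smult s F) = nm5 F" "nm15 (smult s F) = nm15 F"
  using assms by (auto simp: n3.N_smult n5.N_smult n15.N_smult)

lemma nm5_Phi3: "nm5 Phi3 = 1"
  by (rule n5.N_unit[of _ "[:1, 0, 0, 1:]"], rule dvdI[of _ _ "[:0, 1:]"]) (simp add: Phi3_def Phi5_def one_pCons)

lemma norm_x2_minus_1: "nm3 [:-1, 0, 1:] = 3"
proof -
  have "[:-1, 0, 1:] = [:-1, 1:] * [:1, 1 :: int:]" by simp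
  then show ?thesis using norm_x_minus_1 unit_1_plus_x by (metis n3.N_mult mult_1_right)
qed

lemma S15_multiples_225: "225 * z \<in> S15"
proof -
  \<comment> \<open>The values of x - 1 at the other roots glue with any multiple of 15 at 1, since
    x - 1 vanishes there.\<close>
  have "15 * z * nm3 [:-1, 1:] * nm5 [:-1, 1:] * nm15 [:-1, 1:] \<in> S15"
    by (intro S15_glue icong_refl) (simp_all add: cong_iff_dvd_diff)
  then show ?thesis unfolding norm_x_minus_1 by (simp add: mult.commute)
qed

lemma coprime_15_mod:
  assumes "coprime m (15::int)"
  shows "m mod 15 = 1 \<or> m mod 15 = 2 \<or> m mod 15 = 4 \<or> m mod 15 = 7 \<or> m mod 15 = 8 \<or> m mod 15 = 11
      \<or> m mod 15 = 13 \<or> m mod 15 = 14"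
proof -
  define r where "r = m mod 15"
  have "\<not> 3 dvd r" "\<not> 5 dvd r"
    using assms unfolding coprime_15_iff r_def by (simp_all add: dvd_mod_iff)
  moreover have "0 \<le> r" "r < 15" by (simp_all add: r_def)
  then have "r = 0 \<or> r = 1 \<or> r = 2 \<or> r = 3 \<or> r = 4 \<or> r = 5 \<or> r = 6 \<or> r = 7 \<or> r = 8 \<or> r = 9
     \<or> r = 10 \<or> r = 11 \<or> r = 12 \<or> r = 13 \<or> r = 14" by presburger
  ultimately show ?thesis unfolding r_def[symmetric] by (elim disjE) simp_all
qed

text \<open>The integer sits at 1 and units sit elsewhere. Products of 1 + x, 1 + x^2 and 1 + x^4
  give the residues 1, 2, 4, 8 at 1, and signs give the remaining invertible residues modulo
  15.\<close>

lemma S15_coprime: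
  assumes "coprime m (15::int)"
  shows "m \<in> S15"
proof -
  have *: "a \<in> S15" if "a mod 15 = 1 \<or> a mod 15 = 2 \<or> a mod 15 = 4 \<or> a mod 15 = 8" for a
  proof -
    have "\<exists>G. nm3 G = 1 \<and> nm5 G = 1 \<and> nm15 G = 1 \<and> 15 dvd poly G 1 - a"
      using that
    proof (elim disjE)
      assume "a mod 15 = 1"
      then have "15 dvd 1 - a" by presburger
      then show ?thesis by (intro exI[of _ 1]) simp
    next
      assume "a mod 15 = 2"
      then have "15 dvd 2 - a" by presburger
      then show ?thesis by (intro exI[of _ "[:1, 1:]"]) (simp add: unit_1_plus_x)
    next
      assume "a mod 15 = 4"
      then have "15 dvd 4 - a" by presburger
      then show ?thesis
        by (intro exI[of _ "[:1, 1:] * [:1, 0, 1:]"])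
           (simp only: n3.N_mult n5.N_mult n15.N_mult unit_1_plus_x unit_1_plus_x2 poly_mult, simp)
    next
      assume "a mod 15 = 8"
      then have "15 dvd 8 - a" by presburger
      then show ?thesis
        by (intro exI[of _ "[:1, 1:] * [:1, 0, 1:] * [:1, 0, 0, 0, 1:]"])
           (simp only: n3.N_mult n5.N_mult n15.N_mult unit_1_plus_x unit_1_plus_x2 unit_1_plus_x4 poly_mult, simp)
    qed
    then obtain G where G: "nm3 G = 1" "nm5 G = 1" "nm15 G = 1" "15 dvd poly G 1 - a" by blast
    have "[poly G 1 = a] (mod 3)" "[poly G 1 = a] (mod 5)"
      using G(4) by (auto simp: cong_iff_dvd_diff intro: dvd_trans)
    then show ?thesis using S15_glue[of G G G a] G by simp
  qed
  have "m mod 15 = 1 \<or> m mod 15 = 2 \<or> m mod 15 = 4 \<or> m mod 15 = 7 \<or> m mod 15 = 8 \<or> m mod 15 = 11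
      \<or> m mod 15 = 13 \<or> m mod 15 = 14" using coprime_15_mod[OF assms] .
  then have "(m mod 15 = 1 \<or> m mod 15 = 2 \<or> m mod 15 = 4 \<or> m mod 15 = 8) \<or>
      ((- m) mod 15 = 1 \<or> (- m) mod 15 = 2 \<or> (- m) mod 15 = 4 \<or> (- m) mod 15 = 8)"
    by (auto simp: zmod_zminus1_eq_if)
  then show ?thesis using *[of m] *[of "- m"] S15_uminus[of "- m"] by auto
qed

lemma int_mod_5_cases: "\<not> 5 dvd (a::int) \<Longrightarrow> [2 = a] (mod 5) \<or> [4 = a] (mod 5) \<or> [8 = a] (mod 5) \<or> [16 = a] (mod 5)"
proof -
  assume "\<not> 5 dvd a"
  then have "a mod 5 = 1 \<or> a mod 5 = 2 \<or> a mod 5 = 3 \<or> a mod 5 = 4" by presburger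
  then show ?thesis by (auto simp: cong_def)
qed

text \<open>The factor 9 is the norm of the value -3 at cube roots, which glues with the unit 1 +
  x^3 because 2 = -3 modulo 5. The value at 1 must then be a multiple of 3, whence the exponent 3; a
  power of 1 + x^2 adjusts it modulo 5.\<close>

lemma S15_power_3:
  assumes "3 \<le> t" "\<not> 5 dvd m"
  shows "3 ^ t * m \<in> S15"
proof -
  define a where "a = 3 ^ (t - 2) * m"
  have a3: "3 dvd a" using assms(1) by (simp add: a_def dvd_mult2 dvd_power)
  have "\<not> 5 dvd a" unfolding a_def using assms(2) prime_dvd_mult_iff[of "5::int"] prime_dvd_power[of "5::int" 3]
    by auto
  from int_mod_5_cases[OF this] obtain k where k: "[2 * 2 ^ k = a] (mod 5)"
    using that[of 0] that[of 1] that[of 2] that[of 3] by auto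
  define u where "u = [:1, 0, 1 :: int:] ^ k"
  define D where "D = [:1, 0, 0, 1:] * u"
  define B where "B = [:-3:] * u"
  have u: "nm3 u = 1" "nm5 u = 1" "nm15 u = 1" by (simp_all add: u_def unit_1_plus_x2)
  have "icong 5 Phi3 [:1, 0, 0, 1:] [:-3:]"
    by (rule icongI[of _ _ _ 1 _ "[:-1, 1:]"]) (simp add: Phi3_def one_pCons)
  then have "icong 5 Phi3 D B" unfolding D_def B_def by (intro icong_mult icong_refl)
  moreover have "[poly B 1 = a] (mod 3)" using a3 by (simp add: B_def cong_iff_dvd_diff)
  moreover have "[poly D 1 = a] (mod 5)" using k by (simp add: D_def u_def poly_power)
  ultimately have "a * nm3 B * nm5 D * nm15 D \<in> S15" by (intro S15_glue icong_refl)
  moreover have "nm3 B = 9" "nm5 D = 1" "nm15 D = 1"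
    unfolding B_def D_def n3.N_mult n5.N_mult n15.N_mult u unit_1_plus_x3 n3.N_const by simp_all
  moreover have "3 ^ t * m = a * 9"
  proof -
    have "t = (t - 2) + 2" using assms(1) by simp
    then have "(3::int) ^ t = 3 ^ (t - 2) * 3 ^ 2" by (metis power_add)
    then show ?thesis by (simp add: a_def)
  qed
  ultimately show ?thesis by simp
qed

text \<open>The factor 25 is the norm of (x - 1)^2 at fifth roots. At cube roots (x - 1)^2 (1 + x^3)
  is -6x, which modulo 5 is the unit -x; the sign \<open>s\<close> fits the value at 1 modulo
  3.\<close>

lemma S15_power_5:
  assumes "3 \<le> t" "\<not> 3 dvd m"
  shows "5 ^ t * m \<in> S15"
proof -
  define a where "a = 5 ^ (t - 2) * m"
  have a5: "5 dvd a" using assms(1) by (simp add: a_def dvd_mult2 dvd_power)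
  have "\<not> 3 dvd a" unfolding a_def using assms(2) prime_dvd_mult_iff[of "3::int"] prime_dvd_power[of "3::int" 5]
    by auto
  then have "a mod 3 = 1 \<or> a mod 3 = 2" by presburger
  then have "[- 1 = a] (mod 3) \<or> [1 = a] (mod 3)" by (auto simp: cong_def)
  then obtain s :: int where s: "s \<in> {1, -1}" and sa: "[- s = a] (mod 3)" by force
  define D where "D = smult s ([:-1, 1:] ^ 2 * [:1, 0, 0, 1:])"
  define B where "B = smult s [:0, -1:]"
  have "icong 5 Phi3 ([:-1, 1:] ^ 2 * [:1, 0, 0, 1:]) [:0, -1:]"
    by (rule icongI[of _ _ _ "[:0, -1:]" _ "[:1, 3, -3, 1:]"]) (simp add: Phi3_def power2_eq_square)
  then have "icong 5 Phi3 D B" unfolding D_def B_def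
    using icong_mult[OF icong_refl[of 5 Phi3 "[:s:]"], of "[:-1, 1:] ^ 2 * [:1, 0, 0, 1:]" "[:0, -1:]"]
    by (simp del: mult_pCons_right)
  moreover have "[poly B 1 = a] (mod 3)" using sa by (simp add: B_def)
  moreover have "[poly D 1 = a] (mod 5)" using a5 by (simp add: D_def cong_iff_dvd_diff poly_power)
  ultimately have "a * nm3 B * nm5 D * nm15 D \<in> S15" by (intro S15_glue icong_refl)
  moreover have "nm3 B = 1" using nm3_formula[of 0 "-1"] by (simp only: B_def norm_sign[OF s]) simp
  moreover have "nm5 D = 25" "nm15 D = 1"
    unfolding D_def norm_sign[OF s] n5.N_mult n15.N_mult n5.N_power n15.N_power norm_x_minus_1 unit_1_plus_x3 by simp_all
  moreover have "5 ^ t * m = a * 25"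
  proof -
    have "t = (t - 2) + 2" using assms(1) by simp
    then have "(5::int) ^ t = 5 ^ (t - 2) * 5 ^ 2" by (metis power_add)
    then show ?thesis by (simp add: a_def)
  qed
  ultimately show ?thesis by simp
qed

text \<open>The product of the quadratic characters of \<open>F(\<omega>\<^sub>1\<^sub>5)\<close> modulo the primes above 3 and 5 is \<open>-1\<close>.\<close>

definition char_neg :: "int poly \<Rightarrow> bool" where
  "char_neg F \<longleftrightarrow> [nm5 F = 1] (mod 3) \<and> [(nm3 F)\<^sup>2 = - 1] (mod 5) \<or> [nm5 F = - 1] (mod 3) \<and> [(nm3 F)\<^sup>2 = 1] (mod 5)"

section \<open>Elements of character -1 and the polynomials that define good primes\<close>

text \<open>Its value is x^2 - 1 at cube roots, \<open>s\<close> times x^j \<open>Phi3\<close> at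
  fifth roots and \<open>3 * s\<close> at 1; varying \<open>g\<close> changes none of these.\<close>

definition good_form :: "int \<Rightarrow> nat \<Rightarrow> int poly \<Rightarrow> int poly" where
  "good_form s j g = (monom 1 5 - 1) + smult s (monom 1 j * Phi3) + (monom 1 1 - 1) * Phi3 * Phi5 * g"

lemma x5_mod_Phi5: "icong m Phi5 (monom 1 (5 * k + j)) (monom 1 j)"
proof (rule icong_dvd)
  have "y ^ (5 * k + j) = y ^ j" if "y \<in> Z5" for y
    using that by (simp add: Z5_iff power_add power_mult)
  then show "Phi5 dvd monom 1 (5 * k + j) - monom 1 j" by (simp add: n5.Phi_dvd_iff)
qed

lemma icong_monom_mod5: "icong m Phi5 (monom 1 j) (monom 1 (j mod 5))"
  using x5_mod_Phi5[of m "j div 5" "j mod 5"] by simp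

text \<open>Units of order 15 do not change \<open>nm15\<close> but move the residues modulo the
  primes above 3 and 5. Given character -1, they move them to those of x^2 - 1 and of a unit times
  \<open>Phi3\<close>; gluing then produces the required polynomial.\<close>

lemma good_form_exists:
  assumes "char_neg F"
  shows "\<exists>s\<in>{1, -1}. \<exists>j<15. \<exists>g. nm15 (good_form s j g) = nm15 F"
proof -
  \<comment> \<open>The unit x - 1 flips both characters and so brings the second case of
    \<open>char_neg\<close> to the first.\<close>
  obtain D0 where D0: "nm15 D0 = nm15 F" "[nm5 D0 = 1] (mod 3)" "[(nm3 D0)\<^sup>2 = - 1] (mod 5)"
  proof (cases "[nm5 F = 1] (mod 3) \<and> [(nm3 F)\<^sup>2 = - 1] (mod 5)")
    case False
    then have *: "[nm5 F = - 1] (mod 3)" "[(nm3 F)\<^sup>2 = 1] (mod 5)" using assms by (auto simp: char_neg_def)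
    have "[nm5 F * 5 = (- 1) * 5] (mod 3)" using *(1) by (rule cong_scalar_right)
    moreover have "[(nm3 F)\<^sup>2 * 9 = 1 * 9] (mod 5)" using *(2) by (rule cong_scalar_right)
    ultimately show ?thesis
      by (intro that[of "F * [:-1, 1:]"])
         (simp_all only: n3.N_mult n5.N_mult n15.N_mult norm_x_minus_1 power_mult_distrib, simp_all add: cong_def)
  qed (use that in blast)
  have "nm3 D0 mod 5 = 2 \<or> nm3 D0 mod 5 = 3"
  proof -
    have "((nm3 D0 mod 5) * (nm3 D0 mod 5)) mod 5 = 4"
      using D0(3) by (simp add: cong_def power2_eq_square mod_mult_eq)
    moreover have "nm3 D0 mod 5 \<in> set [0, 1, 2, 3, 4]" by (rule mod_5_cases)
    ultimately show ?thesis by auto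
  qed
  then obtain D1 where D1: "nm15 D1 = nm15 F" "[nm5 D1 = 1] (mod 3)" "[nm3 D1 = 3] (mod 5)"
  proof
    assume "nm3 D0 mod 5 = 2"
    then have "[nm3 D0 * 4 = 2 * 4] (mod 5)" by (intro cong_scalar_right) (simp add: cong_def)
    then show ?thesis using D0
      by (intro that[of "D0 * [:1, 0, 0, 1:]"])
         (simp_all only: n3.N_mult n5.N_mult n15.N_mult unit_1_plus_x3, simp_all add: cong_def)
  qed (use D0 that[of D0] in \<open>simp add: cong_def\<close>)
  obtain s1 j1 where s1: "s1 \<in> {1, -1}" and j1: "icong 5 Phi3 D1 (smult s1 (monom 1 j1 * [:-1, 0, 1:]))"
  proof -
    have "\<not> 5 dvd (3::int)" by simp
    then show ?thesis using nm3_orbit[of D1 "[:-1, 0, 1:]"] D1(3) that unfolding norm_x2_minus_1 by blast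
  qed
  \<comment> \<open>The exponent \<open>2 * j1\<close> completes x^j1 to a power of x^3, which is 1
    at cube roots.\<close>
  define D2 where "D2 = smult s1 (monom 1 (2 * j1) * D1)"
  have D2n: "nm15 D2 = nm15 F" "[nm5 D2 = 1] (mod 3)"
    using D1 by (simp_all add: D2_def norm_sign[OF s1])
  have D2: "icong 5 Phi3 D2 [:-1, 0, 1:]"
  proof -
    have "icong 5 Phi3 ([:s1:] * monom 1 (2 * j1) * D1) ([:s1:] * monom 1 (2 * j1) * smult s1 (monom 1 j1 * [:-1, 0, 1:]))"
      by (intro icong_mult icong_refl j1)
    moreover have "[:s1:] * monom 1 (2 * j1) * smult s1 (monom 1 j1 * [:-1, 0, 1:]) = monom 1 (3 * j1) * [:-1, 0, 1:]"
    proof -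
      have ring: "[:s1:] * M * smult s1 (L * A) = smult (s1 * s1) ((M * L) * A)" for M L A :: "int poly"
        by (simp add: mult.assoc)
      have "s1 * s1 = 1" using s1 by auto
      then show ?thesis unfolding ring mult_monom by simp
    qed
    moreover have "icong 5 Phi3 (monom 1 (3 * j1) * [:-1, 0, 1:]) (1 * [:-1, 0, 1:])"
    proof (intro icong_mult icong_refl icong_dvd)
      have "y ^ (3 * j1) = 1" if "y \<in> Z3" for y using that by (simp add: Z3_iff power_mult)
      then show "Phi3 dvd monom 1 (3 * j1) - 1" by (simp add: n3.Phi_dvd_iff)
    qed
    ultimately show ?thesis using icong_trans by (fastforce simp: D2_def)
  qed
  obtain k where k: "icong 3 Phi5 D2 ([:1, 0, 1:] ^ k)" using nm5_orbit[OF D2n(2)] by blast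
  \<comment> \<open>A unit equal to 1 at the cube roots: its powers adjust the residue above 3 while
    preserving the one above 5.\<close>
  define v where "v = smult (-1) (monom 1 2 * [:1, 0, 1 :: int:])"
  \<comment> \<open>Chosen to make k + m + 1 = 4 (k + 1). Modulo 3 and \<open>Phi5\<close> the
    fourth power of 1 + x^2 is -x^4, and \<open>Phi3\<close> is x^2 divided by 1 + x^2.\<close>
  define m where "m = 3 * k + 3"
  define D3 where "D3 = D2 * v ^ m"
  have v: "nm15 v = 1"
  proof -
    have "nm15 (monom 1 2 * [:1, 0, 1:]) = 1" unfolding n15.N_mult unit_1_plus_x2 by simp
    moreover have "(- 1 :: int) \<in> {1, - 1}" by simp
    ultimately show ?thesis unfolding v_def using norm_sign(3) by metis
  qed
  have D3n: "nm15 D3 = nm15 F" by (simp add: D3_def D2n v)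
  have "icong 5 Phi3 v 1"
    unfolding v_def by (rule icong_dvd, rule dvdI[of _ _ "[:-1, 1, -1:]"]) (simp add: Phi3_def one_pCons monom_altdef power2_eq_square)
  then have "icong 5 Phi3 D3 ([:-1, 0, 1:] * 1 ^ m)" unfolding D3_def by (intro icong_mult D2 icong_power)
  then have D3_5: "icong 5 Phi3 D3 [:-1, 0, 1:]" by simp
  define s :: int where "s = (-1) ^ (m + (k + 1))"
  \<comment> \<open>The summand 3 removes the x^2 coming from (1 + x^2) \<open>Phi3\<close>, as x^5
    is 1 modulo \<open>Phi5\<close>.\<close>
  define J where "J = 2 * m + 4 * (k + 1) + 3"
  have s: "s \<in> {1, -1}" unfolding s_def by (simp add: minus_one_power_iff)
  have D3_3: "icong 3 Phi5 D3 (smult s (monom 1 J * Phi3))"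
  proof -
    have w4: "icong 3 Phi5 ([:1, 0, 1:] ^ 4) (smult (-1) (monom 1 4))"
      by (rule icongI[of _ _ _ "[:-2, -1, -1, -2:]" _ "[:7, -4, 4, -1, 1:]"])
         (simp add: Phi5_def eval_nat_numeral monom_altdef)
    have wP: "icong 3 Phi5 ([:1, 0, 1:] * Phi3) (monom 1 2)"
      by (rule icong_dvd, rule dvdI[of _ _ 1]) (simp add: Phi5_def Phi3_def monom_altdef power2_eq_square)
    have pow: "smult (-1) (monom 1 a) ^ n = smult ((-1) ^ n) (monom 1 (a * n))" for a n :: nat
      by (induction n) (simp_all add: mult_monom algebra_simps monom_0 one_pCons)
    have i1: "icong 3 Phi5 (D3 * monom 1 2) (D3 * ([:1, 0, 1:] * Phi3))"
      by (intro icong_mult icong_refl icong_sym[OF wP])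
    have i2: "icong 3 Phi5 (D3 * ([:1, 0, 1:] * Phi3)) ([:1, 0, 1:] ^ k * v ^ m * ([:1, 0, 1:] * Phi3))"
      unfolding D3_def by (intro icong_mult icong_refl k)
    have e1: "[:1, 0, 1:] ^ k * v ^ m * ([:1, 0, 1:] * Phi3)
        = smult ((-1) ^ m) (monom 1 (2 * m)) * ([:1, 0, 1:] ^ 4) ^ (k + 1) * Phi3"
    proof -
      have vm: "v ^ m = smult ((-1) ^ m) (monom 1 (2 * m)) * [:1, 0, 1:] ^ m"
      proof -
        have "v = smult (-1) (monom 1 2) * [:1, 0, 1:]" by (simp add: v_def del: mult_pCons_right)
        then show ?thesis by (simp only: power_mult_distrib pow)
      qed
      have ring: "W ^ k * (S * W ^ m) * (W * P) = S * W ^ (k + m + 1) * P" for W S P :: "int poly"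
        by (simp add: power_add mult_ac)
      have "([:1, 0, 1 :: int:] ^ 4) ^ (k + 1) = [:1, 0, 1:] ^ (k + m + 1)"
        unfolding power_mult[symmetric] by (simp add: m_def)
      then show ?thesis unfolding vm ring by (simp only:)
    qed
    have i3: "icong 3 Phi5 (smult ((-1) ^ m) (monom 1 (2 * m)) * ([:1, 0, 1:] ^ 4) ^ (k + 1) * Phi3)
        (smult ((-1) ^ m) (monom 1 (2 * m)) * (smult (-1) (monom 1 4)) ^ (k + 1) * Phi3)"
      by (intro icong_mult icong_refl icong_power w4)
    have e2: "smult ((-1) ^ m) (monom 1 (2 * m)) * (smult (-1) (monom 1 4)) ^ (k + 1) * Phi3
        = smult s (monom 1 (2 * m + 4 * (k + 1)) * Phi3)"
      unfolding pow s_def power_add by (simp add: mult_monom mult.assoc) (simp add: ac_simps)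
    have "icong 3 Phi5 (D3 * monom 1 2) (smult s (monom 1 (2 * m + 4 * (k + 1)) * Phi3))"
      by (rule icong_trans[OF i1 icong_trans[OF i2[unfolded e1] i3[unfolded e2]]])
    then have i4: "icong 3 Phi5 (D3 * monom 1 2 * monom 1 3) (smult s (monom 1 (2 * m + 4 * (k + 1)) * Phi3) * monom 1 3)"
      by (intro icong_mult icong_refl)
    have e3: "smult s (monom 1 (2 * m + 4 * (k + 1)) * Phi3) * monom 1 3 = smult s (monom 1 J * Phi3)"
    proof -
      have "monom 1 J = monom 1 (2 * m + 4 * (k + 1)) * monom (1::int) 3" by (simp add: J_def mult_monom)
      then show ?thesis by (simp add: mult_ac)
    qed
    have i5: "icong 3 Phi5 (D3 * (monom 1 2 * monom 1 3)) (D3 * 1)"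
      using x5_mod_Phi5[of 3 1 0] by (intro icong_mult icong_refl) (simp add: mult_monom monom_0 one_pCons)
    show ?thesis
      using icong_trans[OF icong_sym[OF i5] i4[unfolded e3 mult.assoc]] by (simp only: mult_1_right)
  qed
  define j where "j = J mod 5"
  define G where "G = (monom 1 5 - 1) + smult s (monom 1 j * Phi3)"
  have "icong 5 Phi3 D3 G"
  proof -
    have "Phi3 dvd [:-1, 0, 1:] - G"
    proof -
      have "y ^ 5 = y * y" if "y \<in> Z3" for y
        using that power_mod_of_1[of y 3 5] by (simp add: Z3_iff power2_eq_square)
      then show ?thesis by (auto simp: n3.Phi_dvd_iff G_def n3.root)
    qed
    then show ?thesis using D3_5 icong_dvd icong_trans by blast
  qed
  moreover have "icong 3 Phi5 D3 G"
  proof -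
    have "icong 3 Phi5 (smult s (monom 1 J * Phi3)) (smult s (monom 1 j * Phi3))"
      using icong_mult[OF icong_refl[of 3 Phi5 "[:s:]"] icong_mult[OF icong_monom_mod5[of 3 J] icong_refl[of 3 Phi5 Phi3]]]
      by (simp add: j_def)
    moreover have "icong 3 Phi5 (smult s (monom 1 j * Phi3)) G"
    proof (rule icong_dvd)
      have "y ^ 5 = 1" if "y \<in> Z5" for y using that by (simp add: Z5_iff)
      then show "Phi5 dvd smult s (monom 1 j * Phi3) - G" by (simp add: n5.Phi_dvd_iff G_def)
    qed
    ultimately show ?thesis using D3_3 icong_trans by blast
  qed
  ultimately obtain H where H: "Phi15 dvd H - D3" "Phi3 dvd H - G" "Phi5 dvd H - G" "poly H 1 = poly G 1"
    using glue[of D3 G G "poly G 1"] by auto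
  have "\<exists>g. H - G = (monom 1 1 - 1) * Phi3 * Phi5 * g"
  proof -
    have "[:-1, 1:] dvd H - G" using H(4) poly_eq_0_iff_dvd[of "H - G" 1] by simp
    then obtain K where K: "H - G = [:-1, 1:] * K" by (rule dvdE)
    have "Phi3 dvd K"
      unfolding n3.Phi_dvd_iff
    proof
      fix z assume z: "z \<in> Z3"
      then have "ev ([:-1, 1:] * K) z = 0" using H(2) K by (simp only: n3.Phi_dvd_iff)
      then show "ev K z = 0" using z by (simp only: ev_mult mult_eq_0_iff) (auto simp: Z3_iff)
    qed
    then obtain L where L: "K = Phi3 * L" by (rule dvdE)
    have "Phi5 dvd L"
      unfolding n5.Phi_dvd_iff
    proof
      fix z assume z: "z \<in> Z5"
      then have e: "ev ([:-1, 1:] * (Phi3 * L)) z = 0" using H(3) K L by (simp only: n5.Phi_dvd_iff)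
      have "z ^ 3 \<noteq> 1" "z \<noteq> 1" using z prime_power_neq_1[of z 5 3] by (auto simp: Z5_iff)
      then have "ev Phi3 z \<noteq> 0" using Z3_iff[of z] by (auto simp: Z3_def)
      then show "ev L z = 0" using e \<open>z \<noteq> 1\<close> by (simp only: ev_mult mult_eq_0_iff) auto
    qed
    then obtain g where g: "L = Phi5 * g" by (rule dvdE)
    have "[:-1, 1:] = monom 1 1 - (1 :: int poly)" by (simp add: monom_altdef one_pCons)
    then show ?thesis using K L g by (metis mult.assoc)
  qed
  then obtain g where g: "H - G = (monom 1 1 - 1) * Phi3 * Phi5 * g" by blast
  then have "H = good_form s j g" by (simp add: good_form_def G_def algebra_simps)
  moreover have "nm15 H = nm15 F" using n15.N_cong[OF H(1)] D3n by simp
  moreover have "j < 15" by (simp add: j_def)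
  ultimately show ?thesis using s by metis
qed

lemma good_form_values:
  assumes "s \<in> {1, -1}"
  shows "poly (good_form s j g) 1 = 3 * s" "Phi3 dvd good_form s j g - [:-1, 0, 1:]"
    "nm3 (good_form s j g) = 3" "nm5 (good_form s j g) = 1"
proof -
  show "poly (good_form s j g) 1 = 3 * s"
    by (simp add: good_form_def poly_monom Phi3_def)
  have "y ^ 5 = y * y" if "y \<in> Z3" for y
    using that power_mod_of_1[of y 3 5] by (simp add: Z3_iff power2_eq_square)
  then show *: "Phi3 dvd good_form s j g - [:-1, 0, 1:]"
    by (auto simp: n3.Phi_dvd_iff good_form_def n3.root)
  show "nm3 (good_form s j g) = 3" using n3.N_cong[OF *] norm_x2_minus_1 by simp
  have "y ^ 5 = 1" if "y \<in> Z5" for y using that by (simp add: Z5_iff)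
  then have "Phi5 dvd good_form s j g - smult s (monom 1 j * Phi3)"
    by (auto simp: n5.Phi_dvd_iff good_form_def n5.root)
  then have "nm5 (good_form s j g) = nm5 (smult s (monom 1 j * Phi3))" by (rule n5.N_cong)
  then show "nm5 (good_form s j g) = 1" by (simp add: norm_sign[OF assms] nm5_Phi3)
qed

lemma char_neg_good_form: "s \<in> {1, -1} \<Longrightarrow> char_neg (good_form s j g)"
  by (simp add: char_neg_def good_form_values cong_def)

text \<open>The good form has determinant 9 times the norm, up to sign. For 25 it is multiplied by
  (x - 1)(1 + x^3): this adds the norm 5 at fifth roots and makes the residue at cube roots 1 modulo
  5, which glues with the value 1 there and -5 at 1.\<close>

lemma S15_char_neg:
  assumes "char_neg F"
  shows "9 * nm15 F \<in> S15" "25 * nm15 F \<in> S15"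
proof -
  obtain s j g where s: "s \<in> {1, -1}" and G: "nm15 (good_form s j g) = nm15 F"
    using good_form_exists[OF assms] by blast
  define G where "G = good_form s j g"
  note v = good_form_values[OF s, of j g, folded G_def]
  have "measure15 G = s * (9 * nm15 F)"
    using v G by (simp add: measure15_def G_def[symmetric])
  then have "s * (9 * nm15 F) \<in> S15" unfolding S15_eq by (metis rangeI)
  then show "9 * nm15 F \<in> S15" using s S15_uminus by fastforce
  define D where "D = G * ([:-1, 1:] * [:1, 0, 0, 1:])"
  have "icong 5 Phi3 D ([:-1, 0, 1:] * ([:-1, 1:] * [:1, 0, 0, 1:]))"
    unfolding D_def by (intro icong_mult icong_refl icong_dvd v)
  moreover have "icong 5 Phi3 ([:-1, 0, 1:] * ([:-1, 1:] * [:1, 0, 0, 1:])) 1"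
    by (rule icongI[of _ _ _ 1 _ "[:-5, 4, 0, -2, 1:]"]) (simp add: Phi3_def one_pCons)
  ultimately have "icong 5 Phi3 D 1" by (rule icong_trans)
  moreover have "[poly D 1 = - 5] (mod 5)" by (simp add: D_def cong_def)
  ultimately have "- 5 * nm3 1 * nm5 D * nm15 D \<in> S15"
    by (intro S15_glue icong_refl) (simp_all add: cong_def)
  moreover have "nm5 D = 5" "nm15 D = nm15 F"
    unfolding D_def n5.N_mult n15.N_mult v norm_x_minus_1 unit_1_plus_x3 using G by (simp_all add: G_def)
  ultimately have "- (25 * nm15 F) \<in> S15" by simp
  then show "25 * nm15 F \<in> S15" using S15_uminus by fastforce
qed

section \<open>Determinants from norms of order 3 and 5\<close>

text \<open>The factor \<open>p\<close> sits at the cube roots. For 9, the norm \<open>3 * p\<close>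
  is 1 or 4 modulo 5, like that of the unit 1 + x^2 or 1 + x^3. For 25, \<open>p\<close> itself has
  the residue of the norm of x - 1 or of (x - 1)(1 + x^3). The congruence then comes from
  \<open>nm3_orbit\<close>.\<close>

lemma S15_norm3:
  assumes "nm3 b = p" "[p = 2] (mod 5) \<or> [p = 3] (mod 5)" "\<not> 3 dvd p"
  shows "9 * p \<in> S15" "25 * p \<in> S15"
proof -
  have nd: "\<not> 5 dvd p"
    using assms(2) cong_dvd_iff[of p 2 5] cong_dvd_iff[of p 3 5] by auto
  have b1: "\<not> 3 dvd poly b 1"
    using nm3_mod3[of b] assms(1,3) cong_dvd_iff by (metis dvd_mult2 power2_eq_square)
  obtain D where D: "nm5 D = 1" "nm15 D = 1" "poly D 1 = 2" "[nm3 D = 3 * p] (mod 5)"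
  proof (cases "[p = 2] (mod 5)")
    case True
    then have "[3 * p = 3 * 2] (mod 5)" by (rule cong_scalar_left)
    then show ?thesis by (intro that[of "[:1, 0, 1:]"]) (simp_all add: unit_1_plus_x2 cong_def)
  next
    case False
    then have "[3 * p = 3 * 3] (mod 5)" using assms(2) by (intro cong_scalar_left) auto
    then show ?thesis by (intro that[of "[:1, 0, 0, 1:]"]) (simp_all add: unit_1_plus_x3 cong_def)
  qed
  have nd3: "\<not> 5 dvd 3 * p" using nd prime_dvd_mult_iff[of "5::int" 3 p] by auto
  have n: "nm3 ([:-1, 0, 1:] * b) = 3 * p" unfolding n3.N_mult norm_x2_minus_1 assms(1) ..
  obtain s j where s: "s \<in> {1, -1}" and B: "icong 5 Phi3 D (smult s (monom 1 j * ([:-1, 0, 1:] * b)))"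
    using nm3_orbit[of D "[:-1, 0, 1:] * b"] D(4) nd3 unfolding n by blast
  have "(- 3) * nm3 (smult s (monom 1 j * ([:-1, 0, 1:] * b))) * nm5 D * nm15 D \<in> S15"
    by (rule S15_glue[OF B]) (simp_all add: D cong_def)
  then have "- (9 * p) \<in> S15"
    unfolding norm_sign[OF s] n3.N_mult[of "monom 1 j"] n D by simp
  then show "9 * p \<in> S15" using S15_uminus by fastforce
  obtain E where E: "nm5 E = 5" "nm15 E = 1" "poly E 1 = 0" "[nm3 E = p] (mod 5)"
  proof (cases "[p = 2] (mod 5)")
    case True
    define E where "E = [:-1, 1:] * [:1, 0, 0, 1 :: int:]"
    have "nm3 E = 12" "nm5 E = 5" "nm15 E = 1" "poly E 1 = 0"
      unfolding E_def n3.N_mult n5.N_mult n15.N_mult norm_x_minus_1 unit_1_plus_x3 by simp_all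
    then show ?thesis using True by (intro that[of E]) (simp_all add: cong_def)
  next
    case False
    then show ?thesis using assms(2) by (intro that[of "[:-1, 1:]"]) (simp_all add: norm_x_minus_1 cong_def)
  qed
  obtain s j where s: "s \<in> {1, -1}" and B: "icong 5 Phi3 E (smult s (monom 1 j * b))"
    using nm3_orbit[of E b] E(4) nd assms(1) by blast
  define a :: int where "a = (if [s * poly b 1 = 5] (mod 3) then 5 else - 5)"
  have "[poly (smult s (monom 1 j * b)) 1 = a] (mod 3)"
  proof -
    have "\<not> 3 dvd s * poly b 1" using b1 s by auto
    then have "(s * poly b 1) mod 3 = 1 \<or> (s * poly b 1) mod 3 = 2" by presburger
    then show ?thesis by (auto simp: a_def poly_monom cong_def)
  qed
  then have "a * nm3 (smult s (monom 1 j * b)) * nm5 E * nm15 E \<in> S15"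
    by (rule S15_glue[OF B icong_refl]) (simp add: E a_def cong_def)
  then have "a * p * 5 \<in> S15" by (simp add: norm_sign[OF s] E assms(1))
  then show "25 * p \<in> S15" using S15_uminus[of "- (25 * p)"] by (auto simp: a_def split: if_splits)
qed

text \<open>The factor \<open>p\<close> sits at the fifth roots. For 25, (x - 1) c has norm
  \<open>5 * p\<close>, which is 1 modulo 3, so it is congruent to a power of 1 + x^2. For 9, a
  factor x - 1 is placed at orders 3 and 15 instead.\<close>

lemma S15_norm5:
  assumes "nm5 c = p" "[p = 2] (mod 3)" "\<not> 5 dvd p"
  shows "9 * p \<in> S15" "25 * p \<in> S15"
proof -
  have c1: "\<not> 5 dvd poly c 1"
    using nm5_mod5[of c] assms(1,3) cong_dvd_iff by (metis dvd_mult2 power4_eq_xxxx mult.assoc)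
  let ?w = "[:1, 0, 1 :: int:]"
  have unit: "nm3 (?w ^ k) = 1" "nm15 (?w ^ k) = 1" for k by (simp_all add: unit_1_plus_x2)
  have p: "[5 * p = 1] (mod 3)" using cong_scalar_left[OF assms(2), of 5] by (simp add: cong_def)
  have n: "nm5 ([:-1, 1:] * d) = 5 * nm5 d" for d unfolding n5.N_mult norm_x_minus_1 ..
  obtain k where k: "icong 3 Phi5 ([:-1, 1:] * c) (?w ^ k)"
    using nm5_orbit[of "[:-1, 1:] * c"] p unfolding n assms(1) by blast
  define a :: int where "a = (if [2 ^ k = (5::int)] (mod 3) then 5 else - 5)"
  have "[poly (?w ^ k) 1 = a] (mod 3)"
  proof -
    have "\<not> 3 dvd (2::int) ^ k" using prime_dvd_power[of "3::int" 2 k] by auto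
    then have "(2::int) ^ k mod 3 = 1 \<or> (2::int) ^ k mod 3 = 2" by presburger
    then show ?thesis by (auto simp: a_def poly_power cong_def)
  qed
  moreover have "[poly ([:-1, 1:] * c) 1 = a] (mod 5)" by (simp add: a_def cong_def)
  ultimately have "a * nm3 (?w ^ k) * nm5 ([:-1, 1:] * c) * nm15 (?w ^ k) \<in> S15"
    by (intro S15_glue icong_refl icong_sym[OF k])
  then have "a * (5 * p) \<in> S15" unfolding n unit assms(1) by simp
  then show "25 * p \<in> S15" using S15_uminus[of "- (25 * p)"] by (auto simp: a_def split: if_splits)
  \<comment> \<open>The value at 1 has to be 3 or -3 modulo 5; multiplying by 1 + x^2 doubles it
    where necessary.\<close>
  obtain c' where c': "nm5 c' = p" "[poly c' 1 = 2] (mod 5) \<or> [poly c' 1 = 3] (mod 5)"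
  proof (cases "[poly c 1 = 2] (mod 5) \<or> [poly c 1 = 3] (mod 5)")
    case False
    have "poly c 1 mod 5 = 1 \<or> poly c 1 mod 5 = 2 \<or> poly c 1 mod 5 = 3 \<or> poly c 1 mod 5 = 4"
      using c1 by presburger
    then have "[poly c 1 = 1] (mod 5) \<or> [poly c 1 = 4] (mod 5)" using False by (auto simp: cong_def)
    then have "[2 * poly c 1 = 2] (mod 5) \<or> [2 * poly c 1 = 3] (mod 5)"
      using cong_scalar_left[of "poly c 1" 1 5 2] cong_scalar_left[of "poly c 1" 4 5 2] by (auto simp: cong_def)
    then show ?thesis by (intro that[of "?w * c"]) (simp_all only: n5.N_mult unit_1_plus_x2 assms(1) poly_mult, simp_all)
  qed (use assms that in blast)
  obtain k1 where k1: "icong 3 Phi5 ([:-1, 1:] * c') (?w ^ k1)"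
    using nm5_orbit[of "[:-1, 1:] * c'"] p unfolding n c' by blast
  have "[nm5 ([:-1, 1:] * [:-1, 1:]) = 1] (mod 3)" unfolding n norm_x_minus_1 by (simp add: cong_def)
  then obtain k2 where k2: "icong 3 Phi5 ([:-1, 1:] * [:-1, 1:]) (?w ^ k2)" using nm5_orbit by blast
  have w40: "icong 3 Phi5 (?w ^ 40) 1"
  proof -
    have w4: "icong 3 Phi5 (?w ^ 4) (smult (-1) (monom 1 4))"
      by (rule icongI[of _ _ _ "[:-2, -1, -1, -2:]" _ "[:7, -4, 4, -1, 1:]"])
         (simp add: Phi5_def eval_nat_numeral monom_altdef)
    have "icong 3 Phi5 ((?w ^ 4) ^ 10) (smult (-1) (monom 1 4) ^ 10)" by (intro icong_power w4)
    moreover have "(?w ^ 4) ^ 10 = ?w ^ 40" by (simp only: power_mult[symmetric]) simp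
    moreover have "smult (-1) (monom 1 4) ^ 10 = monom (1::int) 40"
      by (simp add: smult_power monom_power)
    moreover have "icong 3 Phi5 (monom 1 40) 1" using x5_mod_Phi5[of 3 8 0] by (simp add: monom_0 one_pCons)
    ultimately show ?thesis using icong_trans by metis
  qed
  \<comment> \<open>Modulo 3 and \<open>Phi5\<close>, (x - 1) c' is \<open>?w ^ k1\<close> and (x -
    1)^2 is \<open>?w ^ k2\<close>, so c' is x - 1 times \<open>?w\<close> to the power k1 - k2. The
    factor 39 plays the part of -1 because \<open>?w ^ 40\<close> is 1.\<close>
  define D where "D = [:-1, 1:] * ?w ^ (k1 + 39 * k2)"
  have "icong 3 Phi5 D c'"
  proof -
    have i1: "icong 3 Phi5 ([:-1, 1:] * (?w ^ k1 * ?w ^ (39 * k2))) ([:-1, 1:] * ([:-1, 1:] * c' * ?w ^ (39 * k2)))"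
      by (intro icong_mult icong_refl icong_sym[OF k1])
    have e1: "[:-1, 1:] * ([:-1, 1:] * c' * ?w ^ (39 * k2)) = ([:-1, 1:] * [:-1, 1:]) * (c' * ?w ^ (39 * k2))"
      by (simp only: mult.assoc)
    have i2: "icong 3 Phi5 (([:-1, 1:] * [:-1, 1:]) * (c' * ?w ^ (39 * k2))) (?w ^ k2 * (c' * ?w ^ (39 * k2)))"
      by (intro icong_mult icong_refl k2)
    have e2: "?w ^ k2 * (c' * ?w ^ (39 * k2)) = c' * (?w ^ 40) ^ k2"
    proof -
      have "?w ^ k2 * ?w ^ (39 * k2) = (?w ^ 40) ^ k2"
        by (simp only: power_add[symmetric] power_mult[symmetric]) simp
      then show ?thesis by (simp only: mult.left_commute)
    qed
    have i3: "icong 3 Phi5 (c' * (?w ^ 40) ^ k2) (c' * 1 ^ k2)"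
      by (intro icong_mult icong_refl icong_power w40)
    show ?thesis unfolding D_def power_add
      using icong_trans[OF i1[unfolded e1] icong_trans[OF i2[unfolded e2] i3]] by (simp only: power_one mult_1_right)
  qed
  define a :: int where "a = (if [poly c' 1 = 3] (mod 5) then 3 else - 3)"
  have "[poly c' 1 = a] (mod 5)" using c'(2) by (auto simp: a_def cong_def)
  moreover have "[poly D 1 = a] (mod 3)" by (simp add: D_def a_def cong_def)
  ultimately have "a * nm3 D * nm5 c' * nm15 D \<in> S15"
    using \<open>icong 3 Phi5 D c'\<close> by (intro S15_glue icong_refl)
  moreover have "nm3 D = 3" "nm15 D = 1" unfolding D_def n3.N_mult n15.N_mult unit norm_x_minus_1 by simp_all
  ultimately have "a * 3 * p \<in> S15" using c' by simp
  then show "9 * p \<in> S15" using S15_uminus[of "- (9 * p)"] by (auto simp: a_def split: if_splits)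
qed

section \<open>Splitting of rational primes\<close>

lemma legendre_values: "Legendre a p \<in> {-1, 0, 1}"
  by (simp add: Legendre_def)

lemma legendre_3:
  assumes "\<not> 3 dvd a"
  shows "Legendre a 3 = (if a mod 3 = 1 then 1 else - 1)"
proof -
  have a: "a mod 3 = 1 \<or> a mod 3 = 2" using assms by presburger
  have "QuadRes 3 a \<longleftrightarrow> a mod 3 = 1"
  proof
    assume "QuadRes 3 a"
    then obtain y where y: "y\<^sup>2 mod 3 = a mod 3" by (auto simp: QuadRes_def cong_def)
    have "y\<^sup>2 mod 3 = (y mod 3)\<^sup>2 mod 3" by (simp add: power_mod)
    moreover have "y mod 3 \<in> set [0, 1, 2]" by (rule mod_3_cases)
    ultimately show "a mod 3 = 1" using y a by auto
  next
    assume "a mod 3 = 1"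
    then show "QuadRes 3 a" by (auto simp: QuadRes_def cong_def intro: exI[of _ 1])
  qed
  then show ?thesis using assms by (simp add: Legendre_def cong_0_iff)
qed

lemma legendre_5:
  assumes "\<not> 5 dvd a"
  shows "Legendre a 5 = (if a mod 5 = 1 \<or> a mod 5 = 4 then 1 else - 1)"
proof -
  have a: "a mod 5 = 1 \<or> a mod 5 = 2 \<or> a mod 5 = 3 \<or> a mod 5 = 4" using assms by presburger
  have "QuadRes 5 a \<longleftrightarrow> a mod 5 = 1 \<or> a mod 5 = 4"
  proof
    assume "QuadRes 5 a"
    then obtain y where y: "y\<^sup>2 mod 5 = a mod 5" by (auto simp: QuadRes_def cong_def)
    have "y\<^sup>2 mod 5 = (y mod 5)\<^sup>2 mod 5" by (simp add: power_mod)
    moreover have "y mod 5 \<in> set [0, 1, 2, 3, 4]" by (rule mod_5_cases)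
    ultimately show "a mod 5 = 1 \<or> a mod 5 = 4" using y a by auto
  next
    assume "a mod 5 = 1 \<or> a mod 5 = 4"
    then show "QuadRes 5 a"
    proof
      assume "a mod 5 = 1"
      then show ?thesis by (auto simp: QuadRes_def cong_def intro: exI[of _ 1])
    next
      assume "a mod 5 = 4"
      then show ?thesis by (auto simp: QuadRes_def cong_def intro: exI[of _ 2])
    qed
  qed
  then show ?thesis using assms by (simp add: Legendre_def cong_0_iff)
qed

lemma int_mod_eq: "int p mod 15 = int (p mod 15)" "int p mod 3 = int (p mod 15 mod 3)" "int p mod 5 = int (p mod 15 mod 5)"
  by (simp_all add: zmod_int mod_mod_cancel)

lemma legendre_5_reciprocal:
  assumes p: "prime p" "2 < p" "p \<noteq> 5"
  shows "Legendre 5 (int p) = Legendre (int p) 5"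
proof -
  have "Legendre (int p) 5 * Legendre 5 (int p) = 1"
    using Quadratic_Reciprocity[of p 5] p by simp
  then show ?thesis using legendre_values[of "int p" 5] legendre_values[of 5 "int p"] by auto
qed

text \<open>Reciprocity for 3 produces the same sign as the factor -1 of -15, so the two cancel.
  Both sides lie in {-1, 0, 1}, hence their congruence modulo p > 2 is an equality.\<close>

lemma legendre_minus_15:
  assumes p: "prime p" "2 < p" "p \<noteq> 3" "p \<noteq> 5"
  shows "Legendre (- 15) (int p) = Legendre (int p) 3 * Legendre (int p) 5"
proof -
  define h where "h = (p - 1) div 2"
  have r3: "Legendre (int p) 3 * Legendre 3 (int p) = (- 1) ^ h"
    using Quadratic_Reciprocity[of p 3] p by (simp add: h_def)
  have "[Legendre (- 15) (int p) = (- 15) ^ h] (mod int p)"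
    using euler_criterion[OF p(1,2)] by (simp add: h_def)
  also have "(- 15 :: int) ^ h = (- 1) ^ h * 3 ^ h * 5 ^ h"
    by (simp add: power_mult_distrib[symmetric])
  also have "[(- 1) ^ h * 3 ^ h * 5 ^ h = (- 1) ^ h * Legendre 3 (int p) * Legendre 5 (int p)] (mod int p)"
    using euler_criterion[OF p(1,2)] unfolding h_def by (intro cong_mult cong_refl) (simp_all add: cong_sym_eq)
  also have "(- 1) ^ h * Legendre 3 (int p) * Legendre 5 (int p) = Legendre (int p) 3 * Legendre (int p) 5"
  proof -
    have "(- 1) ^ h * Legendre 3 (int p) = Legendre (int p) 3 * (Legendre 3 (int p) * Legendre 3 (int p))"
      unfolding r3[symmetric] by simp
    also have "Legendre 3 (int p) * Legendre 3 (int p) = 1"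
      using r3 legendre_values[of 3 "int p"] by auto
    finally show ?thesis using legendre_5_reciprocal[OF p(1,2,4)] by simp
  qed
  finally have "int p dvd Legendre (- 15) (int p) - Legendre (int p) 3 * Legendre (int p) 5"
    by (simp add: cong_iff_dvd_diff)
  moreover have "\<bar>Legendre (- 15) (int p) - Legendre (int p) 3 * Legendre (int p) 5\<bar> < int p"
    using legendre_values[of "- 15" "int p"] legendre_values[of "int p" 3] legendre_values[of "int p" 5] p by auto
  ultimately show ?thesis
    using dvd_imp_le_int[of "Legendre (- 15) (int p) - Legendre (int p) 3 * Legendre (int p) 5" "int p"] by fastforce
qed

lemma halve_mod: "odd (p::int) \<Longrightarrow> \<exists>r. p dvd 2 * r - y"
proof -
  assume "odd p"
  then obtain k where "p = 2 * k + 1" by (auto elim: oddE)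
  then have "2 * (y * (k + 1)) - y = p * y" by (simp add: algebra_simps)
  then show ?thesis by (metis dvd_triv_left)
qed

lemma odd_dvd_4: "odd (p::int) \<Longrightarrow> p dvd 2 * (2 * x) \<Longrightarrow> p dvd x"
  by (metis coprime_dvd_mult_right_iff coprime_right_2_iff_odd)

lemma prime_odd_mod_15:
  assumes "prime (p::nat)" "p mod 15 \<noteq> 2"
  shows "2 < p" "odd p"
  using assms prime_ge_2_nat[OF assms(1)] prime_odd_nat[OF assms(1)] by (cases "p = 2"; auto)+

text \<open>Both Legendre symbols of \<open>p\<close>, modulo 3 and modulo 5, are -1, so -15 is a
  square y^2 and (1 + y)/2 is a root. For p = 2 halving fails, but 0 is a root.\<close>

lemma theta_root_exists:
  assumes p: "prime p" "p mod 15 = 2 \<or> p mod 15 = 8"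
  shows "\<exists>r. int p dvd r\<^sup>2 - r + 4"
proof (cases "p = 2")
  case True
  then show ?thesis by (intro exI[of _ 0]) simp
next
  case False
  then have p2: "2 < p" using prime_ge_2_nat[OF p(1)] by simp
  have p35: "p \<noteq> 3" "p \<noteq> 5" using p by auto
  have m: "int p mod 3 = 2" "int p mod 5 = 2 \<or> int p mod 5 = 3"
    using p(2) unfolding int_mod_eq(2,3)[of p] by (elim disjE; simp)+
  then have "\<not> 3 dvd int p" "\<not> 5 dvd int p" by (metis dvd_imp_mod_0 zero_neq_numeral)+
  then have "Legendre (int p) 3 = - 1" "Legendre (int p) 5 = - 1"
    using legendre_3[of "int p"] legendre_5[of "int p"] m by auto
  then have "Legendre (- 15) (int p) = 1" using legendre_minus_15[OF p(1) p2 p35] by simp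
  then have "QuadRes (int p) (- 15)" by (auto simp: Legendre_def split: if_splits)
  then obtain y where y: "[y\<^sup>2 = - 15] (mod int p)" by (auto simp: QuadRes_def)
  have odd: "odd (int p)" using prime_odd_nat[OF p(1)] p2 by simp
  then obtain r where r: "int p dvd 2 * r - (y + 1)" using halve_mod by blast
  then have "[2 * r - 1 = y] (mod int p)" by (simp add: cong_iff_dvd_diff algebra_simps)
  then have "[(2 * r - 1)\<^sup>2 = y\<^sup>2] (mod int p)" by (rule cong_pow)
  then have "[(2 * r - 1)\<^sup>2 = - 15] (mod int p)" using y cong_trans by blast
  then have "int p dvd (2 * r - 1)\<^sup>2 + 15" by (simp add: cong_iff_dvd_diff)
  also have "(2 * r - 1)\<^sup>2 + 15 = 2 * (2 * (r\<^sup>2 - r + 4))" by (simp add: power2_eq_square algebra_simps)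
  finally have "int p dvd r\<^sup>2 - r + 4"
    by (rule odd_dvd_4[OF odd])
  then show ?thesis by blast
qed

lemma tau_root_exists:
  assumes p: "prime p" "p mod 15 = 4"
  shows "\<exists>t. int p dvd t\<^sup>2 + t - 1"
proof -
  have p2: "2 < p" and odd: "odd (int p)" using prime_odd_mod_15[OF p(1)] p(2) by auto
  have m: "int p mod 5 = 4" using p(2) int_mod_eq(3)[of p] by simp
  then have "\<not> 5 dvd int p" by presburger
  then have "Legendre (int p) 5 = 1" using legendre_5[of "int p"] m by simp
  moreover have "p \<noteq> 5" using p by auto
  ultimately have "Legendre 5 (int p) = 1" using legendre_5_reciprocal[OF p(1) p2] by simp
  then have "QuadRes (int p) 5" by (auto simp: Legendre_def split: if_splits)
  then obtain y where y: "[y\<^sup>2 = 5] (mod int p)" by (auto simp: QuadRes_def)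
  obtain t where t: "int p dvd 2 * t - (y - 1)" using halve_mod[OF odd] by blast
  then have "[2 * t + 1 = y] (mod int p)" by (simp add: cong_iff_dvd_diff algebra_simps)
  then have "[(2 * t + 1)\<^sup>2 = y\<^sup>2] (mod int p)" by (rule cong_pow)
  then have "[(2 * t + 1)\<^sup>2 = 5] (mod int p)" using y cong_trans by blast
  then have "int p dvd (2 * t + 1)\<^sup>2 - 5" by (simp add: cong_iff_dvd_diff)
  also have "(2 * t + 1)\<^sup>2 - 5 = 2 * (2 * (t\<^sup>2 + t - 1))" by (simp add: power2_eq_square algebra_simps)
  finally have "int p dvd t\<^sup>2 + t - 1"
    by (rule odd_dvd_4[OF odd])
  then show ?thesis by blast
qed

text \<open>The symbols modulo 3 and 5 are now -1 and 1, so -15 is a nonsquare and the norm form has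
  only the trivial zero modulo \<open>p\<close>.\<close>

lemma inert_14:
  assumes p: "prime p" "p mod 15 = 14" and dvd: "int p dvd a\<^sup>2 + a * b + 4 * b\<^sup>2"
  shows "int p dvd a" "int p dvd b"
proof -
  have p2: "2 < p" using prime_odd_mod_15[OF p(1)] p(2) by auto
  have p35: "p \<noteq> 3" "p \<noteq> 5" using p by auto
  have pp: "prime (int p)" using p(1) by simp
  have m: "int p mod 3 = 2" "int p mod 5 = 4"
    using p(2) int_mod_eq(2,3)[of p] by auto
  then have "\<not> 3 dvd int p" "\<not> 5 dvd int p" by (metis dvd_imp_mod_0 zero_neq_numeral)+
  then have "Legendre (int p) 3 = - 1" "Legendre (int p) 5 = 1"
    using legendre_3[of "int p"] legendre_5[of "int p"] m by auto
  then have "Legendre (- 15) (int p) = - 1" using legendre_minus_15[OF p(1) p2 p35] by simp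
  then have nq: "\<not> QuadRes (int p) (- 15)" by (auto simp: Legendre_def split: if_splits)
  have sq: "(2 * a + b)\<^sup>2 + 15 * b\<^sup>2 = 4 * (a\<^sup>2 + a * b + 4 * b\<^sup>2)" by (simp add: power2_eq_square algebra_simps)
  show b: "int p dvd b"
  proof (rule ccontr)
    assume "\<not> int p dvd b"
    then have "coprime b (int p)" using prime_imp_coprime[OF pp] by (simp add: coprime_commute)
    then obtain c where c: "[b * c = 1] (mod int p)" using cong_solve_coprime_int by blast
    have "[((2 * a + b) * c)\<^sup>2 + 15 * (b * c)\<^sup>2 = 0] (mod int p)"
    proof -
      have "((2 * a + b) * c)\<^sup>2 + 15 * (b * c)\<^sup>2 = 4 * (a\<^sup>2 + a * b + 4 * b\<^sup>2) * c\<^sup>2"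
        by (simp add: power2_eq_square algebra_simps)
      then show ?thesis unfolding cong_0_iff by (simp only: dvd dvd_mult dvd_mult2)
    qed
    moreover have "[((2 * a + b) * c)\<^sup>2 + 15 * (b * c)\<^sup>2 = ((2 * a + b) * c)\<^sup>2 + 15 * 1\<^sup>2] (mod int p)"
      by (intro cong_add cong_refl cong_mult cong_pow c)
    ultimately have "[((2 * a + b) * c)\<^sup>2 + 15 * 1\<^sup>2 = 0] (mod int p)"
      by (rule cong_trans[OF cong_sym, rotated])
    then have "[((2 * a + b) * c)\<^sup>2 = - 15] (mod int p)" by (simp add: cong_iff_dvd_diff)
    then show False using nq by (auto simp: QuadRes_def)
  qed
  then have "int p dvd a * b + 4 * b\<^sup>2" by (simp add: power2_eq_square)
  then have "int p dvd a\<^sup>2" using dvd by (metis add.assoc dvd_add_left_iff)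
  then show "int p dvd a" using pp prime_dvd_power by blast
qed

section \<open>Roots of the cyclotomic polynomials modulo primes\<close>

lemma root_of_unity_mod_prime:
  assumes p: "prime p" and d: "d dvd p - 1" "0 < d"
  shows "\<exists>r. int p dvd r ^ d - 1 \<and> (\<forall>k. 0 < k \<and> k < d \<longrightarrow> \<not> int p dvd r ^ k - 1)"
proof -
  obtain g where g: "residue_primroot p g" using prime_primitive_root_exists[of p] p prime_gt_1_nat[OF p] by blast
  then have og: "ord p g = p - 1" by (auto simp: residue_primroot_def totient_prime[OF p])
  obtain e where e: "p - 1 = d * e" using d(1) by (rule dvdE)
  have pos: "0 < p - 1" using prime_gt_1_nat[OF p] by simp
  define r where "r = g ^ e"
  have iff: "int p dvd int r ^ k - 1 \<longleftrightarrow> d dvd k" for k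
  proof -
    have "int p dvd int r ^ k - 1 \<longleftrightarrow> [int (r ^ k) = int 1] (mod int p)" by (simp add: cong_iff_dvd_diff)
    also have "\<dots> \<longleftrightarrow> [r ^ k = 1] (mod p)" by (rule cong_int_iff)
    also have "\<dots> \<longleftrightarrow> [g ^ (e * k) = 1] (mod p)" by (simp add: r_def power_mult)
    also have "\<dots> \<longleftrightarrow> p - 1 dvd e * k" using ord_divides[of g "e * k" p] og by simp
    also have "\<dots> \<longleftrightarrow> d dvd k" using pos unfolding e by (simp add: mult.commute)
    finally show ?thesis .
  qed
  show ?thesis
    by (rule exI[of _ "int r"]) (use iff d in \<open>auto dest: dvd_imp_le\<close>)
qed

lemma Phi3_root_exists:
  assumes p: "prime p" "3 dvd p - 1"
  shows "\<exists>r. int p dvd poly Phi3 r"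
proof -
  obtain r where r: "int p dvd r ^ 3 - 1" "\<not> int p dvd r ^ 1 - 1"
    using root_of_unity_mod_prime[OF p] by force
  have "r ^ 3 - 1 = (r - 1) * poly Phi3 r" by (simp add: Phi3_def algebra_simps power3_eq_cube)
  then show ?thesis using r p(1) by (metis power_one_right prime_dvd_mult_iff prime_nat_int_transfer)
qed

lemma Phi5_root_exists:
  assumes p: "prime p" "5 dvd p - 1"
  shows "\<exists>r. int p dvd poly Phi5 r"
proof -
  obtain r where r: "int p dvd r ^ 5 - 1" "\<not> int p dvd r ^ 1 - 1"
    using root_of_unity_mod_prime[OF p] by force
  have "r ^ 5 - 1 = (r - 1) * poly Phi5 r" by (simp add: Phi5_def algebra_simps eval_nat_numeral)
  then show ?thesis using r p(1) by (metis power_one_right prime_dvd_mult_iff prime_nat_int_transfer)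
qed

lemma Phi15_root_exists:
  assumes p: "prime p" "15 dvd p - 1"
  shows "\<exists>r. int p dvd poly Phi15 r"
proof -
  obtain r where r: "int p dvd r ^ 15 - 1" "\<forall>k. 0 < k \<and> k < 15 \<longrightarrow> \<not> int p dvd r ^ k - 1"
    using root_of_unity_mod_prime[OF p] by force
  have f: "r ^ 15 - 1 = (r ^ 5 - 1) * (poly Phi3 r * poly Phi15 r)"
    by (simp add: Phi3_def Phi15_def algebra_simps eval_nat_numeral)
  have f3: "r ^ 3 - 1 = (r - 1) * poly Phi3 r" by (simp add: Phi3_def algebra_simps power3_eq_cube)
  have "\<not> int p dvd poly Phi3 r" using r(2)[rule_format, of 3] f3 by auto
  moreover have "\<not> int p dvd r ^ 5 - 1" using r(2)[rule_format, of 5] by simp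
  moreover have "prime (int p)" using p(1) by simp
  ultimately show ?thesis using r(1) unfolding f by (metis prime_dvd_mult_iff)
qed

lemma poly_taylor_1: "\<exists>k. poly f (r + h) = poly f r + h * poly (pderiv f) r + h\<^sup>2 * (k :: int)"
proof (induction f)
  case (pCons a f)
  then obtain k where k: "poly f (r + h) = poly f r + h * poly (pderiv f) r + h\<^sup>2 * k" by blast
  show ?case
    by (intro exI[of _ "poly (pderiv f) r + r * k + h * k"])
       (simp only: poly_pCons k pderiv_pCons poly_add, simp add: algebra_simps power2_eq_square)
qed simp

text \<open>The Bezout relation makes the root simple modulo \<open>p\<close>. If the value is
  divisible by p^2, the shift r + p adds p f'(r) up to multiples of p^2 and spoils that. A single
  factor \<open>p\<close> is what will bound the exponent in the norm of a divisor.\<close>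

lemma exact_root:
  assumes p: "prime (p::int)" and r: "p dvd poly f r"
    and D: "A * f + B * pderiv f = [:D:]" "\<not> p dvd D"
  shows "\<exists>r'. p dvd r' - r \<and> p dvd poly f r' \<and> \<not> p\<^sup>2 dvd poly f r'"
proof (cases "p\<^sup>2 dvd poly f r")
  case False
  then show ?thesis using r by (intro exI[of _ r]) simp
next
  case True
  have "poly A r * poly f r + poly B r * poly (pderiv f) r = D"
    using arg_cong[OF D(1), of "\<lambda>q. poly q r"] by simp
  then have nd: "\<not> p dvd poly (pderiv f) r" using r D(2) by auto
  obtain k where k: "poly f (r + p) = poly f r + p * poly (pderiv f) r + p\<^sup>2 * k" using poly_taylor_1 by blast
  have "\<not> p\<^sup>2 dvd poly f (r + p)"
  proof
    assume "p\<^sup>2 dvd poly f (r + p)"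
    then have "p\<^sup>2 dvd poly f (r + p) - poly f r - p\<^sup>2 * k" using True by (intro dvd_diff) auto
    then have "p * p dvd p * poly (pderiv f) r" by (simp add: k power2_eq_square)
    then show False using nd p by (auto simp: dvd_mult_cancel_left)
  qed
  moreover have "p dvd poly f (r + p)" unfolding k using r by (auto simp: power2_eq_square)
  ultimately show ?thesis by (intro exI[of _ "r + p"]) simp
qed

context cyc begin

lemma N_linear: "even (card Z) \<Longrightarrow> N [:- r, 1:] = poly Phi r"
proof (rule N_unique)
  assume even: "even (card Z)"
  define P where "P = (\<Prod>z\<in>Z. [:- z, 1:])"
  have dP: "degree P = card Z" unfolding P_def by (subst degree_prod_sum_eq) auto
  have "map_poly of_int Phi = P"
  proof (rule poly_eqI_degree_lead_coeff[of _ "card Z" _ Z])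
    have "lead_coeff P = 1" unfolding P_def lead_coeff_prod by simp
    then show "coeff (map_poly of_int Phi) (card Z) = coeff P (card Z)"
      using monic dP degree_Phi by (simp add: coeff_map_poly)
    show "poly (map_poly of_int Phi) z = poly P z" if "z \<in> Z" for z
    proof -
      have "poly P z = 0" using that finite_Z by (auto simp: P_def poly_prod)
      then show ?thesis using root[OF that] by (simp add: ev_def)
    qed
  qed (auto simp: degree_map_poly degree_Phi dP)
  then have c1: "ev Phi (of_int r) = (\<Prod>z\<in>Z. of_int r - z)"
    by (simp add: ev_def P_def poly_prod)
  have c2: "ev Q (of_int r) = of_int (poly Q r)" for Q by (induction Q) simp_all
  have c3: "(\<Prod>z\<in>Z. of_int r - z) = (\<Prod>z\<in>Z. (- 1) * ev [:- r, 1:] z)"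
    by (intro prod.cong) auto
  have c4: "\<dots> = (\<Prod>z\<in>Z. ev [:- r, 1:] z)"
    using even by (simp only: prod.distrib prod_constant) simp
  show "of_int (poly Phi r) = (\<Prod>z\<in>Z. ev [:- r, 1:] z)"
    unfolding c2[symmetric] c1 c3 c4 ..
qed

end

context euclid begin

lemma prime_divisor_bounded:
  assumes p: "prime (p :: nat)" "int p dvd N F" "\<not> int p ^ Suc k dvd N F"
  shows "\<exists>G F' p' j. Phi dvd F - G * F' \<and> Phi dvd [:int p:] - G * p' \<and> N G = int p ^ j \<and> 1 \<le> j \<and> j \<le> k"
proof -
  obtain G F' p' j where *: "Phi dvd F - G * F'" "Phi dvd [:int p:] - G * p'" "N G = int p ^ j" "1 \<le> j"
    using prime_divisor[OF p(1,2)] by blast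
  have "int p ^ j dvd N F" using N_cong[OF *(1)] *(3) by simp
  then have "j \<le> k" using p(3) by (metis le_imp_power_dvd dvd_trans not_less_eq_eq)
  then show ?thesis using * by blast
qed

text \<open>A divisor above \<open>p\<close> has norm congruent to 1 modulo \<open>q\<close>, so
  \<open>p\<close> enters with an exponent that reaches at least its order modulo
  \<open>q\<close>.\<close>

lemma prime_power_dvd_N:
  assumes "prime (p :: nat)" "int p dvd N F" "coprime (int p) q"
  shows "\<exists>j\<ge>1. [int p ^ j = 1] (mod q) \<and> int p ^ j dvd N F"
proof -
  obtain G F' p' j where *: "Phi dvd F - G * F'" "N G = int p ^ j" "1 \<le> j"
    using prime_divisor[OF assms(1,2)] by blast
  have "[int p ^ j = 1] (mod q)" using N_cong_1[of G] * assms(3) by (simp add: coprime_power_left_iff)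
  moreover have "int p ^ j dvd N F" using N_cong[OF *(1)] *(2) by simp
  ultimately show ?thesis using *(3) by blast
qed

text \<open>Splitting off divisors above primes writes the norm as a product of prime powers that
  are each 1 modulo \<open>q\<close>; the hypothesis is applied to each of them.\<close>

lemma N_power_cong_1:
  assumes "N F \<noteq> 0" "coprime (N F) q"
    and "\<And>p j. prime p \<Longrightarrow> int p dvd N F \<Longrightarrow> [int p ^ j = 1] (mod q) \<Longrightarrow> [(int p ^ j) ^ e = 1] (mod m)"
  shows "[(N F) ^ e = 1] (mod m)"
  using assms
proof (induction "nat (N F)" arbitrary: F rule: less_induct)
  case less
  have pos: "0 < N F" using less.prems(1) N_nonneg[of F] by simp
  show ?case
  proof (cases "N F = 1")
    case False
    then have "nat (N F) \<noteq> 1" using pos by simp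
    then obtain p where p: "prime p" "p dvd nat (N F)" using prime_factor_nat by blast
    then have pd: "int p dvd N F" using pos by (metis int_dvd_int_iff int_nat_eq less_imp_le)
    obtain G F' p' j where *: "Phi dvd F - G * F'" "N G = int p ^ j" "1 \<le> j"
      using prime_divisor[OF p(1) pd] by blast
    have NF: "N F = int p ^ j * N F'" using N_cong[OF *(1)] *(2) by simp
    have "coprime (N G) q" using less.prems(2) NF *(2) by simp
    then have "[int p ^ j = 1] (mod q)" using N_cong_1 *(2) by metis
    then have "[(int p ^ j) ^ e = 1] (mod m)" using less.prems(3)[OF p(1) pd] by blast
    moreover have "[(N F') ^ e = 1] (mod m)"
    proof (rule less.hyps)
      have "1 < int p ^ j" using *(3) prime_gt_1_nat[OF p(1)] by (intro one_less_power) auto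
      moreover have "0 < N F'" using pos NF N_nonneg[of F'] by (metis less_le mult_zero_right)
      ultimately have "N F' < N F" unfolding NF by simp
      then show "nat (N F') < nat (N F)" using pos by simp
      show "N F' \<noteq> 0" using \<open>0 < N F'\<close> by simp
      show "coprime (N F') q" using less.prems(2) NF by simp
      show "[(int r ^ i) ^ e = 1] (mod m)" if "prime r" "int r dvd N F'" "[int r ^ i = 1] (mod q)" for r i
        using less.prems(3)[OF that(1) _ that(3)] that(2) NF by simp
    qed
    ultimately have "[(int p ^ j) ^ e * (N F') ^ e = 1 * 1] (mod m)" by (rule cong_mult)
    then show ?thesis by (simp add: NF power_mult_distrib)
  qed simp
qed

end

section \<open>The quadratic character\<close>

text \<open>The number a + 8b combines the residues a - b modulo 3 and a - 2b modulo 5, and as 8 is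
  the inverse of 2 modulo 15 it is half the trace. Character -1 means half trace 4 or 11, that is,
  trace 8 or 7.\<close>

lemma char_neg_iff:
  assumes "[nm5 F = a - b] (mod 3)" "[(nm3 F)\<^sup>2 = a - 2 * b] (mod 5)"
  shows "char_neg F \<longleftrightarrow> (2 * a + b) mod 15 \<in> {7, 8}"
proof -
  define r where "r = (a + 8 * b) mod 15"
  have e3: "(a - b) mod 3 = r mod 3"
  proof -
    have "(a - b) mod 3 = (a + 8 * b) mod 3" by (simp add: mod_eq_dvd_iff)
    then show ?thesis by (simp add: r_def mod_mod_cancel)
  qed
  have e5: "(a - 2 * b) mod 5 = r mod 5"
  proof -
    have "(a - 2 * b) mod 5 = (a + 8 * b) mod 5" by (simp add: mod_eq_dvd_iff)
    then show ?thesis by (simp add: r_def mod_mod_cancel)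
  qed
  have e15: "(2 * a + b) mod 15 = (2 * r) mod 15"
  proof -
    have "(2 * a + b) mod 15 = (2 * (a + 8 * b)) mod 15" by (simp add: mod_eq_dvd_iff)
    then show ?thesis by (simp only: r_def mod_mult_right_eq)
  qed
  have m: "char_neg F \<longleftrightarrow> r mod 3 = 1 \<and> r mod 5 = 4 \<or> r mod 3 = 2 \<and> r mod 5 = 1"
  proof -
    have n: "nm5 F mod 3 = r mod 3" "(nm3 F)\<^sup>2 mod 5 = r mod 5" using assms e3 e5 by (simp_all only: cong_def)
    show ?thesis unfolding char_neg_def cong_def n by simp
  qed
  have "0 \<le> r" "r < 15" by (simp_all add: r_def)
  then have "r = 0 \<or> r = 1 \<or> r = 2 \<or> r = 3 \<or> r = 4 \<or> r = 5 \<or> r = 6 \<or> r = 7 \<or> r = 8 \<or> r = 9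
     \<or> r = 10 \<or> r = 11 \<or> r = 12 \<or> r = 13 \<or> r = 14" by presburger
  then show ?thesis unfolding m e15 by (elim disjE) simp_all
qed

lemma char_neg_trace:
  "\<exists>a b. (\<forall>z\<in>Z15. ev F z * ev F (z ^ 2) * ev F (z ^ 4) * ev F (z ^ 8) = of_int a + of_int b * ev theta z)
     \<and> nm15 F = a\<^sup>2 + a * b + 4 * b\<^sup>2 \<and> (2 * a + b)\<^sup>2 + 15 * b\<^sup>2 = 4 * nm15 F
     \<and> (char_neg F \<longleftrightarrow> (2 * a + b) mod 15 \<in> {7, 8})"
proof -
  obtain a b where ab: "\<forall>z\<in>Z15. ev F z * ev F (z ^ 2) * ev F (z ^ 4) * ev F (z ^ 8) = of_int a + of_int b * ev theta z"
      "nm15 F = a\<^sup>2 + a * b + 4 * b\<^sup>2" "[nm5 F = a - b] (mod 3)" "[(nm3 F)\<^sup>2 = a - 2 * b] (mod 5)"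
    using quadratic_norm by blast
  have "(2 * a + b)\<^sup>2 + 15 * b\<^sup>2 = 4 * nm15 F" unfolding ab(2) by (simp add: power2_eq_square algebra_simps)
  then show ?thesis using ab char_neg_iff[OF ab(3,4)] by blast
qed

text \<open>Hence the relative norm of a unit has trace 2 or -2, which is why units have trivial
  character.\<close>

lemma trace_of_norm_1:
  assumes "T\<^sup>2 + 15 * b\<^sup>2 = (4::int)"
  shows "b = 0 \<and> (T = 2 \<or> T = - 2)"
proof -
  have "b = 0"
  proof (rule ccontr)
    assume "b \<noteq> 0"
    then have "0 < b\<^sup>2" by simp
    then show False using assms zero_le_power2[of T] by linarith
  qed
  then have "T\<^sup>2 = 2\<^sup>2" using assms by simp
  then show ?thesis using \<open>b = 0\<close> by (auto simp only: power2_eq_iff)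
qed

lemma product_square:
  assumes "A * B = y\<^sup>2" "0 < (A::nat)" "0 < B"
  shows "\<exists>g s t. A = g * s\<^sup>2 \<and> B = g * t\<^sup>2 \<and> g dvd A \<and> g dvd B"
proof -
  define g where "g = gcd A B"
  have g0: "g > 0" using assms by (simp add: g_def)
  then obtain A' B' where AB': "A = A' * g" "B = B' * g" "coprime A' B'"
    using gcd_coprime_exists[of A B] unfolding g_def[symmetric] by auto
  then have AB: "A = g * A'" "B = g * B'" "coprime A' B'" by (simp_all only: mult.commute)
  have pos: "0 < A'" "0 < B'" using assms(2,3) AB by (auto intro: Nat.gr0I)
  have "g\<^sup>2 * (A' * B') = y\<^sup>2" using assms(1) AB by (simp add: power2_eq_square mult_ac)
  then have "g\<^sup>2 dvd y\<^sup>2" by (metis dvd_triv_left)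
  then have "g dvd y" by (simp add: pow_divides_pow_iff)
  then obtain y' where y: "y = g * y'" by (rule dvdE)
  then have "A' * B' = y'\<^sup>2" using \<open>g\<^sup>2 * (A' * B') = y\<^sup>2\<close> g0 by (simp add: power_mult_distrib)
  then have "is_nth_power 2 (A' * B')" by (auto simp: is_nth_power_def)
  then have "is_nth_power 2 A'" "is_nth_power 2 B'"
    using is_nth_power_mult_coprime_natD[OF AB(3) _ pos] by blast+
  then obtain s t where "A' = s\<^sup>2" "B' = t\<^sup>2" by (auto simp: is_nth_power_def)
  then show ?thesis using AB by (intro exI[of _ g] exI[of _ s] exI[of _ t]) simp
qed

text \<open>If \<open>T \<equiv> 2\<close>, then \<open>(2q - T)(2q + T) = 15 y\<^sup>2\<close> splits as \<open>3 g s\<^sup>2 \<cdot> 5 g t\<^sup>2\<close> with \<open>g\<close> dividing 4,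
  and \<open>4 q = g (3 s\<^sup>2 + 5 t\<^sup>2)\<close> is impossible modulo 3 or modulo 8.\<close>

lemma no_trace_2:
  fixes q T y :: int
  assumes q: "0 < q" "odd q" "q mod 15 = 4" and T: "T mod 15 = 2"
    and eq: "T\<^sup>2 + 15 * y\<^sup>2 = 4 * q\<^sup>2" and cop: "coprime T q"
  shows False
proof -
  have T2: "\<bar>T\<bar> \<le> \<bar>2 * q\<bar>"
    unfolding abs_le_square_iff using eq by (simp add: power_mult_distrib) (metis zero_le_power2 add_increasing2 le_add_same_cancel1 mult_nonneg_nonneg zero_le_numeral)
  have ne: "T \<noteq> 2 * q" "T \<noteq> - 2 * q"
  proof -
    have "\<not> is_unit q" using q by auto
    then show "T \<noteq> 2 * q" "T \<noteq> - 2 * q" using cop by (auto simp: coprime_mult_left_iff)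
  qed
  obtain u where u: "q = 15 * u + 4" using q(3) by (metis mult_div_mod_eq)
  obtain w where w: "T = 15 * w + 2" using T by (metis mult_div_mod_eq)
  \<comment> \<open>The residues of \<open>q\<close> and \<open>T\<close> modulo 15 decide which
    factor of (2q - T)(2q + T) takes the 3 and which the 5.\<close>
  have "2 * q - T = 3 * (10 * u - 5 * w + 2)" "2 * q + T = 5 * (6 * u + 3 * w + 2)"
    by (simp_all add: u w)
  then obtain A B where A: "2 * q - T = 3 * A" and B: "2 * q + T = 5 * B" by blast
  have pos: "0 < A" "0 < B" using A B T2 ne q(1) by linarith+
  have "15 * (A * B) = (2 * q - T) * (2 * q + T)" unfolding A B by simp
  also have "\<dots> = 15 * y\<^sup>2" using eq by (simp add: power2_eq_square algebra_simps)
  finally have AB: "A * B = y\<^sup>2" by simp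
  then have "nat A * nat B = (nat \<bar>y\<bar>)\<^sup>2"
    using pos by (metis abs_ge_zero abs_mult_self_eq less_imp_le nat_mult_distrib power2_eq_square)
  then obtain g' s' t' where g': "nat A = g' * s'\<^sup>2" "nat B = g' * t'\<^sup>2" "g' dvd nat A" "g' dvd nat B"
    using product_square[of "nat A" "nat B"] pos by auto
  define g s t where "g = int g'" and "s = int s'" and "t = int t'"
  have gA: "A = g * s\<^sup>2" and gB: "B = g * t\<^sup>2"
    using arg_cong[OF g'(1), of int] arg_cong[OF g'(2), of int] pos by (simp_all add: g_def s_def t_def)
  have g0: "0 < g" using gA pos(1) by (cases "g' = 0") (simp_all add: g_def)
  have "g dvd 4"
  proof -
    have "g dvd 3 * A + 5 * B" "g dvd 5 * B - 3 * A" by (simp_all add: gA gB)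
    moreover have "3 * A + 5 * B = 4 * q" "5 * B - 3 * A = 2 * T" using A B by linarith+
    ultimately have "g dvd 4 * q" "g dvd 2 * T" by simp_all
    then have "g dvd 4 * q" "g dvd 4 * T" by (auto dest: dvd_mult[of g "2 * T" 2])
    then have "g dvd gcd (4 * q) (4 * T)" by simp
    also have "gcd (4 * q) (4 * T) = 4" using cop by (simp add: gcd_mult_left coprime_iff_gcd_eq_1[symmetric] coprime_commute)
    finally show ?thesis .
  qed
  then have "g \<le> 4" by (auto dest: zdvd_imp_le)
  then have "g = 1 \<or> g = 2 \<or> g = 3 \<or> g = 4" using g0 by presburger
  then have gs: "g = 1 \<or> g = 2 \<or> g = 4" using \<open>g dvd 4\<close> by auto
  have sum: "4 * q = g * (3 * s\<^sup>2 + 5 * t\<^sup>2)"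
  proof -
    have "4 * q = 3 * A + 5 * B" using A B by simp
    then show ?thesis unfolding gA gB by (simp add: algebra_simps)
  qed
  have t3: "t\<^sup>2 mod 3 = 0 \<or> t\<^sup>2 mod 3 = 1"
    using not_dvd_3_square[of t] by (cases "3 dvd t") (auto simp: cong_def power2_eq_square)
  have q3: "q mod 3 = 1" using q(3) mod_mod_cancel[of 3 15 q] by simp
  define S U where "S = s\<^sup>2" and "U = t\<^sup>2"
  have sum': "4 * q = g * (3 * S + 5 * U)" and t3': "U mod 3 = 0 \<or> U mod 3 = 1" using sum t3 by (simp_all add: S_def U_def)
  obtain u' where u': "q = 3 * u' + 1" using q3 by (metis mult_div_mod_eq)
  obtain v' where v': "U = 3 * v' \<or> U = 3 * v' + 1" using t3' by (metis mult_div_mod_eq add_0_right)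
  show False
    using gs
  proof (elim disjE)
    assume "g = 1"
    then have "4 * (3 * u' + 1) = 3 * S + 5 * U" using sum' u' by simp
    then show False using v' by presburger
  next
    assume "g = 4"
    then have "3 * u' + 1 = 3 * S + 5 * U" using sum' u' by simp
    then show False using v' by presburger
  next
    assume "g = 2"
    then have sum2: "2 * q = 3 * S + 5 * U" using sum' by simp
    have sq8: "x\<^sup>2 mod 8 = 1 \<or> 4 dvd x\<^sup>2" for x :: int
    proof (cases "even x")
      case True
      then show ?thesis by (auto elim!: evenE simp: power2_eq_square)
    next
      case False
      then obtain k where k: "x = 2 * k + 1" by (auto elim: oddE)
      have "even (k * (k + 1))" by simp
      then obtain j where j: "k * (k + 1) = 2 * j" by (rule evenE)
      have "x\<^sup>2 = 4 * (k * (k + 1)) + 1" by (simp add: k power2_eq_square algebra_simps)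
      then have "x\<^sup>2 = 8 * j + 1" by (simp add: j)
      then show ?thesis by simp
    qed
    have S8: "S mod 8 = 1 \<or> 4 dvd S" and U8: "U mod 8 = 1 \<or> 4 dvd U" using sq8 by (simp_all add: S_def U_def)
    obtain i where i: "S = 8 * i + 1 \<or> S = 4 * i" using S8 by (metis mult_div_mod_eq dvdE)
    obtain j where j: "U = 8 * j + 1 \<or> U = 4 * j" using U8 by (metis mult_div_mod_eq dvdE)
    obtain k where "q = 2 * k + 1" using q(2) by (auto elim: oddE)
    then have "2 * (2 * k + 1) = 3 * S + 5 * U" using sum2 by simp
    then show False using i j by presburger
  qed
qed

text \<open>Modulo 15 the square of \<open>T\<close> is 4, which leaves 2, 7, 8 and 13;
  \<open>no_trace_2\<close> for \<open>T\<close> and \<open>- T\<close> removes 2 and 13.\<close>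

lemma trace_7_or_8:
  fixes q T y :: int
  assumes q: "0 < q" "odd q" "q mod 15 = 4"
    and eq: "T\<^sup>2 + 15 * y\<^sup>2 = 4 * q\<^sup>2" and cop: "coprime T q"
  shows "T mod 15 \<in> {7, 8}"
proof -
  have "T\<^sup>2 mod 15 = 4"
  proof -
    have "[q\<^sup>2 = 4\<^sup>2] (mod 15)" using q(3) by (intro cong_pow) (simp add: cong_def)
    then have "[4 * q\<^sup>2 = 4 * 4\<^sup>2] (mod 15)" by (rule cong_scalar_left)
    moreover have "[T\<^sup>2 = T\<^sup>2 + 15 * y\<^sup>2] (mod 15)" by (simp add: cong_iff_dvd_diff)
    ultimately show ?thesis unfolding eq by (simp add: cong_def)
  qed
  then have sq: "((T mod 15) * (T mod 15)) mod 15 = 4" by (simp add: power2_eq_square mod_mult_eq)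
  define r where "r = T mod 15"
  have "0 \<le> r" "r < 15" by (simp_all add: r_def)
  then have "r = 0 \<or> r = 1 \<or> r = 2 \<or> r = 3 \<or> r = 4 \<or> r = 5 \<or> r = 6 \<or> r = 7 \<or> r = 8 \<or> r = 9
     \<or> r = 10 \<or> r = 11 \<or> r = 12 \<or> r = 13 \<or> r = 14" by presburger
  then have "r = 2 \<or> r = 7 \<or> r = 8 \<or> r = 13" using sq unfolding r_def[symmetric] by (elim disjE) simp_all
  moreover have "r \<noteq> 2" using no_trace_2[OF q _ eq cop] by (auto simp: r_def)
  moreover have "r \<noteq> 13"
  proof
    assume "r = 13"
    then have "(- T) mod 15 = 2" by (simp add: r_def zmod_zminus1_eq_if)
    then show False using no_trace_2[OF q, of "- T" y] eq cop by simp
  qed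
  ultimately show ?thesis by (auto simp: r_def)
qed

text \<open>At a primitive 15th root of unity \<open>kappa\<close> takes the value \<open>\<omega> \<tau>\<close> with \<open>\<omega>\<^sup>2 + \<omega> + 1 = 0\<close> and
  \<open>\<tau>\<^sup>2 + \<tau> - 1 = 0\<close>; the primes \<open>p \<equiv> 4\<close> split completely in the field that it generates.\<close>

definition kappa :: "int poly" where "kappa = [:0, 0, 1, 0, 0, 0, 0, 0, 1:]"

lemma theta_conj_2:
  assumes z: "z \<in> Z15"
  shows "ev theta (z ^ 2) = ev theta z" "ev theta (z ^ 4) = ev theta z" "ev theta (z ^ 8) = ev theta z"
  using Z15_power_mod[OF z, of 16] Z15_power_mod[OF z, of 32] Z15_power_mod[OF z, of 64]
  by (simp_all add: ev_theta power_mult[symmetric])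

lemma nm15_theta: "nm15 (theta - [:r:]) = (r\<^sup>2 - r + 4) ^ 4"
proof -
  obtain z where z: "z \<in> Z15" using n15.some_Z by blast
  define t where "t = ev theta z"
  have z7: "z ^ 7 \<in> Z15" using n15.bij[OF z] by (auto simp: bij_betw_def)
  have t7: "ev theta (z ^ 7) = 1 - t" using theta_conj(1)[OF z] by (simp add: t_def)
  have "ev theta (z ^ 14) = 1 - t" "ev theta (z ^ 13) = 1 - t" "ev theta (z ^ 11) = 1 - t"
    using theta_conj_2[OF z7] t7 Z15_power_mod[OF z, of 28] Z15_power_mod[OF z, of 56]
    by (simp_all add: power_mult[symmetric])
  then have "of_int (nm15 (theta - [:r:])) = ((t - of_int r) * ((1 - t) - of_int r)) ^ 4"
    using n15.N_eq_hs[OF z, of "theta - [:r:]"] theta_conj_2[OF z] t7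
    by (simp add: t_def[symmetric] power_mult_distrib eval_nat_numeral mult_ac)
  also have "(t - of_int r) * ((1 - t) - of_int r) = (t - t * t) + of_int (r\<^sup>2 - r)"
    by (simp add: algebra_simps power2_eq_square)
  also have "\<dots> = of_int (r\<^sup>2 - r + 4)" using theta_conj(2)[OF z] by (simp add: t_def)
  finally have "of_int (nm15 (theta - [:r:])) = (of_int ((r\<^sup>2 - r + 4) ^ 4) :: complex)" by simp
  then show ?thesis by (simp only: of_int_eq_iff)
qed

text \<open>\<open>kappa\<close> is invariant under x to x^4, so its four conjugates occur twice
  each. They form two pairs with product -1 and with the sums t and 1 - t.\<close>

lemma nm15_kappa: "nm15 (kappa - [:r:]) = (r ^ 4 - r ^ 3 + 2 * r\<^sup>2 + r + 1)\<^sup>2"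
proof -
  obtain z where z: "z \<in> Z15" using n15.some_Z by blast
  have evk: "ev kappa x = x ^ 2 + x ^ 8" for x by (simp add: kappa_def algebra_simps eval_nat_numeral)
  have pm: "z ^ k = z ^ (k mod 15)" for k using Z15_power_mod[OF z] .
  define k1 k2 k3 k4 where "k1 = z ^ 2 + z ^ 8" and "k2 = z + z ^ 4" and "k3 = z ^ 11 + z ^ 14" and "k4 = z ^ 7 + z ^ 13"
  have ks: "ev kappa z = k1" "ev kappa (z ^ 2) = k2" "ev kappa (z ^ 4) = k1" "ev kappa (z ^ 8) = k2"
    "ev kappa (z ^ 7) = k3" "ev kappa (z ^ 11) = k4" "ev kappa (z ^ 13) = k3" "ev kappa (z ^ 14) = k4"
  proof -
    have "z ^ 16 = z ^ 1" "z ^ 32 = z ^ 2" "z ^ 64 = z ^ 4" "z ^ 56 = z ^ 11" "z ^ 22 = z ^ 7" "z ^ 88 = z ^ 13"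
      "z ^ 26 = z ^ 11" "z ^ 104 = z ^ 14" "z ^ 28 = z ^ 13" "z ^ 112 = z ^ 7"
      by (subst pm, simp)+
    note r = this[unfolded power_one_right]
    show "ev kappa z = k1" "ev kappa (z ^ 2) = k2" "ev kappa (z ^ 4) = k1" "ev kappa (z ^ 8) = k2"
      "ev kappa (z ^ 7) = k3" "ev kappa (z ^ 11) = k4" "ev kappa (z ^ 13) = k3" "ev kappa (z ^ 14) = k4"
      by (simp_all add: evk k1_def k2_def k3_def k4_def power_mult[symmetric] r)
  qed
  define t where "t = ev theta z"
  have s12: "k1 + k2 = t" by (simp add: k1_def k2_def t_def ev_theta)
  have s34: "k3 + k4 = 1 - t"
    using theta_conj(1)[OF z] pm[of 28] pm[of 56]
    by (simp add: k3_def k4_def t_def ev_theta power_mult[symmetric] algebra_simps)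
  have z3: "z ^ 3 \<in> Z5" using Z15_power_neq_1[OF z, of 3] power_power_1[of z 15 3] z
    by (simp add: Z5_iff Z15_iff power_mult[symmetric])
  then have sum: "1 + z ^ 3 + z ^ 6 + z ^ 9 + z ^ 12 = 0"
    by (simp add: Z5_def Phi5_def algebra_simps power_mult[symmetric] power_add[symmetric])
  have p12: "k1 * k2 = - 1"
  proof -
    have "k1 * k2 = z ^ 3 + z ^ 6 + z ^ 9 + z ^ 12"
      by (simp add: k1_def k2_def algebra_simps eval_nat_numeral)
    also have "\<dots> = (1 + z ^ 3 + z ^ 6 + z ^ 9 + z ^ 12) - 1" by simp
    finally show ?thesis unfolding sum by simp
  qed
  have p34: "k3 * k4 = - 1"
  proof -
    have "k3 * k4 = z ^ 18 + z ^ 24 + z ^ 21 + z ^ 27"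
      by (simp add: k3_def k4_def algebra_simps power_add[symmetric])
    also have "\<dots> = (1 + z ^ 3 + z ^ 6 + z ^ 9 + z ^ 12) - 1"
      using pm[of 18] pm[of 24] pm[of 21] pm[of 27] by simp
    finally show ?thesis unfolding sum by simp
  qed
  define R :: complex where "R = of_int r"
  have "of_int (nm15 (kappa - [:r:])) = (((k1 - R) * (k2 - R)) * ((k3 - R) * (k4 - R)))\<^sup>2"
    using n15.N_eq_hs[OF z, of "kappa - [:r:]"] ks
    by (simp add: R_def power2_eq_square mult_ac)
  also have "(k1 - R) * (k2 - R) = k1 * k2 - R * (k1 + k2) + R * R" by (simp add: algebra_simps)
  also have "(k3 - R) * (k4 - R) = k3 * k4 - R * (k3 + k4) + R * R" by (simp add: algebra_simps)
  also have "(k1 * k2 - R * (k1 + k2) + R * R) * (k3 * k4 - R * (k3 + k4) + R * R)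
      = R ^ 4 - R ^ 3 - 2 * R\<^sup>2 + R + 1 + R * R * (t - t * t)"
    unfolding s12 s34 p12 p34 by (simp add: algebra_simps power2_eq_square power3_eq_cube power4_eq_xxxx)
  also have "t - t * t = 4" using theta_conj(2)[OF z] by (simp add: t_def)
  also have "R ^ 4 - R ^ 3 - 2 * R\<^sup>2 + R + 1 + R * R * 4 = of_int (r ^ 4 - r ^ 3 + 2 * r\<^sup>2 + r + 1)"
    by (simp add: R_def power2_eq_square)
  finally have "of_int (nm15 (kappa - [:r:])) = (of_int ((r ^ 4 - r ^ 3 + 2 * r\<^sup>2 + r + 1)\<^sup>2) :: complex)" by simp
  then show ?thesis by (simp only: of_int_eq_iff)
qed

lemma prime_not_dvd_coprime_15:
  assumes "prime p" "p mod 15 \<in> {1, 2, 4, 7, 8, 11, 13, 14}"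
  shows "coprime (int p) 15" "\<not> int p dvd 15"
proof -
  have "\<not> 3 dvd int p" "\<not> 5 dvd int p"
  proof -
    have "p mod 15 mod 3 \<noteq> 0" "p mod 15 mod 5 \<noteq> 0" using assms(2) by (elim insertE emptyE; simp)+
    then have "int p mod 3 \<noteq> 0" "int p mod 5 \<noteq> 0" unfolding int_mod_eq by (simp_all only: of_nat_eq_0_iff not_False_eq_True)
    then show "\<not> 3 dvd int p" "\<not> 5 dvd int p" by (metis dvd_imp_mod_0)+
  qed
  then show "coprime (int p) 15" by (simp add: coprime_15_iff)
  then show "\<not> int p dvd 15"
    using assms(1) by (metis coprime_absorb_left not_prime_unit prime_nat_int_transfer)
qed

lemma dvd_minus_1_of_mod_15:
  assumes "p mod 15 mod d = (1::nat)" "d dvd 15"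
  shows "d dvd p - 1"
proof -
  have "p mod d = 1" using assms by (simp add: mod_mod_cancel)
  then show ?thesis using dvd_minus_mod[of d p] by simp
qed

text \<open>A divisor above \<open>p\<close> is cut out of \<open>kappa - [:x:]\<close> for an exact
  root \<open>x\<close> of the quartic modulo \<open>p\<close>, so its norm is at most p^2; norm p
  is excluded because p is not 1 modulo 15.\<close>

lemma char_neg_norm_4:
  assumes p: "prime p" "p mod 15 = 4"
  shows "\<exists>G. nm15 G = (int p)\<^sup>2 \<and> char_neg G"
proof -
  have pp: "prime (int p)" using p by simp
  have p2: "2 < p" "odd p" using prime_odd_mod_15[OF p(1)] p(2) by auto
  have c15: "coprime (int p) 15" "\<not> int p dvd 15" using prime_not_dvd_coprime_15[of p] p by auto
  obtain t where t: "int p dvd t\<^sup>2 + t - 1" using tau_root_exists[OF p] by blast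
  have "3 dvd p - 1" using dvd_minus_1_of_mod_15[of p 3] p(2) by simp
  then obtain r where "int p dvd poly Phi3 r" using Phi3_root_exists p(1) by blast
  then have r: "int p dvd r\<^sup>2 + r + 1" by (simp add: Phi3_def power2_eq_square algebra_simps)
  define f :: "int poly" where "f = [:1, 1, 2, -1, 1:]"
  have f: "poly f x = x ^ 4 - x ^ 3 + 2 * x\<^sup>2 + x + 1" for x
    by (simp add: f_def algebra_simps eval_nat_numeral)
  \<comment> \<open>This identity puts the quartic in the ideal of the two quadratics: the product
    of a root of each is a root of \<open>f\<close> modulo \<open>p\<close>.\<close>
  have "poly f (r * t) = (r\<^sup>2 + r + 1) * (t ^ 4 * (r * (r - 1)) - t ^ 3 * (r - 1) + 2 * t\<^sup>2)
      + (t\<^sup>2 + t - 1) * (r * (t\<^sup>2 - t) - (t + 1))"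
    unfolding f by (simp add: algebra_simps eval_nat_numeral)
  then have "int p dvd poly f (r * t)" using r t by simp
  moreover have "[:28, -25, 12:] * f + [:2, -11, 7, -3:] * pderiv f = [:30:]"
    by (simp add: f_def pderiv_pCons)
  moreover have "\<not> int p dvd 30"
  proof
    assume "int p dvd 30"
    then have "int p dvd 2 * 15" by simp
    then have "int p dvd 2" using c15 pp prime_dvd_mult_iff by blast
    then have "int p \<le> 2" by (rule zdvd_imp_le) simp
    then show False using p2 by simp
  qed
  ultimately obtain x where x: "int p dvd poly f x" "\<not> (int p)\<^sup>2 dvd poly f x"
    using exact_root[OF pp] by blast
  obtain c where c: "poly f x = int p * c" using x(1) by (rule dvdE)
  have nc: "\<not> int p dvd c" using x(2) unfolding c by (auto simp: power2_eq_square)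
  have N: "nm15 (kappa - [:x:]) = (int p)\<^sup>2 * c\<^sup>2" unfolding nm15_kappa f[symmetric] c by (simp add: power_mult_distrib)
  have "int p dvd nm15 (kappa - [:x:])" unfolding N by (simp add: power2_eq_square)
  moreover have "\<not> int p ^ Suc 2 dvd nm15 (kappa - [:x:])"
  proof
    assume "int p ^ Suc 2 dvd nm15 (kappa - [:x:])"
    then have "(int p)\<^sup>2 * int p dvd (int p)\<^sup>2 * c\<^sup>2" unfolding N by (simp only: power_Suc2)
    moreover have "(int p)\<^sup>2 \<noteq> 0" using p2 by simp
    ultimately have "int p dvd c\<^sup>2" unfolding dvd_mult_cancel_left by blast
    then show False using nc pp prime_dvd_power by blast
  qed
  ultimately obtain G j where G: "nm15 G = int p ^ j" "1 \<le> j" "j \<le> 2"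
    using e15.prime_divisor_bounded[OF p(1)] by blast
  have "[int p ^ j = 1] (mod 15)" using e15.N_cong_1[of G] G(1) c15 by simp
  then have "j \<noteq> 1" using int_mod_eq(1)[of p] p(2) by (auto simp: cong_def)
  then have j: "j = 2" using G by simp
  obtain a b where ab: "nm15 G = a\<^sup>2 + a * b + 4 * b\<^sup>2" "(2 * a + b)\<^sup>2 + 15 * b\<^sup>2 = 4 * nm15 G"
      "char_neg G \<longleftrightarrow> (2 * a + b) mod 15 \<in> {7, 8}"
    using char_neg_trace[of G] by blast
  define T where "T = 2 * a + b"
  have eq: "T\<^sup>2 + 15 * b\<^sup>2 = 4 * (int p)\<^sup>2" using ab(2) G(1) j by (simp add: T_def)
  have p4: "int p mod 15 = 4" using int_mod_eq(1)[of p] p(2) by simp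
  have "T mod 15 \<in> {7, 8}"
  proof (cases "int p dvd T")
    case False
    then have "coprime T (int p)" using prime_imp_coprime[OF pp] by (simp add: coprime_commute)
    then show ?thesis using trace_7_or_8[OF _ _ p4 eq] p2 by simp
  next
    case True
    \<comment> \<open>In this case the trace is 2p or -2p, and 2p is 8 modulo 15.\<close>
    then obtain T' where T': "T = int p * T'" by (rule dvdE)
    have "15 * b\<^sup>2 = 4 * (int p)\<^sup>2 - T\<^sup>2" using eq by simp
    then have "int p dvd 15 * b\<^sup>2" unfolding T' by (simp add: power2_eq_square)
    then have "int p dvd b" using c15 pp by (metis prime_dvd_mult_iff prime_dvd_power)
    then obtain b' where b': "b = int p * b'" by (rule dvdE)
    have "(int p)\<^sup>2 * (T'\<^sup>2 + 15 * b'\<^sup>2) = (int p)\<^sup>2 * 4"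
      using eq unfolding T' b' by (simp add: power_mult_distrib algebra_simps)
    then have "T'\<^sup>2 + 15 * b'\<^sup>2 = 4" using p2 by simp
    then have "T' = 2 \<or> T' = - 2" using trace_of_norm_1 by blast
    then have "[T = 4 * 2] (mod 15) \<or> [T = 4 * (- 2)] (mod 15)"
      unfolding T' using p4 cong_scalar_right[of "int p" 4 15] by (auto simp: cong_def)
    then show ?thesis by (auto simp: cong_def)
  qed
  then show ?thesis using ab(3) G(1) j by (auto simp: T_def)
qed

lemma theta_independent:
  assumes "\<And>z. z \<in> Z15 \<Longrightarrow> of_int u + of_int v * ev theta z = 0"
  shows "v = 0"
proof -
  obtain z where z: "z \<in> Z15" using n15.some_Z by blast
  define t where "t = ev theta z"
  have z7: "z ^ 7 \<in> Z15" using n15.bij[OF z] by (auto simp: bij_betw_def)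
  have "of_int u + of_int v * t = 0" "of_int u + of_int v * (1 - t) = 0"
    using assms[OF z] assms[OF z7] theta_conj(1)[OF z] by (simp_all add: t_def)
  then have "(of_int u + of_int v * t) - (of_int u + of_int v * (1 - t)) = 0" by simp
  then have "of_int v * (2 * t - 1) = 0" by (simp add: algebra_simps)
  moreover have "(2 * t - 1) * (2 * t - 1) = - 15"
  proof -
    have "(2 * t - 1) * (2 * t - 1) = 4 * (t * t) - 4 * t + 1" by (simp add: algebra_simps)
    then show ?thesis using theta_conj(2)[OF z] by (simp add: t_def)
  qed
  then have "2 * t - 1 \<noteq> 0" by auto
  ultimately show ?thesis by (metis mult_eq_0_iff of_int_eq_0_iff)
qed

lemma fourth_powers_mod_15:
  assumes "p mod 15 = 2 \<or> p mod 15 = 8" "[int p ^ j = 1] (mod 15)" "1 \<le> j" "j \<le> 4"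
  shows "j = 4"
proof -
  have "j = 1 \<or> j = 2 \<or> j = 3 \<or> j = 4" using assms(3,4) by presburger
  moreover have "int p ^ j mod 15 = (int (p mod 15)) ^ j mod 15"
    unfolding int_mod_eq(1)[symmetric] by (simp only: power_mod)
  then have "(int (p mod 15)) ^ j mod 15 = 1" using assms(2) by (simp add: cong_def)
  ultimately show ?thesis using assms(1) by (elim disjE) simp_all
qed

text \<open>The norm of \<open>theta - [:x:]\<close> contains exactly p^4, and 2 and 8 have order 4
  modulo 15, so a divisor above \<open>p\<close> has norm p^4. For odd \<open>p\<close> the trace
  argument then runs with q = p^2, which is 4 modulo 15, once the trace is known to be prime to
  \<open>p\<close>.\<close>

lemma char_neg_norm_2_8:
  assumes p: "prime p" "p mod 15 = 2 \<or> p mod 15 = 8"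
  shows "\<exists>G. nm15 G = int p ^ 4 \<and> char_neg G"
proof -
  have pp: "prime (int p)" using p by simp
  have pos: "0 < p" using prime_gt_0_nat[OF p(1)] .
  have c15: "coprime (int p) 15" "\<not> int p dvd 15" using prime_not_dvd_coprime_15[of p] p by auto
  obtain r where r: "int p dvd r\<^sup>2 - r + 4" using theta_root_exists[OF p] by blast
  define f :: "int poly" where "f = [:4, -1, 1:]"
  have f: "poly f x = x\<^sup>2 - x + 4" for x by (simp add: f_def algebra_simps power2_eq_square)
  have "[:4:] * f + [:1, -2:] * pderiv f = [:15:]" by (simp add: f_def pderiv_pCons)
  then obtain x where x: "int p dvd poly f x" "\<not> (int p)\<^sup>2 dvd poly f x"
    using exact_root[OF pp, of f r] r c15 unfolding f by blast
  obtain c where c: "poly f x = int p * c" using x(1) by (rule dvdE)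
  have nc: "\<not> int p dvd c" using x(2) unfolding c by (auto simp: power2_eq_square)
  define E where "E = theta - [:x:]"
  have N: "nm15 E = int p ^ 4 * c ^ 4"
    unfolding E_def nm15_theta f[symmetric] c by (simp add: power_mult_distrib)
  have "int p dvd nm15 E" unfolding N by (simp add: eval_nat_numeral)
  moreover have "\<not> int p ^ Suc 4 dvd nm15 E"
  proof
    assume "int p ^ Suc 4 dvd nm15 E"
    then have "int p ^ 4 * int p dvd int p ^ 4 * c ^ 4" unfolding N by (simp only: power_Suc2)
    moreover have "int p ^ 4 \<noteq> 0" using pos by simp
    ultimately have "int p dvd c ^ 4" unfolding dvd_mult_cancel_left by blast
    then show False using nc pp prime_dvd_power by blast
  qed
  ultimately obtain G H j where G: "Phi15 dvd E - G * H" "nm15 G = int p ^ j" "1 \<le> j" "j \<le> 4"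
    using e15.prime_divisor_bounded[OF p(1), of E 4] by blast
  have "[int p ^ j = 1] (mod 15)" using e15.N_cong_1[of G] G(2) c15 by simp
  then have j: "j = 4" using fourth_powers_mod_15 p(2) G(3,4) by blast
  obtain a b where ab: "\<forall>z\<in>Z15. ev G z * ev G (z ^ 2) * ev G (z ^ 4) * ev G (z ^ 8) = of_int a + of_int b * ev theta z"
      "nm15 G = a\<^sup>2 + a * b + 4 * b\<^sup>2" "(2 * a + b)\<^sup>2 + 15 * b\<^sup>2 = 4 * nm15 G"
      "char_neg G \<longleftrightarrow> (2 * a + b) mod 15 \<in> {7, 8}"
    using char_neg_trace[of G] by blast
  \<comment> \<open>Otherwise \<open>p\<close> would divide (theta - x)^4. Modulo \<open>p\<close>
    the square of theta - x is d (theta - x) with d = 1 - 2x, so the coefficient of theta in the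
    fourth power is d^3, whereas d^2 is -15.\<close>
  have primitive: "\<not> (int p dvd a \<and> int p dvd b)"
  proof
    assume "int p dvd a \<and> int p dvd b"
    then obtain a' b' where a': "a = int p * a'" and b': "b = int p * b'" by (auto elim!: dvdE)
    obtain c' d' where cd: "\<forall>z\<in>Z15. ev H z * ev H (z ^ 2) * ev H (z ^ 4) * ev H (z ^ 8) = of_int c' + of_int d' * ev theta z"
      using quadratic_norm[of H] by blast
    define d n where "d = 1 - 2 * x" and "n = x\<^sup>2 - x + 4"
    \<comment> \<open>u + v theta is the difference of two expressions for (theta - x)^4: the
      expanded power and the product of the relative norms of \<open>G\<close> and
      \<open>H\<close>.\<close>
    define u where "u = - (d ^ 3 * x + n * d\<^sup>2 - n * (d * x) * 2 - n\<^sup>2) - int p * (a' * c' - 4 * b' * d')"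
    define v where "v = d ^ 3 - 2 * n * d - int p * (a' * d' + b' * c' + b' * d')"
    have "of_int u + of_int v * ev theta z = 0" if z: "z \<in> Z15" for z
    proof -
      define t where "t = ev theta z"
      define X :: complex where "X = of_int x"
      have tt: "t * t = t - 4" using theta_conj(2)[OF z] by (simp add: t_def)
      have mem: "z ^ 2 \<in> Z15" "z ^ 4 \<in> Z15" "z ^ 8 \<in> Z15" using n15.bij[OF z] by (auto simp: bij_betw_def)
      have EGH: "ev E y = ev G y * ev H y" if "y \<in> Z15" for y
        using G(1) that by (auto simp: n15.Phi_dvd_iff)
      have Ez: "ev E z = t - X" "ev E (z ^ 2) = t - X" "ev E (z ^ 4) = t - X" "ev E (z ^ 8) = t - X"
        using theta_conj_2[OF z] by (simp_all add: E_def t_def X_def)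
      have "(t - X) * (t - X) * (t - X) * (t - X) = ev E z * ev E (z ^ 2) * ev E (z ^ 4) * ev E (z ^ 8)"
        unfolding Ez ..
      also have "\<dots> = (ev G z * ev G (z ^ 2) * ev G (z ^ 4) * ev G (z ^ 8)) *
          (ev H z * ev H (z ^ 2) * ev H (z ^ 4) * ev H (z ^ 8))"
        using EGH z mem by (simp add: mult_ac)
      also have "\<dots> = (of_int a + of_int b * t) * (of_int c' + of_int d' * t)"
        using ab(1) cd z by (simp add: t_def)
      also have "\<dots> = of_int a * of_int c' + (of_int a * of_int d' + of_int b * of_int c') * t + of_int b * of_int d' * (t * t)"
        by (simp add: algebra_simps)
      finally have 1: "(t - X) * (t - X) * (t - X) * (t - X)
          = of_int (a * c' - 4 * b * d') + of_int (a * d' + b * c' + b * d') * t"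
        unfolding tt by (simp add: algebra_simps)
      define D M where "D = 1 - 2 * X" and "M = X * X - X + 4"
      have 2: "(t - X) * (t - X) = D * (t - X) - M"
      proof -
        have "(t - X) * (t - X) = t * t - 2 * X * t + X * X" by (simp add: algebra_simps)
        then show ?thesis unfolding tt D_def M_def by (simp add: algebra_simps)
      qed
      have "(t - X) * (t - X) * (t - X) * (t - X) = ((t - X) * (t - X)) * ((t - X) * (t - X))"
        by (simp only: mult.assoc)
      also have "\<dots> = (D * (t - X) - M) * (D * (t - X) - M)" unfolding 2 ..
      also have "\<dots> = D * D * ((t - X) * (t - X)) - 2 * D * M * (t - X) + M * M"
        by (simp add: algebra_simps)
      also have "\<dots> = D * D * (D * (t - X) - M) - 2 * D * M * (t - X) + M * M"
        unfolding 2 ..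
      finally have 3: "(t - X) * (t - X) * (t - X) * (t - X) = D * D * (D * (t - X) - M) - 2 * D * M * (t - X) + M * M" .
      have DM: "D = of_int d" "M = of_int n" by (simp_all add: D_def M_def d_def n_def X_def power2_eq_square)
      have "of_int u + of_int v * t =
         (D * D * (D * (t - X) - M) - 2 * D * M * (t - X) + M * M)
         - (of_int (a * c' - 4 * b * d') + of_int (a * d' + b * c' + b * d') * t)"
        unfolding DM a' b' u_def v_def X_def by (simp add: algebra_simps power2_eq_square power3_eq_cube)
      then show ?thesis using 1 3 by (simp add: t_def)
    qed
    then have "v = 0" by (rule theta_independent)
    then have "d ^ 3 - 2 * n * d = int p * (a' * d' + b' * c' + b' * d')" by (simp add: v_def)
    then have "int p dvd d ^ 3 - 2 * n * d" by simp
    moreover have pn: "int p dvd n" using x(1) by (simp add: f n_def)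
    then have "int p dvd 2 * n * d" by simp
    ultimately have "int p dvd d ^ 3" using dvd_diffD1 dvd_diffD by (metis dvd_add diff_add_cancel)
    then have "int p dvd d" using pp prime_dvd_power by blast
    then have "int p dvd d * d" by simp
    moreover have "d * d = 4 * n - 15" by (simp add: d_def n_def power2_eq_square algebra_simps)
    ultimately have "int p dvd 4 * n - 15" by simp
    from dvd_diff[OF dvd_mult[OF pn, of 4] this] show False using c15 by simp
  qed
  define T where "T = 2 * a + b"
  have eq: "T\<^sup>2 + 15 * b\<^sup>2 = 4 * (int p ^ 2)\<^sup>2" using ab(3) G(2) j by (simp add: T_def power_mult[symmetric])
  have "T mod 15 \<in> {7, 8}"
  proof (cases "p = 2")
    case True
    \<comment> \<open>The general argument needs odd q, but here \<open>b\<close> is odd and below 3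
      in absolute value, so T^2 = 64 - 15 = 49.\<close>
    have e64: "T\<^sup>2 + 15 * b\<^sup>2 = 64" using eq True by simp
    have odd: "odd b"
    proof
      assume "even b"
      then obtain k where k: "b = 2 * k" by (rule evenE)
      have "a\<^sup>2 + a * b + 4 * b\<^sup>2 = 16" using ab(2) G(2) j True by simp
      then have "a\<^sup>2 = 2 * (8 - a * k - 2 * b\<^sup>2)" by (simp add: k algebra_simps)
      then have "even (a\<^sup>2)" by simp
      then show False using primitive k True by auto
    qed
    have "b\<^sup>2 < 9" using e64 zero_le_power2[of T] by linarith
    then have "b\<^sup>2 < 3\<^sup>2" by simp
    then have "\<bar>b\<bar> < 3" using abs_square_less_1 power2_less_imp_less[of "\<bar>b\<bar>" 3] by simp
    then have "b = - 1 \<or> b = 1" using odd by presburger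
    then have "b\<^sup>2 = 1" by auto
    then have "T\<^sup>2 = 7\<^sup>2" using e64 by simp
    then have "T = 7 \<or> T = - 7" by (simp only: power2_eq_iff)
    then show ?thesis by auto
  next
    case False
    then have odd: "odd p" using prime_odd_nat[OF p(1)] prime_ge_2_nat[OF p(1)] by simp
    have nd: "\<not> int p dvd T"
    proof
      assume pT: "int p dvd T"
      have "15 * b\<^sup>2 = 4 * (int p ^ 2)\<^sup>2 - T\<^sup>2" using eq by simp
      moreover have "int p dvd 4 * (int p ^ 2)\<^sup>2 - T\<^sup>2" using pT by (intro dvd_diff) (auto simp: power2_eq_square)
      ultimately have "int p dvd 15 * b\<^sup>2" by simp
      then have b: "int p dvd b" using c15 pp by (metis prime_dvd_mult_iff prime_dvd_power)
      then have "int p dvd T - b" using pT by (rule dvd_diff[rotated])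
      then have "int p dvd 2 * a" by (simp add: T_def)
      then have "int p dvd 2 * (2 * a)" by (rule dvd_mult)
      moreover have "odd (int p)" using odd by simp
      ultimately have "int p dvd a" using odd_dvd_4 by blast
      then show False using b primitive by blast
    qed
    then have "coprime T (int p ^ 2)" using prime_imp_coprime[OF pp] by (simp add: coprime_commute)
    moreover have "(int p ^ 2) mod 15 = 4"
    proof -
      have "(int p)\<^sup>2 mod 15 = (int (p mod 15))\<^sup>2 mod 15"
        unfolding int_mod_eq(1)[symmetric] by (simp only: power_mod)
      then show ?thesis using p(2) by auto
    qed
    ultimately show ?thesis using trace_7_or_8[of "int p ^ 2" T b] eq odd pos by simp
  qed
  then show ?thesis using ab(4) G(2) j by (auto simp: T_def)
qed

section \<open>Triviality on inert primes, multiplicativity, and good primes\<close>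

text \<open>An inert \<open>p\<close> can be divided out of \<open>a\<close> and \<open>b\<close>
  again and again. Each division changes the trace by the factor \<open>p\<close>, which is -1
  modulo 15, and the last trace is 2 or -2.\<close>

lemma inert_trace:
  assumes p: "prime p" "p mod 15 = 14" and "a\<^sup>2 + a * b + 4 * b\<^sup>2 = int p ^ j"
  shows "(2 * a + b) mod 15 \<in> {2, 13}"
  using assms(3)
proof (induction j arbitrary: a b rule: less_induct)
  case (less j)
  show ?case
  proof (cases "j = 0")
    case True
    have "(2 * a + b)\<^sup>2 + 15 * b\<^sup>2 = 4 * (a\<^sup>2 + a * b + 4 * b\<^sup>2)" by (simp add: power2_eq_square algebra_simps)
    then have "(2 * a + b)\<^sup>2 + 15 * b\<^sup>2 = 4" using less.prems True by simp
    then have "2 * a + b = 2 \<or> 2 * a + b = - 2" using trace_of_norm_1 by blast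
    then show ?thesis by auto
  next
    case False
    have p1: "1 < int p" using prime_gt_1_nat[OF p(1)] by simp
    have "int p dvd a\<^sup>2 + a * b + 4 * b\<^sup>2" unfolding less.prems using False by (simp add: dvd_power)
    then obtain a' b' where ab: "a = int p * a'" "b = int p * b'"
      using inert_14[OF p] by (metis dvdE)
    have eq: "(int p)\<^sup>2 * (a'\<^sup>2 + a' * b' + 4 * b'\<^sup>2) = int p ^ j"
      using less.prems unfolding ab by (simp add: power2_eq_square algebra_simps)
    have "j \<noteq> 1"
    proof
      assume "j = 1"
      then have "int p * (int p * (a'\<^sup>2 + a' * b' + 4 * b'\<^sup>2)) = int p * 1" using eq by (simp add: power2_eq_square)
      then have "int p * (a'\<^sup>2 + a' * b' + 4 * b'\<^sup>2) = 1" using p1 by (simp only: mult_cancel_left) simp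
      then have "int p dvd 1" by (metis dvd_triv_left)
      then show False using p1 by simp
    qed
    then have "j = 2 + (j - 2)" using False by simp
    then have "int p ^ j = (int p)\<^sup>2 * int p ^ (j - 2)" by (metis power_add)
    then have "a'\<^sup>2 + a' * b' + 4 * b'\<^sup>2 = int p ^ (j - 2)" using eq p1 by simp
    then have "(2 * a' + b') mod 15 \<in> {2, 13}" using less.IH[of "j - 2"] False by simp
    then have "[2 * a' + b' = 2] (mod 15) \<or> [2 * a' + b' = 13] (mod 15)" by (simp add: cong_def)
    moreover have "[int p = 14] (mod 15)" using int_mod_eq(1)[of p] p(2) by (simp add: cong_def)
    ultimately have "[int p * (2 * a' + b') = 14 * 2] (mod 15) \<or> [int p * (2 * a' + b') = 14 * 13] (mod 15)"
      using cong_mult by blast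
    moreover have "2 * a + b = int p * (2 * a' + b')" by (simp add: ab algebra_simps)
    ultimately show ?thesis by (auto simp: cong_def)
  qed
qed

lemma not_char_neg_14: "prime p \<Longrightarrow> p mod 15 = 14 \<Longrightarrow> nm15 G = int p ^ j \<Longrightarrow> \<not> char_neg G"
proof -
  assume p: "prime p" "p mod 15 = 14" and N: "nm15 G = int p ^ j"
  obtain a b where ab: "nm15 G = a\<^sup>2 + a * b + 4 * b\<^sup>2" "char_neg G \<longleftrightarrow> (2 * a + b) mod 15 \<in> {7, 8}"
    using char_neg_trace[of G] by blast
  then show ?thesis using inert_trace[OF p, of a b j] N by auto
qed

lemma not_char_neg_unit: "nm15 G = 1 \<Longrightarrow> \<not> char_neg G"
proof -
  assume N: "nm15 G = 1"
  obtain a b where ab: "(2 * a + b)\<^sup>2 + 15 * b\<^sup>2 = 4 * nm15 G" "char_neg G \<longleftrightarrow> (2 * a + b) mod 15 \<in> {7, 8}"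
    using char_neg_trace[of G] by blast
  have "(2 * a + b)\<^sup>2 + 15 * b\<^sup>2 = 4" using ab(1) N by simp
  then have "2 * a + b = 2 \<or> 2 * a + b = - 2" using trace_of_norm_1 by blast
  then show ?thesis using ab(2) by auto
qed

lemma icong_5_Phi3_of_Phi15: "Phi15 dvd A - B \<Longrightarrow> icong 5 Phi3 A B"
proof -
  assume "Phi15 dvd A - B"
  then obtain K where K: "A - B = Phi15 * K" by (rule dvdE)
  have ring: "(smult 5 X + P * Y) * K = smult 5 (X * K) + P * (Y * K)" for X P Y :: "int poly"
    by (simp add: distrib_right mult.assoc)
  show ?thesis
    by (rule icongI) (unfold K Phi15_mod_Phi3, rule ring)
qed

lemma char_neg_cong: "Phi15 dvd A - B \<Longrightarrow> char_neg A \<longleftrightarrow> char_neg B"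
proof -
  assume AB: "Phi15 dvd A - B"
  have "nm5 A mod 3 = nm5 B mod 3"
    using n5.N_icong[OF icong_3_Phi5_of_Phi15[OF AB]] by (simp add: cong_def)
  moreover have "(nm3 A)\<^sup>2 mod 5 = (nm3 B)\<^sup>2 mod 5"
    using cong_pow[OF n3.N_icong[OF icong_5_Phi3_of_Phi15[OF AB]], of 2] by (simp add: cong_def)
  ultimately show ?thesis by (simp add: char_neg_def cong_def)
qed

text \<open>Both characters are multiplicative. A product of character -1 has invertible residues,
  so failure of \<open>char_neg G\<close> means that \<open>G\<close> has character 1.\<close>

lemma char_neg_mult:
  assumes "char_neg (G * F)" "\<not> char_neg G"
  shows "char_neg F"
proof -
  define x y u v where "x = nm5 G mod 3" and "y = nm5 F mod 3" and "u = (nm3 G)\<^sup>2 mod 5" and "v = (nm3 F)\<^sup>2 mod 5"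
  have sq: "n\<^sup>2 mod 5 = 0 \<or> n\<^sup>2 mod 5 = 1 \<or> n\<^sup>2 mod 5 = 4" for n :: int
  proof -
    have "n mod 5 \<in> set [0, 1, 2, 3, 4]" by (rule mod_5_cases)
    moreover have "n\<^sup>2 mod 5 = (n mod 5)\<^sup>2 mod 5" by (simp add: power_mod)
    ultimately show ?thesis by auto
  qed
  have xy: "x = 0 \<or> x = 1 \<or> x = 2" "y = 0 \<or> y = 1 \<or> y = 2" unfolding x_def y_def by presburger+
  have uv: "u = 0 \<or> u = 1 \<or> u = 4" "v = 0 \<or> v = 1 \<or> v = 4" unfolding u_def v_def by (rule sq)+
  have m: "char_neg F \<longleftrightarrow> y = 1 \<and> v = 4 \<or> y = 2 \<and> v = 1" "char_neg G \<longleftrightarrow> x = 1 \<and> u = 4 \<or> x = 2 \<and> u = 1"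
    by (simp_all add: char_neg_def cong_def x_def y_def u_def v_def)
  have "nm5 (G * F) mod 3 = x * y mod 3" by (simp add: x_def y_def mod_mult_eq)
  moreover have "(nm3 (G * F))\<^sup>2 mod 5 = u * v mod 5" by (simp add: u_def v_def power_mult_distrib mod_mult_eq)
  ultimately have "x * y mod 3 = 1 \<and> u * v mod 5 = 4 \<or> x * y mod 3 = 2 \<and> u * v mod 5 = 1"
    using assms(1) by (simp add: char_neg_def cong_def)
  then show ?thesis using assms(2) xy uv unfolding m by (elim disjE) simp_all
qed

lemma char_neg_coprime: "char_neg F \<Longrightarrow> coprime (nm15 F) 15"
proof -
  assume m: "char_neg F"
  have "\<not> 3 dvd nm5 F"
    using m cong_dvd_iff[of "nm5 F" 1 3] cong_dvd_iff[of "nm5 F" "- 1" 3] by (auto simp: char_neg_def)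
  then have "\<not> 3 dvd (nm5 F)\<^sup>2" using prime_dvd_power[of "3::int"] by auto
  then have 3: "\<not> 3 dvd nm15 F" using cong_dvd_iff[OF nm15_mod3[of F]] by simp
  have "\<not> 5 dvd (nm3 F)\<^sup>2"
    using m cong_dvd_iff[of "(nm3 F)\<^sup>2" 1 5] cong_dvd_iff[of "(nm3 F)\<^sup>2" "- 1" 5] by (auto simp: char_neg_def)
  then have "\<not> 5 dvd nm3 F" by (auto simp: power2_eq_square)
  then have "\<not> 5 dvd nm3 F ^ 4" using prime_dvd_power[of "5::int"] by auto
  then have "\<not> 5 dvd nm15 F" using cong_dvd_iff[OF nm15_mod5[of F]] by simp
  then show ?thesis using 3 by (simp add: coprime_15_iff)
qed

lemma good_prime_iff:
  "good_prime p \<longleftrightarrow> prime p \<and> [p = 1] (mod 15) \<and> (\<exists>j<15. \<exists>s\<in>{1, -1}. \<exists>g. of_nat p = N15 (good_form s j g))"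
  by (simp only: good_prime_def good_form_def cyclotomic_3 cyclotomic_5 Phi3_def Phi5_def)

text \<open>With \<open>good_primeD\<close> this frees goodness from the shape of the polynomial:
  all that counts is an element of norm \<open>p\<close> and character -1.\<close>

lemma good_primeI:
  assumes "prime p" "p mod 15 = 1" "nm15 G = int p" "char_neg G"
  shows "good_prime p"
proof -
  obtain s j g where "s \<in> {1, -1}" "j < 15" and N: "nm15 (good_form s j g) = int p"
    using good_form_exists[OF assms(4)] assms(3) by metis
  moreover have "of_nat p = N15 (good_form s j g)" unfolding N15_eq N by simp
  moreover have "[p = 1] (mod 15)" using assms(2) by (simp add: cong_def)
  ultimately show ?thesis using assms(1) unfolding good_prime_iff by blast
qed

lemma good_primeD: "good_prime p \<Longrightarrow> \<exists>G. nm15 G = int p \<and> char_neg G"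
proof -
  assume "good_prime p"
  then obtain s j g where s: "s \<in> {1, -1}" and "of_nat p = N15 (good_form s j g)"
    unfolding good_prime_iff by blast
  then have "of_int (nm15 (good_form s j g)) = (of_int (int p) :: complex)" unfolding N15_eq by simp
  then have "nm15 (good_form s j g) = int p" by (simp only: of_int_eq_iff)
  then show ?thesis using char_neg_good_form[OF s] by blast
qed

text \<open>A linear polynomial with an exact root of \<open>Phi3\<close> modulo \<open>p\<close>
  has norm divisible by \<open>p\<close> only once, so its divisor above \<open>p\<close> has norm
  \<open>p\<close>.\<close>

lemma norm3_prime:
  assumes p: "prime p" "p mod 15 mod 3 = 1"
  shows "\<exists>b. nm3 b = int p"
proof -
  have pp: "prime (int p)" using p by simp
  have d: "3 dvd p - 1" using dvd_minus_1_of_mod_15[OF p(2)] by simp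
  then obtain r where r: "int p dvd poly Phi3 r" using Phi3_root_exists p(1) by blast
  have "\<not> int p dvd 3"
  proof
    assume "int p dvd 3"
    then have "p dvd 3" by (metis int_dvd_int_iff of_nat_numeral)
    then have "p = 3" using primes_dvd_imp_eq[OF p(1), of 3] by simp
    then show False using p(2) by simp
  qed
  moreover have "[:4:] * Phi3 + [:-1, -2:] * pderiv Phi3 = [:3:]" by (simp add: Phi3_def pderiv_pCons)
  ultimately obtain x where x: "int p dvd poly Phi3 x" "\<not> (int p)\<^sup>2 dvd poly Phi3 x"
    using exact_root[OF pp r] by blast
  have N: "nm3 [:- x, 1:] = poly Phi3 x" by (rule n3.N_linear) simp
  then obtain G j where "nm3 G = int p ^ j" "1 \<le> j" "j \<le> 1"
    using e3.prime_divisor_bounded[OF p(1), of "[:- x, 1:]" 1] x by (auto simp: power2_eq_square)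
  then show ?thesis by (intro exI[of _ G]) (simp add: le_antisym)
qed

lemma norm5_prime:
  assumes p: "prime p" "p mod 15 mod 5 = 1"
  shows "\<exists>c. nm5 c = int p"
proof -
  have pp: "prime (int p)" using p by simp
  have d: "5 dvd p - 1" using dvd_minus_1_of_mod_15[OF p(2)] by simp
  then obtain r where r: "int p dvd poly Phi5 r" using Phi5_root_exists p(1) by blast
  have "\<not> int p dvd 5"
  proof
    assume "int p dvd 5"
    then have "p dvd 5" by (metis int_dvd_int_iff of_nat_numeral)
    then have "p = 5" using primes_dvd_imp_eq[OF p(1), of 5] by simp
    then show False using p(2) by simp
  qed
  moreover have "[:5, -4:] * Phi5 + [:0, -1, 1:] * pderiv Phi5 = [:5:]" by (simp add: Phi5_def pderiv_pCons)
  ultimately obtain x where x: "int p dvd poly Phi5 x" "\<not> (int p)\<^sup>2 dvd poly Phi5 x"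
    using exact_root[OF pp r] by blast
  have N: "nm5 [:- x, 1:] = poly Phi5 x" by (rule n5.N_linear) simp
  then obtain G j where "nm5 G = int p ^ j" "1 \<le> j" "j \<le> 1"
    using e5.prime_divisor_bounded[OF p(1), of "[:- x, 1:]" 1] x by (auto simp: power2_eq_square)
  then show ?thesis by (intro exI[of _ G]) (simp add: le_antisym)
qed

text \<open>\<open>prime_divisor\<close> leaves the exponent of \<open>p\<close> open, but goodness
  is about norm \<open>p\<close> itself. As \<open>p\<close> splits completely, it divides
  \<open>F\<close> at some conjugate of a root modulo \<open>p\<close>; the divisor belonging to
  that conjugate has norm \<open>p\<close> and divides both the linear polynomial and
  \<open>p\<close>, hence \<open>F\<close>.\<close>

lemma split_prime_divisor:
  assumes p: "prime p" "p mod 15 = 1" and F: "int p dvd nm15 F"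
  shows "\<exists>G F'. Phi15 dvd F - G * F' \<and> nm15 G = int p"
proof -
  have pp: "prime (int p)" using p by simp
  have c15: "\<not> int p dvd 15" using prime_not_dvd_coprime_15[of p] p by auto
  have d: "15 dvd p - 1" using dvd_minus_mod[of 15 p] p(2) by simp
  then obtain r where r: "int p dvd poly Phi15 r" using Phi15_root_exists p(1) by blast
  have "[nm15 F = (\<Prod>h\<in>hs15. poly F (r ^ h))] (mod int p)"
    using n15.N_cong_at[of F r] r cong_dvd_modulus by blast
  then have "int p dvd (\<Prod>h\<in>hs15. poly F (r ^ h))" using F cong_dvd_iff by blast
  then obtain h where h: "h \<in> hs15" "int p dvd poly F (r ^ h)"
    using iffD1[OF prime_dvd_prod_iff[OF n15.finite_hs pp, of "\<lambda>h. poly F (r ^ h)"]] by blast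
  have "int p dvd poly Phi15 (r ^ h)"
  proof -
    have "Phi15 dvd pcompose Phi15 (monom 1 h)"
      unfolding n15.Phi_dvd_iff
    proof
      fix z assume "z \<in> Z15"
      then have "z ^ h \<in> Z15" by (rule bij_betw_apply[OF n15.bij h(1)])
      then show "ev (pcompose Phi15 (monom 1 h)) z = 0" by (simp add: n15.root)
    qed
    then obtain K where "pcompose Phi15 (monom 1 h) = Phi15 * K" by (rule dvdE)
    from arg_cong[OF this, of "\<lambda>q. poly q r"] show ?thesis using r by (simp add: poly_pcompose poly_monom)
  qed
  moreover have "[:14, 14, 16, -4, 5, -10, -16:] * Phi15 + [:-1, 0, -1, -2, 1, -1, 1, 2:] * pderiv Phi15 = [:15:]"
    by (simp add: Phi15_def pderiv_pCons)
  ultimately obtain x where x: "int p dvd x - r ^ h" "int p dvd poly Phi15 x" "\<not> (int p)\<^sup>2 dvd poly Phi15 x"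
    using exact_root[OF pp] c15 by blast
  have N: "nm15 [:- x, 1:] = poly Phi15 x" by (rule n15.N_linear) simp
  then obtain G L p' j where G: "Phi15 dvd [:- x, 1:] - G * L" "Phi15 dvd [:int p:] - G * p'"
      "nm15 G = int p ^ j" "1 \<le> j" "j \<le> 1"
    using e15.prime_divisor_bounded[OF p(1), of "[:- x, 1:]" 1] x by (auto simp: power2_eq_square)
  have "int p dvd poly F x"
  proof -
    have "[:- (r ^ h), 1:] dvd F - [:poly F (r ^ h):]" by (simp add: poly_eq_0_iff_dvd[symmetric])
    then obtain K where "F - [:poly F (r ^ h):] = [:- (r ^ h), 1:] * K" by (rule dvdE)
    from arg_cong[OF this, of "\<lambda>q. poly q x"] have "poly F x = poly F (r ^ h) + (x - r ^ h) * poly K x"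
      by (simp add: algebra_simps)
    then show ?thesis using h(2) x(1) by simp
  qed
  then obtain c where c: "poly F x = int p * c" by (rule dvdE)
  have "[:- x, 1:] dvd F - [:poly F x:]" by (simp add: poly_eq_0_iff_dvd[symmetric])
  then obtain K where K: "F - [:poly F x:] = [:- x, 1:] * K" by (rule dvdE)
  have "Phi15 dvd F - G * (L * K + p' * [:c:])"
    unfolding n15.Phi_dvd_iff
  proof
    fix z assume z: "z \<in> Z15"
    have 1: "ev [:- x, 1:] z = ev G z * ev L z" "ev [:int p:] z = ev G z * ev p' z"
      using G(1,2) z unfolding n15.Phi_dvd_iff ev_diff ev_mult by auto
    have "ev F z = ev ([:- x, 1:] * K) z + ev [:poly F x:] z"
      using K by (metis diff_add_cancel ev_add)
    also have "\<dots> = ev [:- x, 1:] z * ev K z + ev [:int p:] z * ev [:c:] z" unfolding ev_mult by (simp add: c)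
    finally show "ev (F - G * (L * K + p' * [:c:])) z = 0"
      unfolding 1 ev_diff ev_mult ev_add by (simp add: algebra_simps)
  qed
  then show ?thesis using G(3,4,5) by (metis le_antisym power_one_right)
qed

text \<open>Divisors of character 1 are split off, among them those above primes 14 modulo 15; the
  norm drops and the cofactor keeps character -1. The process cannot reach norm 1, so it meets a
  divisor of norm \<open>p\<close> and character -1 with p = 1 modulo 15.\<close>

lemma good_prime_divisor:
  assumes "char_neg F" "\<And>p. prime p \<Longrightarrow> int p dvd nm15 F \<Longrightarrow> p mod 15 = 1 \<or> p mod 15 = 14"
  shows "\<exists>p. good_prime p \<and> int p dvd nm15 F"
  using assms
proof (induction "nat (nm15 F)" arbitrary: F rule: less_induct)
  case less
  have "nm15 F \<noteq> 0" using char_neg_coprime[OF less.prems(1)] by auto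
  then have pos: "0 < nm15 F" using n15.N_nonneg[of F] by simp
  have "nm15 F \<noteq> 1" using not_char_neg_unit less.prems(1) by blast
  then have "nat (nm15 F) \<noteq> 1" using pos by simp
  then obtain p where p: "prime p" "p dvd nat (nm15 F)" using prime_factor_nat by blast
  then have pd: "int p dvd nm15 F" using pos by (metis int_dvd_int_iff int_nat_eq less_imp_le)
  have step: ?case if G: "Phi15 dvd F - G * F'" "nm15 G = int p ^ j" "1 \<le> j" "\<not> char_neg G" for G F' j
  proof -
    have NF: "nm15 F = int p ^ j * nm15 F'" using n15.N_cong[OF G(1)] G(2) by simp
    have "char_neg F'" using char_neg_mult[of G F'] char_neg_cong[OF G(1)] less.prems(1) G(4) by blast
    moreover have "nat (nm15 F') < nat (nm15 F)"
    proof -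
      have "1 < int p ^ j" using G(3) prime_gt_1_nat[OF p(1)] by (intro one_less_power) auto
      moreover have "0 < nm15 F'" using pos NF n15.N_nonneg[of F'] by (metis less_le mult_zero_right)
      ultimately have "nm15 F' < nm15 F" unfolding NF by simp
      then show ?thesis using pos by simp
    qed
    moreover have "r mod 15 = 1 \<or> r mod 15 = 14" if "prime r" "int r dvd nm15 F'" for r
      using less.prems(2)[OF that(1)] that(2) NF by simp
    ultimately obtain r where "good_prime r" "int r dvd nm15 F'" using less.hyps by blast
    then show ?thesis using NF by auto
  qed
  consider "p mod 15 = 1" | "p mod 15 = 14" using less.prems(2)[OF p(1) pd] by blast
  then show ?case
  proof cases
    case 1
    obtain G F' where G: "Phi15 dvd F - G * F'" "nm15 G = int p" using split_prime_divisor[OF p(1) 1 pd] by blast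
    show ?thesis
    proof (cases "char_neg G")
      case True
      then show ?thesis using good_primeI[OF p(1) 1 G(2)] pd by blast
    next
      case False
      then show ?thesis using step[of G F' 1] G by simp
    qed
  next
    case 2
    obtain G F' p' j where G: "Phi15 dvd F - G * F'" "nm15 G = int p ^ j" "1 \<le> j"
      using e15.prime_divisor[OF p(1) pd] by blast
    then show ?thesis using step not_char_neg_14[OF p(1) 2] by blast
  qed
qed

section \<open>The cofactors of 9 and 25\<close>

definition special :: "int \<Rightarrow> bool" where
  "special k \<longleftrightarrow> (\<exists>(m :: int) (p :: nat). gcd m 15 = 1 \<and> prime p \<and>
            (k = m * int p \<and>
               ([p = 7] (mod 15) \<or> [p = 11] (mod 15) \<or> [p = 13] (mod 15) \<or>
                ([p = 1] (mod 15) \<and> good_prime p))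
             \<or> k = m * int p ^ 2 \<and> [p = 4] (mod 15)
             \<or> k = m * int p ^ 4 \<and> ([p = 2] (mod 15) \<or> [p = 8] (mod 15))))"

text \<open>Primes 7 and 13 modulo 15 are norms of order 3, primes 11 are norms of order 5, and the
  other cases provide elements of order 15 with character -1. The cofactor \<open>m\<close> is a
  determinant by itself.\<close>

lemma special_S15:
  assumes "special k"
  shows "9 * k \<in> S15" "25 * k \<in> S15"
proof -
  obtain m p where m: "gcd m 15 = 1" and p: "prime p" and c:
      "k = m * int p \<and> ([p = 7] (mod 15) \<or> [p = 11] (mod 15) \<or> [p = 13] (mod 15) \<or> ([p = 1] (mod 15) \<and> good_prime p))
       \<or> k = m * int p ^ 2 \<and> [p = 4] (mod 15) \<or> k = m * int p ^ 4 \<and> ([p = 2] (mod 15) \<or> [p = 8] (mod 15))"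
    using assms unfolding special_def by (elim exE conjE) (rule that; assumption)
  have cases:
      "k = m * int p \<and> (p mod 15 = 7 \<or> p mod 15 = 11 \<or> p mod 15 = 13 \<or> good_prime p)
       \<or> k = m * int p ^ 2 \<and> p mod 15 = 4 \<or> k = m * int p ^ 4 \<and> (p mod 15 = 2 \<or> p mod 15 = 8)"
    using c by (elim disjE conjE) (simp_all add: cong_def)
  have mS: "m \<in> S15" using S15_coprime m by (simp add: coprime_iff_gcd_eq_1)
  have "\<exists>x. k = m * x \<and> 9 * x \<in> S15 \<and> 25 * x \<in> S15"
    using cases
  proof (elim disjE conjE)
    have split3: "9 * int p \<in> S15 \<and> 25 * int p \<in> S15" if p15: "p mod 15 = 7 \<or> p mod 15 = 13"
    proof -
      have "p mod 15 mod 3 = 1" using p15 by (elim disjE) simp_all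
      then obtain b where b: "nm3 b = int p" using norm3_prime[OF p] by blast
      have "int p mod 5 = 2 \<or> int p mod 5 = 3" using p15 unfolding int_mod_eq by (elim disjE) simp_all
      then have "[int p = 2] (mod 5) \<or> [int p = 3] (mod 5)" by (simp add: cong_def)
      moreover have "\<not> 3 dvd int p" using prime_not_dvd_coprime_15(1)[OF p] p15 coprime_15_iff by auto
      ultimately show ?thesis using S15_norm3[OF b] by blast
    qed
    { assume "k = m * int p" "p mod 15 = 7" then show ?thesis using split3 by blast }
    { assume "k = m * int p" "p mod 15 = 13" then show ?thesis using split3 by blast }
    { assume k: "k = m * int p" and p15: "p mod 15 = 11"
      then obtain c where c: "nm5 c = int p" using norm5_prime[OF p] by auto
      have "int p mod 3 = 2" unfolding int_mod_eq p15 by simp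
      then have "[int p = 2] (mod 3)" by (simp add: cong_def)
      moreover have "\<not> 5 dvd int p" using prime_not_dvd_coprime_15(1)[OF p] p15 coprime_15_iff by auto
      ultimately show ?thesis using S15_norm5[OF c] k by blast }
    { assume k: "k = m * int p" and "good_prime p"
      then obtain G where "nm15 G = int p" "char_neg G" using good_primeD by blast
      then show ?thesis using S15_char_neg[of G] k by (metis (no_types, lifting)) }
    { assume k: "k = m * int p ^ 2" and "p mod 15 = 4"
      then obtain G where "nm15 G = int p ^ 2" "char_neg G" using char_neg_norm_4[OF p] by blast
      then show ?thesis using S15_char_neg[of G] k by (metis (no_types, lifting)) }
    { assume k: "k = m * int p ^ 4" and "p mod 15 = 2"
      then obtain G where "nm15 G = int p ^ 4" "char_neg G" using char_neg_norm_2_8[OF p] by blast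
      then show ?thesis using S15_char_neg[of G] k by (metis (no_types, lifting)) }
    { assume k: "k = m * int p ^ 4" and "p mod 15 = 8"
      then obtain G where "nm15 G = int p ^ 4" "char_neg G" using char_neg_norm_2_8[OF p] by blast
      then show ?thesis using S15_char_neg[of G] k by (metis (no_types, lifting)) }
  qed
  then obtain x where x: "k = m * x" "9 * x \<in> S15" "25 * x \<in> S15" by blast
  show "9 * k \<in> S15" using S15_mult[OF mS x(2)] by (simp add: x(1) mult.left_commute)
  show "25 * k \<in> S15" using S15_mult[OF mS x(3)] by (simp add: x(1) mult.left_commute)
qed

context
  fixes k :: int
  assumes k15: "coprime k 15" and not_special: "\<not> special k"
begin

lemma cofactor_coprime: "k = m * x \<Longrightarrow> gcd m 15 = 1"
  using k15 by (simp add: coprime_iff_gcd_eq_1[symmetric])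

lemma prime_divisor_cases:
  assumes "prime p" "int p dvd k"
  shows "p mod 15 = 1 \<and> \<not> good_prime p \<or> p mod 15 = 2 \<and> \<not> int p ^ 4 dvd k \<or> p mod 15 = 4 \<and> \<not> int p ^ 2 dvd k
    \<or> p mod 15 = 8 \<and> \<not> int p ^ 4 dvd k \<or> p mod 15 = 14"
proof -
  have "coprime (int p) 15" using k15 assms(2) coprime_divisors by (metis dvd_refl)
  note c = coprime_15_mod[OF this, unfolded int_mod_eq(1)]
  define n where "n = p mod 15"
  have "n = 1 \<or> n = 2 \<or> n = 4 \<or> n = 7 \<or> n = 8 \<or> n = 11 \<or> n = 13 \<or> n = 14"
    using c unfolding n_def[symmetric] by presburger
  then have r: "p mod 15 = 1 \<or> p mod 15 = 2 \<or> p mod 15 = 4 \<or> p mod 15 = 7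
      \<or> p mod 15 = 8 \<or> p mod 15 = 11 \<or> p mod 15 = 13 \<or> p mod 15 = 14"
    unfolding n_def .
  obtain m where m: "k = m * int p" using assms(2) by (metis dvdE mult.commute)
  have "p mod 15 \<noteq> 7" "p mod 15 \<noteq> 11" "p mod 15 \<noteq> 13" "\<not> (p mod 15 = 1 \<and> good_prime p)"
    using not_special m cofactor_coprime[OF m] assms(1) unfolding special_def by (auto simp: cong_def)
  moreover have "\<not> int p ^ 2 dvd k" if "p mod 15 = 4"
  proof
    assume "int p ^ 2 dvd k"
    then obtain m where m: "k = m * int p ^ 2" by (metis dvdE mult.commute)
    then show False using not_special cofactor_coprime[OF m] assms(1) that unfolding special_def by (auto simp: cong_def)
  qed
  moreover have "\<not> int p ^ 4 dvd k" if "p mod 15 = 2 \<or> p mod 15 = 8"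
  proof
    assume "int p ^ 4 dvd k"
    then obtain m where m: "k = m * int p ^ 4" by (metis dvdE mult.commute)
    then show False using not_special cofactor_coprime[OF m] assms(1) that unfolding special_def by (auto simp: cong_def)
  qed
  ultimately show ?thesis using r by blast
qed

lemma power_mod_mod: "int p ^ j mod n = (int (p mod 15) mod n) ^ j mod n" if "n dvd 15" for p j
proof -
  have "int (p mod 15) mod n = int p mod n" using that by (simp add: zmod_int mod_mod_cancel)
  then show ?thesis by (simp add: power_mod)
qed

lemma order_2_8_5: "p mod 15 = 2 \<or> p mod 15 = 8 \<Longrightarrow> [int p ^ j = 1] (mod 5) \<Longrightarrow> 1 \<le> j \<Longrightarrow> 4 \<le> j"
proof (rule ccontr)
  assume p: "p mod 15 = 2 \<or> p mod 15 = 8" and c: "[int p ^ j = 1] (mod 5)" and j: "1 \<le> j" "\<not> 4 \<le> j"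
  have "j = 1 \<or> j = 2 \<or> j = 3" using j by presburger
  moreover have "(int (p mod 15) mod 5) ^ j mod 5 = 1" using c power_mod_mod[of 5 p j] by (simp add: cong_def)
  ultimately show False using p by (elim disjE) simp_all
qed

text \<open>Prime powers in the norm are 1 modulo 5. For primes 4 this requires the square, for
  primes 2 and 8 the fourth power, and neither divides \<open>k\<close>. There remain primes 1, and
  primes 14 with even exponent, whose powers are 1 modulo 3.\<close>

lemma nm5_cong_1:
  assumes "nm5 C dvd k"
  shows "[nm5 C = 1] (mod 3)"
proof -
  have k0: "k \<noteq> 0" using k15 by auto
  have cop: "coprime (nm5 C) 5"
    using k15 assms coprime_divisors[of "nm5 C" k 5 15] by simp
  have "[(nm5 C) ^ 1 = 1] (mod 3)"
  proof (rule e5.N_power_cong_1[OF _ cop])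
    show "nm5 C \<noteq> 0" using assms k0 by auto
    fix p j assume p: "prime p" "int p dvd nm5 C" and j: "[int p ^ j = 1] (mod 5)"
    have pk: "int p dvd k" using p(2) assms dvd_trans by blast
    have "coprime (int p) 5" using p(2) cop coprime_divisors by (metis dvd_refl)
    then obtain i where i: "1 \<le> i" "[int p ^ i = 1] (mod 5)" "int p ^ i dvd nm5 C"
      using e5.prime_power_dvd_N[OF p] by blast
    have ik: "int p ^ i dvd k" using i(3) assms dvd_trans by blast
    have "p mod 15 = 1 \<or> p mod 15 = 14"
      using prime_divisor_cases[OF p(1) pk]
    proof (elim disjE conjE)
      assume "p mod 15 = 4" "\<not> int p ^ 2 dvd k"
      have "i \<noteq> 1" using i(2) power_mod_mod[of 5 p i] \<open>p mod 15 = 4\<close> by (auto simp: cong_def)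
      then have "int p ^ 2 dvd int p ^ i" using i(1) by (intro le_imp_power_dvd) simp
      then show ?thesis using \<open>\<not> int p ^ 2 dvd k\<close> ik dvd_trans by blast
    next
      assume "p mod 15 = 2" "\<not> int p ^ 4 dvd k"
      then show ?thesis using order_2_8_5[of p i] i ik le_imp_power_dvd dvd_trans by blast
    next
      assume "p mod 15 = 8" "\<not> int p ^ 4 dvd k"
      then show ?thesis using order_2_8_5[of p i] i ik le_imp_power_dvd dvd_trans by blast
    qed auto
    then have "int p ^ j mod 3 = 1"
    proof
      assume "p mod 15 = 14"
      have "even j"
      proof (rule ccontr)
        assume "odd j"
        have "[int p = - 1] (mod 5)" using int_mod_eq(3)[of p] \<open>p mod 15 = 14\<close> by (simp add: cong_def)
        then have "[int p ^ j = (- 1) ^ j] (mod 5)" by (rule cong_pow)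
        then have "[1 = - 1] (mod (5::int))" using j \<open>odd j\<close> by (simp add: cong_def)
        then show False by (simp add: cong_def)
      qed
      have "[int p = - 1] (mod 3)" using int_mod_eq(2)[of p] \<open>p mod 15 = 14\<close> by (simp add: cong_def)
      then have "[int p ^ j = (- 1) ^ j] (mod 3)" by (rule cong_pow)
      then show ?thesis using \<open>even j\<close> by (simp add: cong_def)
    next
      assume "p mod 15 = 1"
      then show ?thesis using power_mod_mod[of 3 p j] by simp
    qed
    then show "[(int p ^ j) ^ 1 = 1] (mod 3)" by (simp add: cong_def)
  qed
  then show ?thesis by simp
qed

text \<open>Primes 1, 4 and 14 have square 1 modulo 5. Primes 2 and 8 have square -1 modulo 5, but
  they are -1 modulo 3 and so enter with even exponent.\<close>

lemma nm3_square_cong_1: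
  assumes "nm3 B dvd k"
  shows "[(nm3 B)\<^sup>2 = 1] (mod 5)"
proof -
  have k0: "k \<noteq> 0" using k15 by auto
  have cop: "coprime (nm3 B) 3"
    using k15 assms coprime_divisors[of "nm3 B" k 3 15] by simp
  show ?thesis
  proof (rule e3.N_power_cong_1[OF _ cop])
    show "nm3 B \<noteq> 0" using assms k0 by auto
    fix p j assume p: "prime p" "int p dvd nm3 B" and j: "[int p ^ j = 1] (mod 3)"
    have pk: "int p dvd k" using p(2) assms dvd_trans by blast
    have "p mod 15 = 1 \<or> p mod 15 = 4 \<or> p mod 15 = 14 \<or> p mod 15 = 2 \<or> p mod 15 = 8"
      using prime_divisor_cases[OF p(1) pk] by blast
    then consider "[(int p)\<^sup>2 = 1] (mod 5)" | "[int p = - 1] (mod 3)" "[(int p)\<^sup>2 = - 1] (mod 5)"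
    proof -
      have sq: "(int p)\<^sup>2 mod 5 = (int (p mod 15) mod 5)\<^sup>2 mod 5" using power_mod_mod[of 5 p 2] by simp
      have m3: "int p mod 3 = int (p mod 15 mod 3)" by (rule int_mod_eq)
      assume "p mod 15 = 1 \<or> p mod 15 = 4 \<or> p mod 15 = 14 \<or> p mod 15 = 2 \<or> p mod 15 = 8"
      then show thesis using that sq m3 by (elim disjE) (simp_all add: cong_def)
    qed
    then show "[(int p ^ j)\<^sup>2 = 1] (mod 5)"
    proof cases
      case 1
      then have "[((int p)\<^sup>2) ^ j = 1 ^ j] (mod 5)" by (rule cong_pow)
      then show ?thesis by (simp add: power_mult[symmetric] mult.commute)
    next
      case 2
      have "even j"
      proof (rule ccontr)
        assume "odd j"
        have "[int p ^ j = (- 1) ^ j] (mod 3)" using 2(1) by (rule cong_pow)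
        then have "[1 = - 1] (mod (3::int))" using j \<open>odd j\<close> by (simp add: cong_def)
        then show False by (simp add: cong_def)
      qed
      have "[((int p)\<^sup>2) ^ j = (- 1) ^ j] (mod 5)" using 2(2) by (rule cong_pow)
      then show ?thesis using \<open>even j\<close> by (simp add: power_mult[symmetric] mult.commute)
    qed
  qed
qed

text \<open>The argument with orders leaves only primes 1 and 14 in \<open>nm15 F\<close>. Character
  -1 would then yield a good prime dividing \<open>k\<close>.\<close>

lemma not_char_neg:
  assumes "nm15 F dvd k"
  shows "\<not> char_neg F"
proof
  assume m: "char_neg F"
  have "p mod 15 = 1 \<or> p mod 15 = 14" if p: "prime p" "int p dvd nm15 F" for p
  proof -
    have pk: "int p dvd k" using p(2) assms dvd_trans by blast
    have "coprime (int p) 15" using p(2) char_neg_coprime[OF m] coprime_divisors by (metis dvd_refl)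
    then obtain i where i: "1 \<le> i" "[int p ^ i = 1] (mod 15)" "int p ^ i dvd nm15 F"
      using e15.prime_power_dvd_N[OF p] by blast
    have i5: "[int p ^ i = 1] (mod 5)" using i(2) by (rule cong_dvd_modulus) simp
    have ik: "int p ^ i dvd k" using i(3) assms dvd_trans by blast
    show ?thesis
      using prime_divisor_cases[OF p(1) pk]
    proof (elim disjE conjE)
      assume "p mod 15 = 4" "\<not> int p ^ 2 dvd k"
      have "i \<noteq> 1" using i5 power_mod_mod[of 5 p i] \<open>p mod 15 = 4\<close> by (auto simp: cong_def)
      then have "int p ^ 2 dvd int p ^ i" using i(1) by (intro le_imp_power_dvd) simp
      then show ?thesis using \<open>\<not> int p ^ 2 dvd k\<close> ik dvd_trans by blast
    next
      assume "p mod 15 = 2" "\<not> int p ^ 4 dvd k"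
      then show ?thesis using order_2_8_5[of p i] i(1) i5 ik le_imp_power_dvd dvd_trans by blast
    next
      assume "p mod 15 = 8" "\<not> int p ^ 4 dvd k"
      then show ?thesis using order_2_8_5[of p i] i(1) i5 ik le_imp_power_dvd dvd_trans by blast
    qed auto
  qed
  then obtain p where p: "good_prime p" "int p dvd nm15 F" using good_prime_divisor[OF m] by blast
  then have "prime p" "p mod 15 = 1" by (auto simp: good_prime_def cong_def)
  moreover have "int p dvd k" using p(2) assms dvd_trans by blast
  ultimately show False using prime_divisor_cases[of p] p(1) by simp
qed

end

section \<open>The classification\<close>

text \<open>As 3 is inert at order 5, \<open>F\<close> is 3 times an element there, and the norm of
  3 is 81.\<close>

lemma nm5_dvd_81: "3 dvd nm5 F \<Longrightarrow> 81 dvd nm5 F"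
proof -
  assume "3 dvd nm5 F"
  then obtain U V where "F = smult 3 U + Phi5 * V" using nm5_dvd3[of F] by (auto simp: icong_def)
  then have "Phi5 dvd F - smult 3 U" by simp
  then have "nm5 F = 3 ^ 4 * nm5 U" using n5.N_cong[of F "smult 3 U"] by (simp add: n5.N_smult)
  then show ?thesis by simp
qed

lemma nm3_dvd_25: "5 dvd nm3 F \<Longrightarrow> 25 dvd nm3 F"
proof -
  assume "5 dvd nm3 F"
  then obtain U V where "F = smult 5 U + Phi3 * V" using nm3_dvd5[of F] by (auto simp: icong_def)
  then have "Phi3 dvd F - smult 5 U" by simp
  then have "nm3 F = 5 ^ 2 * nm3 U" using n3.N_cong[of F "smult 5 U"] by (simp add: n3.N_smult)
  then show ?thesis by simp
qed

text \<open>At 3 the factors pair up: F(1) with \<open>nm3\<close>, and \<open>nm5\<close> with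
  \<open>nm15\<close>, divisible together or not at all. The second pair brings at least 81, so an
  exact 9 can only come from the first.\<close>

lemma measure15_dvd_3:
  assumes "3 dvd measure15 F"
  shows "27 dvd measure15 F \<or> 3 dvd poly F 1 \<and> 3 dvd nm3 F"
proof -
  have p3: "prime (3::int)" by simp
  have "3 dvd poly F 1 \<or> 3 dvd nm3 F \<or> 3 dvd nm5 F \<or> 3 dvd nm15 F"
    using assms unfolding measure15_def prime_dvd_mult_iff[OF p3] by blast
  moreover have "3 dvd nm3 F \<longleftrightarrow> 3 dvd poly F 1"
    using cong_dvd_iff[OF nm3_mod3[of F]] prime_dvd_power_iff[OF p3, of 2] by simp
  moreover have "3 dvd nm15 F \<longleftrightarrow> 3 dvd nm5 F"
    using cong_dvd_iff[OF nm15_mod3[of F]] prime_dvd_power_iff[OF p3, of 2] by simp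
  moreover have "27 dvd measure15 F" if "3 dvd nm5 F"
  proof -
    have "(27::int) dvd 81" by simp
    then have "27 dvd nm5 F" using nm5_dvd_81[OF that] dvd_trans by blast
    then show ?thesis unfolding measure15_def by simp
  qed
  ultimately show ?thesis by blast
qed

text \<open>The pairs at 5 are F(1) with \<open>nm5\<close>, and \<open>nm3\<close> with
  \<open>nm15\<close>; the second brings 25 and a further 5.\<close>

lemma measure15_dvd_5:
  assumes "5 dvd measure15 F"
  shows "125 dvd measure15 F \<or> 5 dvd poly F 1 \<and> 5 dvd nm5 F"
proof -
  have p5: "prime (5::int)" by simp
  have "5 dvd poly F 1 \<or> 5 dvd nm3 F \<or> 5 dvd nm5 F \<or> 5 dvd nm15 F"
    using assms unfolding measure15_def prime_dvd_mult_iff[OF p5] by blast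
  moreover have "5 dvd nm5 F \<longleftrightarrow> 5 dvd poly F 1"
    using cong_dvd_iff[OF nm5_mod5[of F]] prime_dvd_power_iff[OF p5, of 4] by simp
  moreover have c: "5 dvd nm15 F \<longleftrightarrow> 5 dvd nm3 F"
    using cong_dvd_iff[OF nm15_mod5[of F]] prime_dvd_power_iff[OF p5, of 4] by simp
  moreover have "125 dvd measure15 F" if "5 dvd nm3 F"
  proof -
    have "25 * 5 dvd nm3 F * nm15 F" using nm3_dvd_25[OF that] c that by (intro mult_dvd_mono) auto
    then have "125 dvd (poly F 1 * nm5 F) * (nm3 F * nm15 F)" using dvd_mult[of 125] by simp
    then show ?thesis unfolding measure15_def by (simp add: mult_ac)
  qed
  ultimately show ?thesis by blast
qed

text \<open>If \<open>k\<close> were not special, \<open>nm5 F\<close> would be 1 modulo 3 and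
  \<open>nm3 B\<close> would have square 1 modulo 5. The factor 3 of \<open>nm3 F\<close>
  contributes 9 = -1, so \<open>F\<close> would have character -1 although \<open>nm15 F\<close>
  divides \<open>k\<close>.\<close>

lemma special_of_9:
  assumes x: "measure15 F = 9 * k" and k: "coprime k 15"
  shows "special k"
proof (rule ccontr)
  assume ns: "\<not> special k"
  have "\<not> 3 dvd k" using k by (simp add: coprime_15_iff)
  then have "\<not> 27 dvd measure15 F" unfolding x by presburger
  then have 3: "3 dvd poly F 1" "3 dvd nm3 F" using measure15_dvd_3[of F] x by auto
  obtain A where A: "poly F 1 = 3 * A" using 3(1) by (rule dvdE)
  obtain B where B: "Phi3 dvd F - [:-1, 1:] * B" using divide_by_x_minus_1[OF 3(1) Phi3_at_1] by blast
  have n3: "nm3 F = 3 * nm3 B" using n3.N_cong[OF B] by (simp only: n3.N_mult norm_x_minus_1)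
  have "9 * k = 9 * (A * nm3 B * nm5 F * nm15 F)" using x unfolding measure15_def A n3 by simp
  then have keq: "k = A * nm3 B * nm5 F * nm15 F" by simp
  have "[nm5 F = 1] (mod 3)" by (rule nm5_cong_1[OF k ns]) (simp add: keq)
  moreover have "[(nm3 F)\<^sup>2 = - 1] (mod 5)"
  proof -
    have "[(nm3 B)\<^sup>2 = 1] (mod 5)" by (rule nm3_square_cong_1[OF k ns]) (simp add: keq)
    then have "[9 * (nm3 B)\<^sup>2 = 9 * 1] (mod 5)" by (rule cong_scalar_left)
    then show ?thesis by (simp add: n3 power_mult_distrib cong_def)
  qed
  ultimately have "char_neg F" by (simp add: char_neg_def)
  moreover have "\<not> char_neg F" by (rule not_char_neg[OF k ns]) (simp add: keq)
  ultimately show False by blast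
qed

text \<open>Here the sign comes from the factor 5 of \<open>nm5 F\<close>, which is -1 modulo 3,
  while \<open>(nm3 F)\<^sup>2\<close> is 1 modulo 5.\<close>

lemma special_of_25:
  assumes x: "measure15 F = 25 * k" and k: "coprime k 15"
  shows "special k"
proof (rule ccontr)
  assume ns: "\<not> special k"
  have "\<not> 5 dvd k" using k by (simp add: coprime_15_iff)
  then have "\<not> 125 dvd measure15 F" unfolding x by presburger
  then have 5: "5 dvd poly F 1" "5 dvd nm5 F" using measure15_dvd_5[of F] x by auto
  obtain A where A: "poly F 1 = 5 * A" using 5(1) by (rule dvdE)
  obtain C where C: "Phi5 dvd F - [:-1, 1:] * C" using divide_by_x_minus_1[OF 5(1) Phi5_at_1] by blast
  have n5: "nm5 F = 5 * nm5 C" using n5.N_cong[OF C] by (simp only: n5.N_mult norm_x_minus_1)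
  have "25 * k = 25 * (A * nm3 F * nm5 C * nm15 F)" using x unfolding measure15_def A n5 by simp
  then have keq: "k = A * nm3 F * nm5 C * nm15 F" by simp
  have "[nm5 C = 1] (mod 3)" by (rule nm5_cong_1[OF k ns]) (simp add: keq)
  then have "[5 * nm5 C = 5 * 1] (mod 3)" by (rule cong_scalar_left)
  then have "[nm5 F = - 1] (mod 3)" by (simp add: n5 cong_def)
  moreover have "[(nm3 F)\<^sup>2 = 1] (mod 5)" by (rule nm3_square_cong_1[OF k ns]) (simp add: keq)
  ultimately have "char_neg F" by (simp add: char_neg_def)
  moreover have "\<not> char_neg F" by (rule not_char_neg[OF k ns]) (simp add: keq)
  ultimately show False by blast
qed

lemma prime_power_decomposition:
  fixes x q :: int
  assumes "prime q" "q ^ 2 dvd x" "x \<noteq> 0"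
  shows "\<exists>t m. 2 \<le> t \<and> x = q ^ t * m \<and> \<not> q dvd m"
proof -
  have "\<not> is_unit q" using assms(1) by auto
  then obtain m where m: "x = q ^ multiplicity q x * m" "\<not> q dvd m"
    using multiplicity_decompose'[of x q] assms(3) by metis
  have "2 \<le> multiplicity q x"
    using assms \<open>\<not> is_unit q\<close> by (intro multiplicity_geI) auto
  then show ?thesis using m by blast
qed

lemma S15_cases:
  assumes "x \<in> S15"
  shows "225 dvd x \<or> coprime x 15
    \<or> (\<exists>q t m. q \<in> {3, 5} \<and> t \<ge> 3 \<and> coprime m 15 \<and> x = q ^ t * m)
    \<or> (\<exists>q k. q \<in> {3, 5} \<and> special k \<and> x = q ^ 2 * k)"
proof -
  obtain F where F: "x = measure15 F" using assms S15_eq by blast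
  have 9: "9 dvd x" if "3 dvd x"
    using measure15_dvd_3[OF that[unfolded F]] unfolding F
  proof (elim disjE)
    assume "27 dvd measure15 F"
    then show "9 dvd measure15 F" by (rule dvd_trans[rotated]) simp
  next
    assume "3 dvd poly F 1 \<and> 3 dvd nm3 F"
    then have "3 * 3 dvd poly F 1 * nm3 F" by (intro mult_dvd_mono) auto
    then show "9 dvd measure15 F" unfolding measure15_def by simp
  qed
  have 25: "25 dvd x" if "5 dvd x"
    using measure15_dvd_5[OF that[unfolded F]] unfolding F
  proof (elim disjE)
    assume "125 dvd measure15 F"
    then show "25 dvd measure15 F" by (rule dvd_trans[rotated]) simp
  next
    assume "5 dvd poly F 1 \<and> 5 dvd nm5 F"
    then have "5 * 5 dvd poly F 1 * nm5 F" by (intro mult_dvd_mono) auto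
    then have "25 dvd (poly F 1 * nm5 F) * (nm3 F * nm15 F)" by simp
    then show "25 dvd measure15 F" unfolding measure15_def by (simp add: mult_ac)
  qed
  consider "3 dvd x" "5 dvd x" | "\<not> 3 dvd x" "\<not> 5 dvd x" | "3 dvd x" "\<not> 5 dvd x" | "\<not> 3 dvd x" "5 dvd x" by blast
  then show ?thesis
  proof cases
    case 1
    have "coprime (9::int) 25" by (simp add: coprime_iff_gcd_eq_1 gcd_non_0_int)
    then have "9 * 25 dvd x" using 9[OF 1(1)] 25[OF 1(2)] by (intro divides_mult)
    then show ?thesis by simp
  next
    case 2
    then show ?thesis by (simp add: coprime_15_iff)
  next
    case 3
    then have "x \<noteq> 0" by auto
    then obtain t m where tm: "2 \<le> t" "x = 3 ^ t * m" "\<not> 3 dvd m"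
      using prime_power_decomposition[of 3 x] 9[OF 3(1)] by auto
    have m: "coprime m 15" using tm 3(2) by (auto simp: coprime_15_iff)
    show ?thesis
    proof (cases "t = 2")
      case True
      then have "special m" using special_of_9[of F m] tm m F by simp
      then show ?thesis using tm True by blast
    next
      case False
      then have "3 \<le> t" using tm by simp
      then show ?thesis using tm m by blast
    qed
  next
    case 4
    then have "x \<noteq> 0" by auto
    then obtain t m where tm: "2 \<le> t" "x = 5 ^ t * m" "\<not> 5 dvd m"
      using prime_power_decomposition[of 5 x] 25[OF 4(2)] by auto
    have m: "coprime m 15" using tm 4(1) by (auto simp: coprime_15_iff)
    show ?thesis
    proof (cases "t = 2")
      case True
      then have "special m" using special_of_25[of F m] tm m F by simp
      then show ?thesis using tm True by blast
    next
      case False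
      then have "3 \<le> t" using tm by simp
      then show ?thesis using tm m by blast
    qed
  qed
qed

theorem theorem3:
  shows "S15 =
      {15 ^ 2 * z | z :: int. True}
    \<union> {m :: int. gcd m 15 = 1}
    \<union> {q ^ t * m | (q :: int) (t :: nat) (m :: int). q \<in> {3, 5} \<and> t \<ge> 3 \<and> gcd m 15 = 1}
    \<union> {q ^ 2 * k | (q :: int) (k :: int). q \<in> {3, 5} \<and>
         (\<exists>(m :: int) (p :: nat). gcd m 15 = 1 \<and> prime p \<and>
            (k = m * int p \<and>
               ([p = 7] (mod 15) \<or> [p = 11] (mod 15) \<or> [p = 13] (mod 15) \<or>
                ([p = 1] (mod 15) \<and> good_prime p))
             \<or> k = m * int p ^ 2 \<and> [p = 4] (mod 15)
             \<or> k = m * int p ^ 4 \<and> ([p = 2] (mod 15) \<or> [p = 8] (mod 15))))}"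
  unfolding special_def[symmetric] unfolding coprime_iff_gcd_eq_1[symmetric]
proof (intro Set.equalityI subsetI)
  fix x assume "x \<in> S15"
  from S15_cases[OF this]
  show "x \<in> {15 ^ 2 * z | z. True} \<union> {m. coprime m 15}
      \<union> {q ^ t * m | q t m. q \<in> {3, 5} \<and> t \<ge> 3 \<and> coprime m 15} \<union> {q ^ 2 * k | q k. q \<in> {3, 5} \<and> special k}"
  proof (elim disjE)
    assume "225 dvd x"
    then obtain z where "x = 15 ^ 2 * z" by (auto elim!: dvdE)
    then show ?thesis by blast
  qed blast+
next
  fix x :: int
  assume "x \<in> {15 ^ 2 * z | z. True} \<union> {m. coprime m 15}
      \<union> {q ^ t * m | q t m. q \<in> {3, 5} \<and> t \<ge> 3 \<and> coprime m 15} \<union> {q ^ 2 * k | q k. q \<in> {3, 5} \<and> special k}"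
  then consider z where "x = 15 ^ 2 * z" | "coprime x 15"
    | q t m where "x = q ^ t * m" "q \<in> {3, 5}" "t \<ge> 3" "coprime m 15"
    | q k where "x = q ^ 2 * k" "q \<in> {3, 5}" "special k"
    by blast
  then show "x \<in> S15"
  proof cases
    case 1
    then show ?thesis using S15_multiples_225 by simp
  next
    case 2
    then show ?thesis by (rule S15_coprime)
  next
    case 3
    then show ?thesis using S15_power_3 S15_power_5 by (auto simp: coprime_15_iff)
  next
    case 4
    then show ?thesis using special_S15 by auto
  qed
qed

end
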